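(* Let $p$ be a prime. For all $\beta, \gamma>0$ there exists $\varepsilon>0$ such that for all $\alpha>0$ there is a value of $c$ for which the following holds. Let $A$ and $B$ be subsets of $\mathbb{Z}_p$ and let $1 \leq c_1 \leq |A|$ and $1 \leq c_2 \leq |B|$ be integers such that $c_1c_2 \geq c\max(|A|,|B|)$. Suppose that $2 \leq \min(|A|,|B|)$, $\alpha |B| \leq |A| \leq \alpha^{-1} |B|$, $|A|+|B| \leq (1-\beta)p$, and $$\mathbb{E}_{A' \in A^{(c_1)},\ B' \in B^{(c_2)}} |A'+B'| \leq |A|+|B|-1 +\varepsilon \min(|A|,|B|).$$ Then there exist arithmetic progressions $P$ and $Q$ in $\mathbb{Z}_p$ with the same common difference such that $\max(|A\Delta P|, |B \Delta Q|) \leq \gamma \min(|A|,|B|)$.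
   Context: For a finite set $X$ and integer $m$, $X^{(m)}$ denotes the family of all $m$-element subsets of $X$; the expectation is over $A'$ and $B'$ chosen independently and uniformly from $A^{(c_1)}$ and $B^{(c_2)}$. $A'+B'$ is the sumset and $\Delta$ the symmetric difference. *)

theory Defs
  imports
    "HOL-Probability.Probability_Mass_Function"
    "HOL-Library.Ramsey"
    "HOL-Number_Theory.Residues"
begin

text \<open>
  Arithmetic progressions with common difference \<open>d\<close> in (the additive group of) a ring.
  They are nonempty and have nonzero common difference; a singleton is a progression for
  every nonzero \<open>d\<close>.
\<close>

definition arith_prog :: "('a, 'b) ring_scheme \<Rightarrow> 'a \<Rightarrow> 'a set \<Rightarrow> bool" where
  "arith_prog R d P \<longleftrightarrow>
     d \<in> carrier R \<and> d \<noteq> \<zero>\<^bsub>R\<^esub> \<and>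
     (\<exists>a \<in> carrier R. \<exists>k::nat. 1 \<le> k \<and> P = {a \<oplus>\<^bsub>R\<^esub> [i] \<cdot>\<^bsub>R\<^esub> d | i::nat. i < k})"

text \<open>
  The expectation of \<open>|A' + B'|\<close>, where \<open>A'\<close> and \<open>B'\<close> are independent uniform
  \<open>c1\<close>- and \<open>c2\<close>-element subsets of \<open>A\<close> and \<open>B\<close>. The value of \<open>pmf_of_set\<close> is meaningful
  only for finite nonempty arguments, that is for finite \<open>A\<close>, \<open>B\<close> with
  \<open>c1 \<le> card A\<close> and \<open>c2 \<le> card B\<close>.
\<close>

definition expected_sumset_card ::
  "('a, 'b) ring_scheme \<Rightarrow> 'a set \<Rightarrow> nat \<Rightarrow> 'a set \<Rightarrow> nat \<Rightarrow> real" where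
  "expected_sumset_card R A c1 B c2 =
     measure_pmf.expectation (pair_pmf (pmf_of_set (nsets A c1)) (pmf_of_set (nsets B c2)))
       (\<lambda>(A', B'). real (card (A' <+>\<^bsub>R\<^esub> B')))"

end

theory Submission
  imports Defs
begin

text \<open>
  A second moment computation shows that \<open>x\<close> lies in \<open>A' + B'\<close> with probability at least
  \<open>rq / (1 + rq)\<close>, where \<open>r\<close> is the number of representations of \<open>x\<close> as a sum and
  \<open>q = c\<^sub>1c\<^sub>2 / |A||B|\<close>. Hence a set \<open>S\<close> with little more than \<open>|A| + |B|\<close> elements contains the
  sums of all but a tiny proportion of the pairs of \<open>A \<times> B\<close>. From here on the parameter \<open>\<alpha>\<close>
  plays no role.

  Let \<open>|B| \<le> |A|\<close>. Replacing \<open>(A, B)\<close> by \<open>(A \<union> (B + e), B \<inter> (A - e))\<close> keeps \<open>|A| + |B|\<close> and does not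
  increase the number of pairs with sum outside \<open>S\<close>. A suitable \<open>e\<close> always removes a definite
  proportion of \<open>B\<close>, so boundedly many steps lead to a pair \<open>(A', B')\<close> where \<open>B'\<close> is
  much smaller than \<open>B\<close>, but not negligible. Almost all translates of \<open>A'\<close> by elements of \<open>B'\<close> lie in
  \<open>S\<close>, which makes the seminorm \<open>f d = |A' - (A' + d)|\<close> at most about \<open>|B'|\<close> on the difference set
  of \<open>B'\<close>. By Cauchy--Davenport the level sets of \<open>f\<close> grow linearly, and this level set is as
  large as it can be. Linear growth of the iterated sumsets forces a Fourier coefficient of
  the level set to be almost maximal, so after a dilation most of the level set consists of small
  integers. A packing argument modulo its largest element \<open>L\<close> then bounds \<open>f\<close> on all of
  \<open>{0..<L}\<close> (after dividing by the gcd), while \<open>f L\<close> is hardly larger than \<open>L\<close>. The number of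
  elements of \<open>A'\<close> in a sliding window of length \<open>L\<close> then has total variation \<open>2 f L\<close>, which is
  too small to rise and fall twice: \<open>A'\<close>, and with it \<open>S\<close>, is close to an arc.

  Finally, if almost all sums of \<open>A\<close> and \<open>B\<close> lie in an arc of length about \<open>|A| + |B|\<close>, both sets are
  close to arcs themselves.
\<close>

subsection \<open>Periodic sets of integers\<close>

text \<open>The set \<open>S\<close> links the shrunken pair to the original one: the replacements
  alter \<open>A\<close> and \<open>B\<close> but never \<open>S\<close>, so an arc close to
  \<open>S\<close> can be used with the original pair again. Shrinking is needed because the passage
  from shift loss to arcs costs thousands of times \<open>|B'|\<close>, which is harmless only if
  \<open>|B'|\<close> is at most \<open>\<kappa> |B|\<close> with a tiny \<open>\<kappa>\<close>. It
  must not go too far either: the errors in the size of \<open>S\<close> and in the number of bad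
  pairs have to stay below fixed fractions of \<open>|B'|\<close> and \<open>|B'|^2\<close>, which
  makes \<epsilon> a multiple of \<open>\<beta> \<kappa>\<close>. The return to \<open>A\<close> and
  \<open>B\<close> is a Markov argument and costs a square root, hence
  \<open>\<kappa> = \<theta>^2\<close> and final errors of order
  \<open>\<theta> |B| / \<beta>\<close>. The numerical constants serve one chain: at radius
  \<open>t\<close> the level set has at least \<open>1.6 t\<close> residues, nine tenths of them
  become small integers, so \<open>L\<close> is at least about \<open>0.72 t\<close>; the sliding
  window excludes a second rise and fall once \<open>f L < 1.6 L\<close>, and
  \<open>1.6 * 0.72 > 1\<close>.\<close>

text \<open>Subsets of \<open>\<int>/p\<close> are represented by \<open>p\<close>-periodic sets of integers, so that translations and
  dilations need no reduction modulo \<open>p\<close>; \<open>mu\<close> counts residue classes.\<close>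

locale prime_modulus =
  fixes p :: int
  assumes prime_p: "prime p"
begin

lemma p_pos [simp]: "0 < p"
  using prime_p prime_gt_0_int by blast

lemma p_nonneg [simp]: "0 \<le> p"
  using p_pos by linarith

lemma p_neq_0 [simp]: "p \<noteq> 0"
  using p_pos by linarith

definition periodic :: "int set \<Rightarrow> bool" where
  "periodic A \<longleftrightarrow> (\<forall>x. x + p \<in> A \<longleftrightarrow> x \<in> A)"

definition mu :: "int set \<Rightarrow> real" where
  "mu A = (\<Sum>x\<in>{0..<p}. of_bool (x \<in> A))"

lemma periodicD: "periodic A \<Longrightarrow> x + p \<in> A \<longleftrightarrow> x \<in> A"
  by (simp add: periodic_def)

lemma periodic_mult_fun:
  fixes g :: "int \<Rightarrow> 'a"
  assumes "\<And>x. g (x + p) = g x"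
  shows "g (x + j * p) = g x"
proof -
  have nat: "g (y + int n * p) = g y" for y n
  proof (induction n)
    case (Suc n)
    have "g (y + int (Suc n) * p) = g ((y + int n * p) + p)"
      by (simp add: algebra_simps)
    then show ?case using assms Suc by simp
  qed simp
  show ?thesis
  proof (cases "j \<ge> 0")
    case True
    then show ?thesis using nat[of x "nat j"] by simp
  next
    case False
    then show ?thesis using nat[of "x + j * p" "nat (-j)"] by (simp add: algebra_simps)
  qed
qed

lemma periodic_fun_mod:
  fixes g :: "int \<Rightarrow> 'a"
  assumes "\<And>x. g (x + p) = g x"
  shows "g (x mod p) = g x"
  using periodic_mult_fun[of g x "- (x div p)"] assms
  by (simp add: minus_div_mult_eq_mod)

lemma periodic_mult: "periodic A \<Longrightarrow> x + j * p \<in> A \<longleftrightarrow> x \<in> A"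
  using periodic_mult_fun[of "\<lambda>x. x \<in> A"] by (simp add: periodic_def)

lemma periodic_mod: "periodic A \<Longrightarrow> x mod p \<in> A \<longleftrightarrow> x \<in> A"
  using periodic_fun_mod[of "\<lambda>x. x \<in> A"] by (simp add: periodic_def)

lemma periodic_cong_mem:
  assumes "periodic A" "[x = y] (mod p)"
  shows "x \<in> A \<longleftrightarrow> y \<in> A"
  using assms periodic_mod unfolding cong_def by metis

lemma periodic_affine: "periodic A \<Longrightarrow> periodic {x. k * x + d \<in> A}"
proof -
  assume "periodic A"
  then have "(k * x + d) + k * p \<in> A \<longleftrightarrow> k * x + d \<in> A" for x
    by (rule periodic_mult)
  then show ?thesis by (simp add: periodic_def algebra_simps)
qed

lemma periodic_shift: "periodic A \<Longrightarrow> periodic {x. x + d \<in> A}"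
  using periodic_affine[of A 1 d] by simp

lemma periodic_reflect: "periodic A \<Longrightarrow> periodic {x. d - x \<in> A}"
  using periodic_affine[of A "-1" d] by simp

lemma periodic_UNIV [simp]: "periodic UNIV" by (simp add: periodic_def)

lemma periodic_Compl: "periodic A \<Longrightarrow> periodic (- A)" by (simp add: periodic_def)

lemma periodic_Int: "periodic A \<Longrightarrow> periodic B \<Longrightarrow> periodic (A \<inter> B)"
  by (simp add: periodic_def)

lemma periodic_Un: "periodic A \<Longrightarrow> periodic B \<Longrightarrow> periodic (A \<union> B)"
  by (simp add: periodic_def)

lemma periodic_Diff: "periodic A \<Longrightarrow> periodic B \<Longrightarrow> periodic (A - B)"
  by (simp add: periodic_def)

lemma sum_affine:
  fixes g :: "int \<Rightarrow> 'a::comm_monoid_add"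
  assumes per: "\<And>x. g (x + p) = g x" and k: "coprime k p"
  shows "(\<Sum>x\<in>{0..<p}. g (k * x + d)) = (\<Sum>x\<in>{0..<p}. g x)"
proof -
  let ?h = "\<lambda>x. (k * x + d) mod p"
  have inj: "inj_on ?h {0..<p}"
  proof (rule inj_onI)
    fix x y assume xy: "x \<in> {0..<p}" "y \<in> {0..<p}" "?h x = ?h y"
    then have "[k * x + d = k * y + d] (mod p)" by (simp add: cong_def)
    then have "[k * x = k * y] (mod p)" by (simp add: cong_add_rcancel)
    then have "[x = y] (mod p)" using k by (simp add: cong_mult_lcancel)
    then show "x = y" using xy by (simp add: cong_def)
  qed
  have sub: "?h ` {0..<p} \<subseteq> {0..<p}" by auto
  then have im: "?h ` {0..<p} = {0..<p}"
    using inj by (simp add: endo_inj_surj)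
  have "(\<Sum>x\<in>{0..<p}. g x) = (\<Sum>x\<in>?h ` {0..<p}. g x)" using im by simp
  also have "\<dots> = (\<Sum>x\<in>{0..<p}. g (?h x))" by (simp add: sum.reindex[OF inj])
  also have "\<dots> = (\<Sum>x\<in>{0..<p}. g (k * x + d))" using periodic_fun_mod[of g] per by simp
  finally show ?thesis by simp
qed

lemma sum_shift:
  fixes g :: "int \<Rightarrow> 'a::comm_monoid_add"
  assumes "\<And>x. g (x + p) = g x"
  shows "(\<Sum>x\<in>{0..<p}. g (x + d)) = (\<Sum>x\<in>{0..<p}. g x)"
  using sum_affine[of g 1 d] assms by simp

lemma sum_reflect:
  fixes g :: "int \<Rightarrow> 'a::comm_monoid_add"
  assumes "\<And>x. g (x + p) = g x"
  shows "(\<Sum>x\<in>{0..<p}. g (d - x)) = (\<Sum>x\<in>{0..<p}. g x)"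
  using sum_affine[of g "-1" d] assms by simp

lemma mu_card: "mu A = real (card (A \<inter> {0..<p}))"
  by (simp add: mu_def Int_commute Int_def)

lemma mu_nonneg [simp]: "0 \<le> mu A" by (simp add: mu_card)

lemma mu_UNIV [simp]: "mu UNIV = p" by (simp add: mu_card)

lemma mu_empty [simp]: "mu {} = 0" by (simp add: mu_card)

lemma mu_mono: "A \<subseteq> B \<Longrightarrow> mu A \<le> mu B"
  unfolding mu_card by (intro of_nat_mono card_mono) auto

lemma mu_le_p: "mu A \<le> p" using mu_mono[of A UNIV] by simp

lemma mu_Un_Int: "mu (A \<union> B) + mu (A \<inter> B) = mu A + mu B"
  unfolding mu_def sum.distrib[symmetric] by (intro sum.cong) auto

lemma mu_Un_le: "mu (A \<union> B) \<le> mu A + mu B"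
  using mu_Un_Int[of A B] mu_nonneg[of "A \<inter> B"] by linarith

lemma mu_Diff: "mu (A - B) = mu A - mu (A \<inter> B)"
  unfolding mu_def sum_subtractf[symmetric] by (intro sum.cong) auto

lemma mu_Compl: "mu (- A) = p - mu A"
  using mu_Diff[of UNIV A] by (simp add: Compl_eq_Diff_UNIV)

lemma mu_affine:
  assumes "periodic A" "coprime k p"
  shows "mu {x. k * x + d \<in> A} = mu A"
  unfolding mu_def mem_Collect_eq using assms by (intro sum_affine) (auto simp: periodicD)

lemma mu_shift: "periodic A \<Longrightarrow> mu {x. x + d \<in> A} = mu A"
  using mu_affine[of A 1 d] by simp

lemma mu_reflect: "periodic A \<Longrightarrow> mu {x. d - x \<in> A} = mu A"
  using mu_affine[of A "-1" d] by simp

lemma periodic_nonempty_rep: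
  assumes "periodic A" "A \<noteq> {}"
  obtains x where "x \<in> A" "0 \<le> x" "x < p"
  using assms periodic_mod p_pos by (metis all_not_in_conv pos_mod_bound pos_mod_sign)

lemma mu_ge_1:
  assumes "periodic A" "x \<in> A"
  shows "1 \<le> mu A"
proof -
  obtain y where "y \<in> A" "0 \<le> y" "y < p" using periodic_nonempty_rep[of A] assms by auto
  then have "card (A \<inter> {0..<p}) \<noteq> 0" by auto
  then show ?thesis unfolding mu_card by linarith
qed

lemma mu_pos_nonempty: "0 < mu A \<Longrightarrow> \<exists>x. x \<in> A"
  by (metis all_not_in_conv less_irrefl mu_empty)

lemma card_le_mu:
  assumes "F \<subseteq> A" "F \<subseteq> {0..<p}"
  shows "real (card F) \<le> mu A"
  unfolding mu_card using assms by (intro of_nat_mono card_mono) auto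

lemma card_interval_le_mu:
  assumes per: "periodic A" and "F \<subseteq> A" "F \<subseteq> {a..<a + p}"
  shows "real (card F) \<le> mu A"
proof -
  have "card F = card ((\<lambda>x. x - a) ` F)" by (simp add: card_image inj_on_def)
  also have "real \<dots> \<le> mu {x. x + a \<in> A}" using assms by (intro card_le_mu) auto
  finally show ?thesis by (simp add: mu_shift[OF per])
qed

text \<open>As \<open>p\<close> is prime, \<open>d\<close> generates the group of residues, so steps
  of \<open>d\<close> lead from \<open>x\<close> to everything.\<close>

lemma invariant_eq_UNIV:
  assumes per: "periodic A" and x: "x \<in> A" and d: "\<not> p dvd d"
    and inv: "\<And>x. x \<in> A \<Longrightarrow> x + d \<in> A"
  shows "A = UNIV"
proof -
  have "y \<in> A" for y
  proof -
    have "coprime d p" using d prime_p by (metis coprime_commute prime_imp_coprime)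
    then obtain w where w: "[d * w = 1] (mod p)" using cong_solve_coprime_int by blast
    define n where "n = nat ((w * (y - x)) mod p)"
    have step: "x + int k * d \<in> A" for k
    proof (induction k)
      case (Suc k)
      then show ?case using inv[OF Suc] by (simp add: algebra_simps)
    qed (simp add: x)
    have "[int n * d = w * (y - x) * d] (mod p)"
      by (simp add: n_def cong_mult cong_def mod_mult_left_eq)
    also have "[w * (y - x) * d = (y - x) * (d * w)] (mod p)" by (simp add: mult_ac)
    also have "[(y - x) * (d * w) = (y - x) * 1] (mod p)" by (intro cong_mult w) simp
    finally have "[x + int n * d = x + (y - x)] (mod p)" by (intro cong_add) auto
    then show ?thesis using periodic_cong_mem[OF per, of "x + int n * d" y] step[of n] by simp
  qed
  then show ?thesis by auto
qed

text \<open>The part of \<open>B + e\<close> that already lies in \<open>A\<close> is a translate of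
  the new second set, so the first set gains exactly what the second one loses.\<close>

lemma e_transform_card:
  assumes "periodic A" "periodic B"
  shows "mu (A \<union> {x. x - e \<in> B}) + mu (B \<inter> {x. x + e \<in> A}) = mu A + mu B"
proof -
  have "mu (A \<union> {x. x - e \<in> B}) + mu (A \<inter> {x. x - e \<in> B}) = mu A + mu B"
    using mu_Un_Int[of A "{x. x - e \<in> B}"] mu_shift[OF assms(2), of "-e"] by simp
  moreover have "mu (B \<inter> {x. x + e \<in> A}) = mu (A \<inter> {x. x - e \<in> B})"
    using mu_shift[of "A \<inter> {x. x - e \<in> B}" e] periodic_Int[OF assms(1) periodic_shift[OF assms(2), of "-e"]]
    by (simp add: Int_def conj_commute)
  ultimately show ?thesis by simp
qed

text \<open>Induction on the number of residues of \<open>B\<close>. An e-transform keeps the sum of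
  the sizes, and its sums stay in \<open>C\<close>, so one that shrinks \<open>B\<close> reduces the
  claim. If none does, \<open>A\<close> is invariant under every difference of elements of
  \<open>B\<close>: either \<open>B\<close> is a single residue, or \<open>A\<close> and with it
  \<open>C\<close> is everything.\<close>

theorem cauchy_davenport:
  assumes "periodic A" "periodic B" "periodic C" "A \<noteq> {}" "B \<noteq> {}"
    and "\<And>a b. a \<in> A \<Longrightarrow> b \<in> B \<Longrightarrow> a + b \<in> C"
  shows "min (real_of_int p) (mu A + mu B - 1) \<le> mu C"
  using assms
proof (induction "card (B \<inter> {0..<p})" arbitrary: A B rule: less_induct)
  case less
  note perA = less.prems(1) and perB = less.prems(2)
  show ?case
  proof (cases "\<exists>b b'. b \<in> B \<and> b' \<in> B \<and> \<not> p dvd (b - b')")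
    case False
    obtain b where b: "b \<in> B" "0 \<le> b" "b < p" using periodic_nonempty_rep less.prems by metis
    have "B \<inter> {0..<p} \<subseteq> {b}"
    proof
      fix x assume x: "x \<in> B \<inter> {0..<p}"
      then have "p dvd x - b" using False b by auto
      then have "x mod p = b mod p" by (simp add: mod_eq_dvd_iff)
      then show "x \<in> {b}" using x b by simp
    qed
    then have "card (B \<inter> {0..<p}) \<le> card {b}" by (intro card_mono) auto
    then have "mu B \<le> 1" by (simp add: mu_card)
    moreover have "mu A \<le> mu C"
    proof -
      have "mu A \<le> mu {x. x + b \<in> C}" by (intro mu_mono) (use less.prems(6) b(1) in auto)
      then show ?thesis using mu_shift[OF less.prems(3)] by simp
    qed
    ultimately show ?thesis by linarith
  next
    case True
    then obtain b b' where b: "b \<in> B" "b' \<in> B" "\<not> p dvd (b - b')" by auto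
    show ?thesis
    proof (cases "\<exists>a\<in>A. \<exists>y\<in>B. \<not> (\<forall>z\<in>B. z + (a - y) \<in> A)")
      case False
      have "x + (b - b') \<in> A" if "x \<in> A" for x
        using False b that by (force simp: algebra_simps)
      then have "A = UNIV" using invariant_eq_UNIV[OF perA _ b(3)] less.prems(4) by blast
      then have "x \<in> C" for x using less.prems(6)[of "x - b" b] b(1) by simp
      then have "C = UNIV" by auto
      then show ?thesis by simp
    next
      case True
      then obtain a y z where ay: "a \<in> A" "y \<in> B" "z \<in> B" "z + (a - y) \<notin> A" by auto
      define e where "e = a - y"
      define A' where "A' = A \<union> {x. x - e \<in> B}"
      define B' where "B' = B \<inter> {x. x + e \<in> A}"
      have per': "periodic A'" "periodic B'"
        using periodic_Un[OF perA periodic_shift[OF perB, of "-e"]]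
          periodic_Int[OF perB periodic_shift[OF perA, of e]] by (auto simp: A'_def B'_def)
      have "z \<notin> B'" using ay by (simp add: B'_def e_def)
      then have "z mod p \<notin> B'" "z mod p \<in> B"
        using periodic_mod[OF per'(2), of z] periodic_mod[OF perB, of z] ay by simp_all
      moreover have "z mod p \<in> {0..<p}" by simp
      moreover have "B' \<subseteq> B" by (simp add: B'_def)
      ultimately have "B' \<inter> {0..<p} \<subset> B \<inter> {0..<p}" by blast
      then have lt: "card (B' \<inter> {0..<p}) < card (B \<inter> {0..<p})" by (intro psubset_card_mono) auto
      have ne: "A' \<noteq> {}" "B' \<noteq> {}" using ay by (auto simp: A'_def B'_def e_def)
      have sums: "u + v \<in> C" if "u \<in> A'" "v \<in> B'" for u v
      proof (cases "u \<in> A")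
        case True
        then show ?thesis using that less.prems(6) by (auto simp: B'_def)
      next
        case False
        then show ?thesis
          using that less.prems(6)[of "v + e" "u - e"] by (simp add: A'_def B'_def add.commute)
      qed
      have "min (real_of_int p) (mu A' + mu B' - 1) \<le> mu C"
        using less.hyps[OF lt per' less.prems(3) ne sums] by blast
      then show ?thesis using e_transform_card[OF perA perB, of e] by (simp add: A'_def B'_def)
    qed
  qed
qed

end

subsection \<open>Shift loss\<close>

context prime_modulus begin

text \<open>For periodic \<open>A\<close> this is half the size of the symmetric difference of
  \<open>A\<close> and \<open>A - d\<close>, which is why it behaves like a seminorm in
  \<open>d\<close>.\<close>

definition shift_loss :: "int set \<Rightarrow> int \<Rightarrow> real" where
  "shift_loss A d = mu {x. x \<in> A \<and> x + d \<notin> A}"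

end

text \<open>Stated abstractly because the packing argument is run for a dilate
  \<open>f (j * y)\<close>, which is again of this kind.\<close>

locale periodic_seminorm = prime_modulus +
  fixes f :: "int \<Rightarrow> real"
  assumes f_periodic: "f (x + p) = f x"
    and f_minus: "f (- x) = f x"
    and f_triangle: "f (x + y) \<le> f x + f y"
    and f_zero: "f 0 = 0"
begin

definition level :: "real \<Rightarrow> int set" where
  "level s = {d. f d \<le> s}"

lemma periodic_level: "periodic (level s)"
  by (simp add: periodic_def level_def f_periodic)

lemma f_nonneg: "0 \<le> f x"
  using f_triangle[of x "-x"] by (simp add: f_minus f_zero)

lemma zero_in_level: "0 \<le> s \<Longrightarrow> 0 \<in> level s"
  by (simp add: level_def f_zero)

lemma level_mono: "s \<le> s' \<Longrightarrow> level s \<subseteq> level s'"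
  by (auto simp: level_def)

lemma level_add: "x \<in> level s \<Longrightarrow> y \<in> level s' \<Longrightarrow> x + y \<in> level (s + s')"
  using f_triangle[of x y] by (simp add: level_def)

lemma level_minus: "- x \<in> level s \<longleftrightarrow> x \<in> level s"
  by (simp add: level_def f_minus)

text \<open>The \<open>h\<close>-fold sumset of a level set lies in the level set of
  \<open>h\<close> times the radius; Cauchy--Davenport is applied \<open>h - 1\<close>
  times.\<close>

lemma level_growth:
  assumes "0 \<le> s" "1 \<le> h"
  shows "min (real_of_int p) (real h * (mu (level s) - 1) + 1) \<le> mu (level (real h * s))"
  using assms(2)
proof (induction h rule: dec_induct)
  case base
  then show ?case by simp
next
  case (step n)
  have sums: "a + b \<in> level (real (Suc n) * s)" if "a \<in> level (real n * s)" "b \<in> level s" for a b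
    using level_add[OF that] by (simp add: algebra_simps)
  have ne: "level (real n * s) \<noteq> {}" "level s \<noteq> {}"
    using zero_in_level[of "real n * s"] zero_in_level[of s] assms(1) by auto
  have cd: "min (real_of_int p) (mu (level (real n * s)) + mu (level s) - 1) \<le> mu (level (real (Suc n) * s))"
    using cauchy_davenport[OF periodic_level periodic_level periodic_level ne sums] by blast
  have "1 \<le> mu (level s)" using mu_ge_1[OF periodic_level zero_in_level] assms(1) by blast
  then show ?case using cd step.IH by (simp add: algebra_simps)
qed

end

context prime_modulus begin

lemma shift_loss_alt: "shift_loss A d = mu A - mu {x. x \<in> A \<and> x + d \<in> A}"
proof -
  have "{x. x \<in> A \<and> x + d \<notin> A} = A - {x. x + d \<in> A}" by auto
  then show ?thesis by (simp add: shift_loss_def mu_Diff Int_def)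
qed

lemma shift_loss_minus:
  assumes "periodic A"
  shows "shift_loss A (- d) = shift_loss A d"
proof -
  have "mu {x. x + d \<in> {x. x \<in> A \<and> x + (- d) \<in> A}} = mu {x. x \<in> A \<and> x + (- d) \<in> A}"
    by (intro mu_shift) (use assms periodic_Int[OF assms periodic_shift[OF assms, of "-d"]] in \<open>simp add: Int_def\<close>)
  then show ?thesis by (simp add: shift_loss_alt conj_commute)
qed

lemma periodic_loss_set: "periodic A \<Longrightarrow> periodic {x. x \<in> A \<and> x + d \<notin> A}"
  using periodic_Diff[OF _ periodic_shift[of A d], of A] by (simp add: set_diff_eq)

lemma shift_loss_seminorm:
  assumes per: "periodic A"
  shows "periodic_seminorm p (shift_loss A)"
proof unfold_locales
  show "shift_loss A (x + p) = shift_loss A x" for x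
    using periodicD[OF per] by (simp add: shift_loss_def flip: add.assoc)
  show "shift_loss A (- x) = shift_loss A x" for x by (rule shift_loss_minus[OF per])
  show "shift_loss A 0 = 0" by (simp add: shift_loss_def)
  show "shift_loss A (x + y) \<le> shift_loss A x + shift_loss A y" for x y
  proof -
    have "{z. z \<in> A \<and> z + (x + y) \<notin> A} \<subseteq>
        {z. z \<in> A \<and> z + x \<notin> A} \<union> {z. z + x \<in> {z. z \<in> A \<and> z + y \<notin> A}}"
      by (auto simp: add.assoc)
    from mu_mono[OF this] show ?thesis
      using mu_Un_le[of "{z. z \<in> A \<and> z + x \<notin> A}" "{z. z + x \<in> {z. z \<in> A \<and> z + y \<notin> A}}"]
        mu_shift[OF periodic_loss_set[OF per], of x y]
      by (simp add: shift_loss_def)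
  qed
qed

lemma shift_loss_Compl:
  assumes "periodic A"
  shows "shift_loss (- A) d = shift_loss A d"
proof -
  have "shift_loss (- A) d = mu {x. x + d \<in> {x. x \<in> A \<and> x + (- d) \<notin> A}}"
    by (simp add: shift_loss_def conj_commute)
  also have "\<dots> = shift_loss A (- d)"
    using mu_shift[OF periodic_loss_set[OF assms], of d "- d"] by (simp add: shift_loss_def)
  finally show ?thesis by (simp add: shift_loss_minus[OF assms])
qed

lemma shift_loss_dilate:
  assumes "periodic A" "coprime k p"
  shows "shift_loss {x. k * x \<in> A} d = shift_loss A (k * d)"
  using mu_affine[OF periodic_loss_set[OF assms(1), of "k * d"] assms(2), of 0]
  by (simp add: shift_loss_def algebra_simps)

lemma sum_correlation:
  assumes "periodic A" "periodic B"
  shows "(\<Sum>d\<in>{0..<p}. mu {x. x \<in> A \<and> x + d \<in> B}) = mu A * mu B"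
proof -
  have "(\<Sum>d\<in>{0..<p}. mu {x. x \<in> A \<and> x + d \<in> B}) =
      (\<Sum>d\<in>{0..<p}. \<Sum>x\<in>{0..<p}. of_bool (x \<in> A) * of_bool (d + x \<in> B))"
    by (simp only: mu_def mem_Collect_eq of_bool_conj add.commute)
  also have "\<dots> = (\<Sum>x\<in>{0..<p}. of_bool (x \<in> A) * (\<Sum>d\<in>{0..<p}. of_bool (d + x \<in> B)))"
    by (subst sum.swap) (simp only: sum_distrib_left)
  also have "\<dots> = (\<Sum>x\<in>{0..<p}. of_bool (x \<in> A) * mu B)"
    using mu_shift[OF assms(2)] by (simp only: mu_def mem_Collect_eq)
  also have "\<dots> = mu A * mu B" by (simp only: mu_def sum_distrib_right)
  finally show ?thesis .
qed

text \<open>The sizes of \<open>A \<inter> (A - d)\<close> sum to \<open>(mu A)^2\<close>, so few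
  shifts lose only a quarter of \<open>A\<close>. This bounds the level set of radius
  \<open>mu A / 4\<close> by a multiple of its radius, and linear growth carries the bound down to
  the radius \<open>s\<close>.\<close>

lemma shift_loss_level_card_half:
  assumes per: "periodic A" and half: "2 * mu A \<le> p" and s: "1 \<le> s" "4 * s \<le> mu A"
  shows "mu {d. shift_loss A d \<le> s} \<le> 12 * s"
proof -
  interpret periodic_seminorm p "shift_loss A" by (rule shift_loss_seminorm[OF per])
  define a where "a = mu A"
  have a: "a \<ge> 4" using s by (simp add: a_def)
  have "mu (level (a / 4)) * (3 / 4 * a) = (\<Sum>d\<in>{0..<p}. of_bool (d \<in> level (a / 4)) * (3 / 4 * a))"
    by (simp only: mu_def sum_distrib_right)
  also have "\<dots> \<le> (\<Sum>d\<in>{0..<p}. mu {x. x \<in> A \<and> x + d \<in> A})"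
    by (intro sum_mono) (auto simp: level_def shift_loss_alt a_def)
  also have "\<dots> = a * a" using sum_correlation[OF per per] by (simp add: a_def)
  finally have "mu (level (a / 4)) * (3 / 4) \<le> a" using a by simp
  then have top: "mu (level (a / 4)) \<le> 4 / 3 * a" by simp
  \<comment> \<open>How many copies of \<open>s\<close> fit into \<open>a / 4\<close>; the floor
    costs at most a factor 2, hence \<open>hlo\<close>.\<close>
  define h where "h = nat \<lfloor>a / (4 * s)\<rfloor>"
  have q: "1 \<le> a / (4 * s)" using s by (simp add: a_def)
  then have h1: "1 \<le> h" by (simp add: h_def le_nat_floor)
  have hup: "real h \<le> a / (4 * s)" using q by (simp add: h_def)
  have "a / (4 * s) < real h + 1" using q unfolding h_def by linarith
  then have "a / (4 * s) \<le> 2 * real h" using h1 by linarith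
  then have hlo: "a / (8 * s) \<le> real h" using s by (simp add: field_simps)
  have hs: "real h * s \<le> a / 4" using hup s by (simp add: field_simps)
  have "min (real_of_int p) (real h * (mu (level s) - 1) + 1) \<le> mu (level (a / 4))"
    using level_growth[of s h] mu_mono[OF level_mono[OF hs]] s h1 by linarith
  \<comment> \<open>The minimum is not \<open>p\<close>: as \<open>2 * a\<close> is at most
    \<open>p\<close>, the upper bound \<open>4 / 3 * a\<close> is less than
    \<open>p\<close>.\<close>
  then have gr: "real h * (mu (level s) - 1) + 1 \<le> 4 / 3 * a"
    using top half a by (simp add: a_def min_def split: if_splits)
  have "mu (level s) \<le> 12 * s"
  proof (cases "mu (level s) \<le> 1")
    case True
    then show ?thesis using s by linarith
  next
    case False
    then have "a / (8 * s) * (mu (level s) - 1) \<le> real h * (mu (level s) - 1)"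
      using hlo by (intro mult_right_mono) auto
    then have "a / (8 * s) * (mu (level s) - 1) \<le> 4 / 3 * a" using gr by linarith
    then have "a * (mu (level s) - 1) \<le> a * (32 / 3 * s)" using s by (simp add: field_simps)
    then have "mu (level s) - 1 \<le> 32 / 3 * s" using a by simp
    then show ?thesis using s by linarith
  qed
  then show ?thesis by (simp add: level_def)
qed

text \<open>A set and its complement have the same shift loss, so the smaller of the two can be
  used.\<close>

lemma shift_loss_level_card:
  assumes "periodic A" "1 \<le> s" "4 * s \<le> mu A" "4 * s \<le> p - mu A"
  shows "mu {d. shift_loss A d \<le> s} \<le> 12 * s"
proof (cases "2 * mu A \<le> p")
  case True
  then show ?thesis using shift_loss_level_card_half assms by blast
next
  case False
  then have "mu {d. shift_loss (- A) d \<le> s} \<le> 12 * s"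
    using shift_loss_level_card_half[of "- A" s] assms by (simp add: mu_Compl periodic_Compl)
  then show ?thesis by (simp add: shift_loss_Compl[OF assms(1)])
qed

end

subsection \<open>Fourier concentration of level sets\<close>

lemma linear_times_geometric_small:
  fixes q :: real
  assumes "0 \<le> q" "q < 1"
  shows "\<exists>h::nat. 1 \<le> h \<and> 15 * real h * q ^ (2 * h - 2) < 1"
proof (cases "q = 0")
  case True
  then show ?thesis by (intro exI[of _ 2]) simp
next
  case False
  then have q: "0 < q" using assms by simp
  have "q\<^sup>2 < 1" using assms by (simp add: power_less_one_iff)
  then have "(\<lambda>n. of_nat n * (q\<^sup>2) ^ n) \<longlonglongrightarrow> 0"
    by (intro powser_times_n_limit_0) simp
  then have "\<forall>\<^sub>F n in sequentially. of_nat n * (q\<^sup>2) ^ n < q\<^sup>2 / 15"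
    using q by (intro order_tendstoD(2)) auto
  then obtain n0 where n0: "\<And>n. n \<ge> n0 \<Longrightarrow> of_nat n * (q\<^sup>2) ^ n < q\<^sup>2 / 15"
    by (auto simp: eventually_sequentially)
  define h where "h = max 1 n0"
  have "2 * h = (2 * h - 2) + 2" by (simp add: h_def)
  then have "q ^ (2 * h) = q ^ (2 * h - 2) * q\<^sup>2" by (metis power_add)
  moreover have "real h * q ^ (2 * h) < q\<^sup>2 / 15"
    using n0[of h] by (simp add: h_def power_mult[symmetric])
  ultimately have "15 * real h * q ^ (2 * h - 2) * q\<^sup>2 < 1 * q\<^sup>2" by (simp add: mult_ac)
  then have "15 * real h * q ^ (2 * h - 2) < 1" using q by (simp only: mult_less_cancel_right_pos zero_less_power)
  then show ?thesis by (intro exI[of _ h]) (simp add: h_def)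
qed

text \<open>An average cosine of \<open>concentration_ratio\<close> leaves, after doubling the frequency, at most a tenth
  of the angles further than \<open>\<pi>/100\<close> from \<open>0\<close>; \<open>fourier_order\<close> is the number of summands that
  forces a Fourier coefficient above this ratio.\<close>

definition concentration_ratio :: real where
  "concentration_ratio = 1 - (1 - cos (pi / 100)) / 40"

definition fourier_order :: nat where
  "fourier_order = (SOME h. 1 \<le> h \<and> 15 * real h * concentration_ratio ^ (2 * h - 2) < 1)"

lemma cos_pi_100: "0 < cos (pi / 100)" "cos (pi / 100) < 1"
proof -
  show "0 < cos (pi / 100)" by (rule cos_gt_zero_pi) (use pi_gt_zero in auto)
  have "cos (pi / 100) < cos 0" using pi_gt_zero by (intro cos_monotone_0_pi) auto
  then show "cos (pi / 100) < 1" by simp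
qed

lemma concentration_ratio: "0 < concentration_ratio" "concentration_ratio < 1"
  using cos_pi_100 by (auto simp: concentration_ratio_def)

lemma fourier_order:
  "1 \<le> fourier_order" "15 * real fourier_order * concentration_ratio ^ (2 * fourier_order - 2) < 1"
  using someI_ex[OF linear_times_geometric_small[of concentration_ratio]] concentration_ratio
  by (auto simp: fourier_order_def)

section \<open>Characters and Fourier coefficients modulo \<open>p\<close>\<close>

context prime_modulus begin

definition echar :: "int \<Rightarrow> complex" where
  "echar z = cis (2 * pi * real_of_int z / real_of_int p)"

lemma echar_add: "echar (x + y) = echar x * echar y"
  by (simp add: echar_def cis_mult add_divide_distrib ring_distribs)

lemma echar_0 [simp]: "echar 0 = 1" by (simp add: echar_def)

lemma echar_minus: "echar (- x) = cnj (echar x)" by (simp add: echar_def cis_cnj)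

lemma norm_echar [simp]: "norm (echar x) = 1" by (simp add: echar_def)

lemma echar_multiple: "echar (j * p) = 1"
proof -
  have "2 * pi * real_of_int (j * p) / real_of_int p = 2 * pi * real_of_int j"
    by simp
  then show ?thesis unfolding echar_def by (simp only: cis_multiple_2pi Ints_of_int)
qed

lemma echar_eq_1:
  assumes "echar z = 1"
  shows "p dvd z"
proof -
  have "cos (2 * pi * real_of_int z / real_of_int p) = 1"
    using assms by (simp add: echar_def complex_eq_iff)
  then obtain n :: int where n: "2 * pi * real_of_int z / real_of_int p = of_int n * 2 * pi"
    using cos_one_2pi_int by metis
  then have "real_of_int z = real_of_int (n * p)" using p_pos by (simp add: field_simps)
  then have "z = n * p" by linarith
  then show ?thesis by simp
qed

lemma echar_orthogonal:
  "(\<Sum>k\<in>{0..<p}. echar (k * z)) = (if p dvd z then of_int p else 0)"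
proof (cases "p dvd z")
  case True
  then obtain j where "z = p * j" by (elim dvdE)
  then have "echar (k * z) = 1" for k
    using echar_multiple[of "k * j"] by (simp add: mult_ac)
  then show ?thesis using True by simp
next
  case False
  let ?s = "\<Sum>k\<in>{0..<p}. echar (k * z)"
  have "echar ((k + p) * z) = echar (k * z)" for k
    using echar_multiple[of z] by (simp add: ring_distribs echar_add mult.commute)
  then have "(\<Sum>k\<in>{0..<p}. echar ((k + 1) * z)) = ?s" by (intro sum_shift) auto
  moreover have "(\<Sum>k\<in>{0..<p}. echar ((k + 1) * z)) = ?s * echar z"
    by (simp add: ring_distribs echar_add sum_distrib_right)
  ultimately have "?s * (echar z - 1) = 0" by (simp add: algebra_simps)
  then show ?thesis using False echar_eq_1 by auto
qed

definition dft :: "(int \<Rightarrow> real) \<Rightarrow> int \<Rightarrow> complex" where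
  "dft g k = (\<Sum>x\<in>{0..<p}. of_real (g x) * echar (k * x))"

lemma parseval:
  fixes g :: "int \<Rightarrow> real"
  shows "(\<Sum>k\<in>{0..<p}. (norm (dft g k))\<^sup>2) = p * (\<Sum>x\<in>{0..<p}. (g x)\<^sup>2)"
proof -
  have e: "complex_of_real ((norm (dft g k))\<^sup>2) =
      (\<Sum>x\<in>{0..<p}. \<Sum>y\<in>{0..<p}. of_real (g x * g y) * echar (k * (x - y)))" for k
  proof -
    have "complex_of_real ((norm (dft g k))\<^sup>2) = dft g k * cnj (dft g k)"
      by (simp only: complex_norm_square)
    also have "\<dots> = (\<Sum>x\<in>{0..<p}. \<Sum>y\<in>{0..<p}.
        (of_real (g x) * echar (k * x)) * (of_real (g y) * echar (- (k * y))))"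
      by (simp only: dft_def sum_product cnj_sum complex_cnj_mult complex_cnj_complex_of_real echar_minus)
    also have "\<dots> = (\<Sum>x\<in>{0..<p}. \<Sum>y\<in>{0..<p}. of_real (g x * g y) * echar (k * (x - y)))"
    proof (intro sum.cong refl)
      fix x y
      have "echar (k * (x - y)) = echar (k * x) * echar (- (k * y))"
        by (simp add: right_diff_distrib flip: echar_add)
      then show "(of_real (g x) * echar (k * x)) * (of_real (g y) * echar (- (k * y))) =
          of_real (g x * g y) * echar (k * (x - y))" by simp
    qed
    finally show ?thesis .
  qed
  have "complex_of_real (\<Sum>k\<in>{0..<p}. (norm (dft g k))\<^sup>2) =
      (\<Sum>k\<in>{0..<p}. \<Sum>x\<in>{0..<p}. \<Sum>y\<in>{0..<p}. of_real (g x * g y) * echar (k * (x - y)))"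
    by (simp only: of_real_sum e)
  also have "\<dots> = (\<Sum>x\<in>{0..<p}. \<Sum>k\<in>{0..<p}. \<Sum>y\<in>{0..<p}. of_real (g x * g y) * echar (k * (x - y)))"
    by (rule sum.swap)
  also have "\<dots> = (\<Sum>x\<in>{0..<p}. \<Sum>y\<in>{0..<p}. \<Sum>k\<in>{0..<p}. of_real (g x * g y) * echar (k * (x - y)))"
    by (intro sum.cong refl sum.swap)
  also have "\<dots> = (\<Sum>x\<in>{0..<p}. \<Sum>y\<in>{0..<p}. of_real (g x * g y) * (if x = y then of_int p else 0))"
  proof (intro sum.cong refl)
    fix x y assume xy: "x \<in> {0..<p}" "y \<in> {0..<p}"
    have "p dvd (x - y) \<longleftrightarrow> x = y" using xy by (simp add: mod_eq_dvd_iff[symmetric])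
    then show "(\<Sum>k\<in>{0..<p}. of_real (g x * g y) * echar (k * (x - y))) =
        of_real (g x * g y) * (if x = y then of_int p else 0)"
      by (simp only: sum_distrib_left[symmetric] echar_orthogonal)
  qed
  also have "\<dots> = (\<Sum>x\<in>{0..<p}. of_real (g x * g x) * of_int p)"
    by (intro sum.cong refl) (simp add: if_distrib cong: if_cong)
  also have "\<dots> = complex_of_real (p * (\<Sum>x\<in>{0..<p}. (g x)\<^sup>2))"
    by (simp add: sum_distrib_left power2_eq_square mult_ac)
  finally show ?thesis by (simp only: of_real_eq_iff)
qed

text \<open>The number of ways to write \<open>x\<close> modulo \<open>p\<close> as an ordered sum
  of \<open>h\<close> residues from \<open>D\<close>.\<close>

fun iterated_conv :: "int set \<Rightarrow> nat \<Rightarrow> int \<Rightarrow> real" where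
  "iterated_conv D 0 x = of_bool (p dvd x)"
| "iterated_conv D (Suc h) x = (\<Sum>d\<in>{0..<p}. of_bool (d \<in> D) * iterated_conv D h (x - d))"

lemma iterated_conv_periodic: "iterated_conv D h (x + p) = iterated_conv D h x"
proof (induction h arbitrary: x)
  case (Suc h)
  have "iterated_conv D h (x + p - d) = iterated_conv D h (x - d)" for d
    using Suc[of "x - d"] by (simp add: algebra_simps)
  then show ?case by simp
qed simp

lemma dft_conv:
  assumes "\<And>x. g (x + p) = g x"
  shows "dft (\<lambda>x. \<Sum>d\<in>{0..<p}. of_bool (d \<in> D) * g (x - d)) k = dft (\<lambda>x. of_bool (x \<in> D)) k * dft g k"
proof -
  have "dft (\<lambda>x. \<Sum>d\<in>{0..<p}. of_bool (d \<in> D) * g (x - d)) k =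
      (\<Sum>x\<in>{0..<p}. \<Sum>d\<in>{0..<p}. of_real (of_bool (d \<in> D)) * of_real (g (x - d)) * echar (k * x))"
    by (simp only: dft_def of_real_sum of_real_mult sum_distrib_right)
  also have "\<dots> = (\<Sum>d\<in>{0..<p}. \<Sum>x\<in>{0..<p}. of_real (of_bool (d \<in> D)) * of_real (g (x - d)) * echar (k * x))"
    by (rule sum.swap)
  also have "\<dots> = (\<Sum>d\<in>{0..<p}. of_real (of_bool (d \<in> D)) * echar (k * d) * dft g k)"
  proof (intro sum.cong refl)
    fix d
    have "(\<Sum>x\<in>{0..<p}. of_real (g (x + (- d))) * echar (k * (x + (- d)))) = dft g k"
      unfolding dft_def
    proof (rule sum_shift)
      fix x show "of_real (g (x + p)) * echar (k * (x + p)) = of_real (g x) * echar (k * x)"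
        using assms echar_multiple[of k] by (simp add: ring_distribs echar_add)
    qed
    then have s: "(\<Sum>x\<in>{0..<p}. of_real (g (x - d)) * echar (k * (x - d))) = dft g k" by simp
    have "of_real (of_bool (d \<in> D)) * echar (k * d) * dft g k =
        (\<Sum>x\<in>{0..<p}. (of_real (of_bool (d \<in> D)) * echar (k * d)) * (of_real (g (x - d)) * echar (k * (x - d))))"
      by (simp only: s sum_distrib_left[symmetric])
    also have "\<dots> = (\<Sum>x\<in>{0..<p}. of_real (of_bool (d \<in> D)) * of_real (g (x - d)) * echar (k * x))"
    proof (intro sum.cong refl)
      fix x
      have "echar (k * x) = echar (k * d) * echar (k * (x - d))"
        by (simp add: right_diff_distrib flip: echar_add)
      then show "(of_real (of_bool (d \<in> D)) * echar (k * d)) * (of_real (g (x - d)) * echar (k * (x - d))) =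
        of_real (of_bool (d \<in> D)) * of_real (g (x - d)) * echar (k * x)" by (simp add: mult_ac)
    qed
    finally show "(\<Sum>x\<in>{0..<p}. of_real (of_bool (d \<in> D)) * of_real (g (x - d)) * echar (k * x)) =
        of_real (of_bool (d \<in> D)) * echar (k * d) * dft g k" by simp
  qed
  also have "\<dots> = dft (\<lambda>x. of_bool (x \<in> D)) k * dft g k"
    by (simp only: dft_def sum_distrib_right)
  finally show ?thesis .
qed

lemma dft_iterated_conv: "dft (iterated_conv D h) k = dft (\<lambda>x. of_bool (x \<in> D)) k ^ h"
proof (induction h)
  case 0
  have "dft (iterated_conv D 0) k = (\<Sum>x\<in>{0..<p}. if x = 0 then 1 else 0)"
    unfolding dft_def
  proof (intro sum.cong refl)
    fix x assume "x \<in> {0..<p}"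
    then have "p dvd x \<longleftrightarrow> x = 0" by (auto dest: zdvd_imp_le)
    then show "of_real (iterated_conv D 0 x) * echar (k * x) = (if x = 0 then 1 else 0)" by simp
  qed
  then show ?case by (simp del: iterated_conv.simps)
next
  case (Suc h)
  have "dft (iterated_conv D (Suc h)) k =
      dft (\<lambda>x. \<Sum>d\<in>{0..<p}. of_bool (d \<in> D) * iterated_conv D h (x - d)) k" by (simp add: fun_eq_iff dft_def)
  then show ?case using dft_conv[of "iterated_conv D h" D k, OF iterated_conv_periodic] Suc by simp
qed

lemma dft_0_indicator: "dft (\<lambda>x. of_bool (x \<in> D)) 0 = of_real (mu D)"
  by (simp only: dft_def mu_def of_real_sum mult_zero_left echar_0 mult_1_right)

lemma sum_iterated_conv: "(\<Sum>x\<in>{0..<p}. iterated_conv D h x) = mu D ^ h"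
proof -
  have "complex_of_real (\<Sum>x\<in>{0..<p}. iterated_conv D h x) = dft (iterated_conv D h) 0"
    by (simp add: dft_def)
  also have "\<dots> = complex_of_real (mu D ^ h)" by (simp add: dft_iterated_conv dft_0_indicator)
  finally show ?thesis by (simp only: of_real_eq_iff)
qed

text \<open>The representation function of \<open>h\<close>-fold sums has its whole mass
  \<open>mu D ^ h\<close> on \<open>V\<close>, so Cauchy--Schwarz bounds its square sum from below.
  If every coefficient at a nonzero frequency were at most \<open>q * mu D\<close>, Parseval would
  bound the square sum from above; for \<open>V\<close> as small as in \<open>big\<close> the two
  bounds contradict each other.\<close>

lemma large_dft_coefficient:
  assumes supp: "\<And>x. iterated_conv D h x \<noteq> 0 \<Longrightarrow> x \<in> V"
    and h: "1 \<le> h" and pos: "0 < mu D" and q: "0 \<le> q"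
    and big: "mu V * (mu D / p + q ^ (2 * h - 2)) < mu D"
  shows "\<exists>k\<in>{1..<p}. q * mu D < norm (dft (\<lambda>x. of_bool (x \<in> D)) k)"
proof (rule ccontr)
  assume "\<not> ?thesis"
  then have small: "norm (dft (\<lambda>x. of_bool (x \<in> D)) k) \<le> q * mu D" if "k \<in> {1..<p}" for k
    using that by force
  let ?D = "dft (\<lambda>x. of_bool (x \<in> D))" and ?N = "mu D"
  have V0: "mu V \<ge> 0" by simp
  have "(?N ^ h)\<^sup>2 = (\<Sum>x\<in>{0..<p}. of_bool (x \<in> V) * iterated_conv D h x)\<^sup>2"
    unfolding sum_iterated_conv[symmetric]
    by (intro arg_cong[where f = "\<lambda>z. z\<^sup>2"] sum.cong refl) (use supp in auto)
  also have "\<dots> \<le> (\<Sum>x\<in>{0..<p}. (of_bool (x \<in> V))\<^sup>2) * (\<Sum>x\<in>{0..<p}. (iterated_conv D h x)\<^sup>2)"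
    by (rule Cauchy_Schwarz_ineq_sum)
  also have "(\<Sum>x\<in>{0..<p}. (of_bool (x \<in> V))\<^sup>2) = mu V"
    unfolding mu_def by (intro sum.cong) auto
  finally have cs: "?N ^ (2 * h) \<le> mu V * (\<Sum>x\<in>{0..<p}. (iterated_conv D h x)\<^sup>2)"
    by (simp add: power_mult[symmetric] mult.commute)
  have "p * (\<Sum>x\<in>{0..<p}. (iterated_conv D h x)\<^sup>2) = (\<Sum>k\<in>{0..<p}. (norm (?D k)) ^ (2 * h))"
    unfolding parseval[symmetric] dft_iterated_conv norm_power
    by (simp only: power_mult[symmetric] mult.commute)
  \<comment> \<open>Frequency 0 carries the main term. At the others all but two of the
    \<open>2 * h\<close> factors are bounded by \<open>q * ?N\<close>, which leaves a sum of squares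
    for Parseval.\<close>
  also have "\<dots> \<le> (\<Sum>k\<in>{0..<p}. (if k = 0 then ?N ^ (2 * h) else 0) + (q * ?N) ^ (2 * h - 2) * (norm (?D k))\<^sup>2)"
  proof (intro sum_mono)
    fix k assume k: "k \<in> {0..<p}"
    show "(norm (?D k)) ^ (2 * h) \<le> (if k = 0 then ?N ^ (2 * h) else 0) + (q * ?N) ^ (2 * h - 2) * (norm (?D k))\<^sup>2"
    proof (cases "k = 0")
      case True
      then show ?thesis using q pos by (simp add: dft_0_indicator)
    next
      case False
      have "2 * h = (2 * h - 2) + 2" using h by simp
      then have "(norm (?D k)) ^ (2 * h) = (norm (?D k)) ^ (2 * h - 2) * (norm (?D k))\<^sup>2"
        by (metis power_add)
      also have "\<dots> \<le> (q * ?N) ^ (2 * h - 2) * (norm (?D k))\<^sup>2"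
        using small[of k] k False by (intro mult_right_mono power_mono) auto
      finally show ?thesis using False by simp
    qed
  qed
  also have "\<dots> = ?N ^ (2 * h) + (q * ?N) ^ (2 * h - 2) * (p * (\<Sum>x\<in>{0..<p}. (of_bool (x \<in> D) :: real)\<^sup>2))"
    by (simp add: sum.distrib sum_distrib_left[symmetric] parseval)
  also have "(\<Sum>x\<in>{0..<p}. (of_bool (x \<in> D) :: real)\<^sup>2) = ?N"
    unfolding mu_def by (intro sum.cong) auto
  finally have up: "p * (\<Sum>x\<in>{0..<p}. (iterated_conv D h x)\<^sup>2) \<le> ?N ^ (2 * h) + (q * ?N) ^ (2 * h - 2) * (p * ?N)" .
  have "2 * h = Suc (2 * h - 1)" "2 * h - 1 = Suc (2 * h - 2)" using h by auto
  then have pw: "?N ^ (2 * h) = ?N * ?N ^ (2 * h - 1)" "?N ^ (2 * h - 1) = ?N * ?N ^ (2 * h - 2)"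
    by (metis power_Suc)+
  have rp: "0 < real_of_int p" by simp
  have "?N ^ (2 * h - 1) * (p * ?N) \<le> mu V * (p * (\<Sum>x\<in>{0..<p}. (iterated_conv D h x)\<^sup>2))"
    using mult_left_mono[OF cs[unfolded pw(1)], of p] rp by (simp only: mult_ac less_imp_le)
  also have "\<dots> \<le> mu V * (?N ^ (2 * h) + (q * ?N) ^ (2 * h - 2) * (p * ?N))"
    by (intro mult_left_mono up V0)
  also have "\<dots> = ?N ^ (2 * h - 1) * (p * (mu V * (?N / p + q ^ (2 * h - 2))))"
  proof -
    have "p * (?N / p + q ^ (2 * h - 2)) = ?N + p * q ^ (2 * h - 2)"
      using rp by (simp add: distrib_left)
    moreover have "?N ^ (2 * h) + (q * ?N) ^ (2 * h - 2) * (p * ?N) =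
        ?N ^ (2 * h - 1) * (?N + p * q ^ (2 * h - 2))"
      unfolding pw power_mult_distrib by (simp only: distrib_left mult_ac)
    ultimately show ?thesis by (metis mult.left_commute)
  qed
  finally have "p * ?N \<le> p * (mu V * (?N / p + q ^ (2 * h - 2)))"
    using pos by (simp add: mult_le_cancel_left)
  then have "?N \<le> mu V * (?N / p + q ^ (2 * h - 2))" using rp by (simp add: mult_le_cancel_left)
  then show False using big by linarith
qed

text \<open>The distance \<open>p / 200\<close> corresponds to the angle \<open>pi / 100\<close> in
  \<open>echar\<close>.\<close>

definition near_zero :: "int \<Rightarrow> bool" where
  "near_zero y \<longleftrightarrow> (\<exists>j. 200 * \<bar>y - j * p\<bar> < p)"

lemma cos_not_near_zero:
  assumes "\<not> near_zero y"
  shows "Re (echar y) \<le> cos (pi / 100)"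
proof -
  \<comment> \<open>The distance from \<open>y\<close> to the nearest multiple of
    \<open>p\<close>.\<close>
  define z where "z = (if 2 * (y mod p) \<le> p then y mod p else p - y mod p)"
  have m: "0 \<le> y mod p" "y mod p < p" by simp_all
  have z2: "0 \<le> z" "2 * z \<le> p" using m by (auto simp: z_def less_imp_le)
  have y: "y = y div p * p + y mod p" by simp
  have Re: "Re (echar y) = cos (2 * pi * z / p)"
  proof -
    have "echar y = echar (y mod p)"
      using echar_add[of "y div p * p" "y mod p"] echar_multiple[of "y div p"] by simp
    moreover have "Re (echar (p - y mod p)) = Re (echar (y mod p))"
      using echar_add[of p "- (y mod p)"] echar_multiple[of 1] by (simp add: echar_minus)
    ultimately show ?thesis by (simp add: z_def echar_def)
  qed
  have "p \<le> 200 * z"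
  proof (rule ccontr)
    assume c: "\<not> ?thesis"
    have "near_zero y"
    proof (cases "2 * (y mod p) \<le> p")
      case True
      have "y - y div p * p = y mod p" using y by linarith
      then show ?thesis using True c m unfolding near_zero_def z_def by (intro exI[of _ "y div p"]) auto
    next
      case False
      have "y - (y div p + 1) * p = y mod p - p" using y by (simp add: algebra_simps)
      then show ?thesis using False c m unfolding near_zero_def z_def
        by (intro exI[of _ "y div p + 1"]) (simp add: abs_if)
    qed
    then show False using assms by simp
  qed
  then have "real_of_int p \<le> 200 * real_of_int z" by linarith
  then have "pi / 100 \<le> 2 * pi * z / p" using pi_gt_zero by (simp add: field_simps)
  moreover have "2 * pi * z / p \<le> pi"
    using z2 pi_gt_zero of_int_le_iff[of "2 * z" p, where ?'a = real] by (simp add: field_simps)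
  ultimately show ?thesis using Re pi_gt_zero by (simp add: cos_monotone_0_pi_le)
qed

end

context periodic_seminorm begin

lemma iterated_conv_level: "iterated_conv (level t) h x \<noteq> 0 \<Longrightarrow> x \<in> level (real h * t)"
proof (induction h arbitrary: x)
  case 0
  then have "p dvd x" by (simp split: if_splits)
  then obtain j where "x = 0 + j * p" by (metis add_0 dvd_div_mult_self)
  then show ?case
    using periodic_mult[OF periodic_level, of 0 j 0] zero_in_level[of 0] by simp
next
  case (Suc h)
  then obtain d where "of_bool (d \<in> level t) * iterated_conv (level t) h (x - d) \<noteq> 0"
    by (auto elim: sum.not_neutral_contains_not_neutral)
  then have "d \<in> level t" "x - d \<in> level (real h * t)" using Suc.IH[of "x - d"] by (auto split: if_splits)
  then show ?case using level_add[of d t "x - d" "real h * t"] by (simp add: algebra_simps)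
qed

text \<open>All sums of \<open>fourier_order\<close> elements of \<open>level t\<close> lie in a
  level set that is known to have only linear size, so some coefficient of \<open>level t\<close> is
  nearly maximal. A Markov argument turns this average into concentration of the individual
  angles.\<close>

lemma level_concentration:
  assumes odd: "odd p" and t: "1 \<le> t" "1.6 * t \<le> mu (level t)"
    and card: "mu (level (real fourier_order * t)) \<le> 12 * (real fourier_order * t)"
    and small: "24 * (real fourier_order * t) \<le> p"
  shows "\<exists>k. coprime k p \<and> 0.9 * mu (level t) \<le> mu {d \<in> level t. near_zero (k * d)}"
proof -
  define D where "D = level t"
  define N where "N = mu D"
  define h where "h = fourier_order"
  define q where "q = concentration_ratio"
  note h = fourier_order[folded h_def q_def] and q = concentration_ratio[folded q_def]
  have N: "1.6 * t \<le> N" "0 < N" using t by (auto simp: N_def D_def)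
  let ?D = "dft (\<lambda>x. of_bool (x \<in> D))"
  have "\<exists>k\<in>{1..<p}. q * mu D < norm (?D k)"
  proof (rule large_dft_coefficient[of D h "level (real h * t)" q])
    show "x \<in> level (real h * t)" if "iterated_conv D h x \<noteq> 0" for x
      using iterated_conv_level that by (simp add: D_def)
    have h': "1 \<le> real h" using h by simp
    have ht: "0 < real h * t" using h' t by simp
    have qh: "real h * q ^ (2 * h - 2) < 1 / 15" using h(2) by simp
    have "mu (level (real h * t)) * (N / p + q ^ (2 * h - 2)) \<le> 12 * (real h * t) * (N / p + q ^ (2 * h - 2))"
      using card N q by (intro mult_right_mono) (auto simp: h_def)
    also have "\<dots> = 12 * (real h * t) * N / p + 12 * t * (real h * q ^ (2 * h - 2))"
      by (simp add: algebra_simps)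
    \<comment> \<open>Here \<open>12 * t * (1 / 15)\<close> is \<open>0.8 * t\<close>, at most half
      of \<open>N\<close> because \<open>N\<close> is at least \<open>1.6 * t\<close>.\<close>
    also have "\<dots> < N / 2 + 12 * t * (1 / 15)"
    proof (intro add_le_less_mono)
      have "12 * (real h * t) * N \<le> p / 2 * N"
        using small N by (intro mult_right_mono) (auto simp: h_def)
      then show "12 * (real h * t) * N / p \<le> N / 2" by (simp add: field_simps)
      show "12 * t * (real h * q ^ (2 * h - 2)) < 12 * t * (1 / 15)"
        using qh t by (intro mult_strict_left_mono) auto
    qed
    also have "\<dots> \<le> N" using N by simp
    finally show "mu (level (real h * t)) * (mu D / p + q ^ (2 * h - 2)) < mu D"
      by (simp add: N_def)
  qed (use h q N in \<open>auto simp: N_def\<close>)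
  then obtain k where k: "1 \<le> k" "k < p" "q * N < norm (?D k)" by (auto simp: N_def)
  define c where "c y = Re (echar y)" for y
  have c_double: "c (2 * y) = 2 * (c y)\<^sup>2 - 1" for y
  proof -
    have "c (2 * y) = cos (2 * (2 * pi * y / p))" by (simp add: c_def echar_def mult_ac)
    also have "\<dots> = 2 * (c y)\<^sup>2 - 1" unfolding cos_double_cos by (simp add: c_def echar_def)
    finally show ?thesis .
  qed
  \<comment> \<open>Level sets are symmetric, so the coefficient is real.\<close>
  have Im0: "Im (?D k) = 0"
  proof -
    let ?s = "\<lambda>x. of_bool (x \<in> D) * Im (echar (k * x))"
    have im: "Im (?D k) = (\<Sum>x\<in>{0..<p}. ?s x)"
      unfolding dft_def Im_sum by (intro sum.cong refl) simp
    have "(\<Sum>x\<in>{0..<p}. ?s (0 - x)) = (\<Sum>x\<in>{0..<p}. ?s x)"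
    proof (rule sum_reflect)
      fix x
      have "echar (k * (x + p)) = echar (k * x)"
        using echar_multiple[of k] by (simp add: ring_distribs echar_add)
      then show "?s (x + p) = ?s x" using periodicD[OF periodic_level] by (simp add: D_def)
    qed
    moreover have "?s (0 - x) = - ?s x" for x
      by (simp add: D_def level_minus echar_minus)
    ultimately have "- (\<Sum>x\<in>{0..<p}. ?s x) = (\<Sum>x\<in>{0..<p}. ?s x)" by (simp only: sum_negf)
    then show ?thesis unfolding im by linarith
  qed
  have Re: "Re (?D k) = (\<Sum>x\<in>{0..<p}. of_bool (x \<in> D) * c (k * x))"
    unfolding dft_def Re_sum by (intro sum.cong refl) (simp add: c_def)
  have "norm (?D k) = \<bar>Re (?D k)\<bar>" using Im0 by (simp add: cmod_def)
  then have "(q * N)\<^sup>2 \<le> (Re (?D k))\<^sup>2" using k(3) q N by (intro abs_le_square_iff[THEN iffD1]) simp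
  also have "\<dots> = (\<Sum>x\<in>{0..<p}. of_bool (x \<in> D) * (of_bool (x \<in> D) * c (k * x)))\<^sup>2"
    unfolding Re by (intro arg_cong[where f = "\<lambda>z. z\<^sup>2"] sum.cong refl) simp
  also have "\<dots> \<le> (\<Sum>x\<in>{0..<p}. (of_bool (x \<in> D))\<^sup>2) * (\<Sum>x\<in>{0..<p}. (of_bool (x \<in> D) * c (k * x))\<^sup>2)"
    by (rule Cauchy_Schwarz_ineq_sum)
  also have "(\<Sum>x\<in>{0..<p}. (of_bool (x \<in> D))\<^sup>2) = N"
    unfolding mu_def N_def by (intro sum.cong) auto
  also have "(\<Sum>x\<in>{0..<p}. (of_bool (x \<in> D) * c (k * x))\<^sup>2) =
      (\<Sum>x\<in>{0..<p}. of_bool (x \<in> D) * (c (k * x))\<^sup>2)"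
    by (intro sum.cong refl) simp
  finally have "N * (q\<^sup>2 * N) \<le> N * (\<Sum>x\<in>{0..<p}. of_bool (x \<in> D) * (c (k * x))\<^sup>2)"
    by (simp add: power2_eq_square mult_ac)
  then have q2: "q\<^sup>2 * N \<le> (\<Sum>x\<in>{0..<p}. of_bool (x \<in> D) * (c (k * x))\<^sup>2)"
    using N by (simp only: mult_le_cancel_left_pos)
  \<comment> \<open>The coefficient may be close to \<open>- N\<close> instead of \<open>N\<close>.
    Its square controls the mean squared cosine, and the double angle formula turns this into a
    bound at twice the frequency, where the sign no longer matters. As \<open>p\<close> is odd,
    twice the frequency is still invertible.\<close>
  define k2 where "k2 = 2 * k"
  have "of_bool (x \<in> D) * (1 - c (k2 * x)) = 2 * of_bool (x \<in> D) - 2 * (of_bool (x \<in> D) * (c (k * x))\<^sup>2)" for x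
    using c_double[of "k * x"] by (simp add: k2_def mult_ac)
  then have "(\<Sum>x\<in>{0..<p}. of_bool (x \<in> D) * (1 - c (k2 * x))) =
      2 * N - 2 * (\<Sum>x\<in>{0..<p}. of_bool (x \<in> D) * (c (k * x))\<^sup>2)"
    by (simp only: sum_subtractf sum_distrib_left[symmetric] N_def mu_def)
  also have "\<dots> \<le> 2 * (1 - q\<^sup>2) * N" using q2 by (simp add: algebra_simps)
  also have "\<dots> \<le> 4 * (1 - q) * N"
  proof (intro mult_right_mono)
    have "2 * (1 - q\<^sup>2) = 4 * (1 - q) - 2 * (1 - q)\<^sup>2" by (simp add: power2_eq_square algebra_simps)
    then show "2 * (1 - q\<^sup>2) \<le> 4 * (1 - q)" by simp
  qed (use N in simp)
  also have "4 * (1 - q) = (1 - cos (pi / 100)) / 10" by (simp add: q_def concentration_ratio_def)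
  finally have tot: "(\<Sum>x\<in>{0..<p}. of_bool (x \<in> D) * (1 - c (k2 * x))) \<le> (1 - cos (pi / 100)) / 10 * N" .
  let ?F = "{d \<in> D. \<not> near_zero (k2 * d)}"
  have "(1 - cos (pi / 100)) * mu ?F = (\<Sum>x\<in>{0..<p}. (1 - cos (pi / 100)) * of_bool (x \<in> ?F))"
    by (simp only: mu_def sum_distrib_left)
  also have "\<dots> \<le> (\<Sum>x\<in>{0..<p}. of_bool (x \<in> D) * (1 - c (k2 * x)))"
  proof (intro sum_mono)
    fix x
    have "c (k2 * x) \<le> 1" using abs_Re_le_cmod[of "echar (k2 * x)"] by (simp add: c_def)
    then show "(1 - cos (pi / 100)) * of_bool (x \<in> ?F) \<le> of_bool (x \<in> D) * (1 - c (k2 * x))"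
      using cos_not_near_zero[of "k2 * x"] by (auto simp: c_def)
  qed
  also note tot
  finally have "(1 - cos (pi / 100)) * mu ?F \<le> (1 - cos (pi / 100)) * (N / 10)" by simp
  then have F: "mu ?F \<le> N / 10" using cos_pi_100(2) by simp
  have "mu {d \<in> D. near_zero (k2 * d)} = N - mu ?F"
  proof -
    have "mu (D - {d. \<not> near_zero (k2 * d)}) = N - mu (D \<inter> {d. \<not> near_zero (k2 * d)})"
      by (simp add: mu_Diff N_def)
    moreover have "D - {d. \<not> near_zero (k2 * d)} = {d \<in> D. near_zero (k2 * d)}" by auto
    moreover have "D \<inter> {d. \<not> near_zero (k2 * d)} = ?F" by auto
    ultimately show ?thesis by simp
  qed
  moreover have "coprime k2 p"
  proof -
    have "coprime p k" using k prime_p zdvd_not_zless by (intro prime_imp_coprime) auto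
    moreover have "coprime 2 p" using odd by (simp add: coprime_left_2_iff_odd)
    ultimately show ?thesis by (simp add: k2_def coprime_commute)
  qed
  ultimately show ?thesis using F by (intro exI[of _ k2]) (auto simp: D_def N_def)
qed

end

subsection \<open>Packing modulo the largest element\<close>

lemma Gcd_mem_subgroup:
  fixes H :: "int set"
  assumes "finite E" "E \<subseteq> H" "0 \<in> H"
    and add: "\<And>x y. x \<in> H \<Longrightarrow> y \<in> H \<Longrightarrow> x + y \<in> H"
    and minus: "\<And>x. x \<in> H \<Longrightarrow> - x \<in> H"
  shows "m * Gcd E \<in> H"
proof -
  have mult: "k * x \<in> H" if "x \<in> H" for k x
  proof -
    have nat: "int n * x \<in> H" for n
      by (induction n) (use assms(3) add that in \<open>auto simp: algebra_simps\<close>)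
    show ?thesis
    proof (cases "k \<ge> 0")
      case True
      then show ?thesis using nat[of "nat k"] by simp
    next
      case False
      then show ?thesis using minus[OF nat[of "nat (- k)"]] by simp
    qed
  qed
  have "Gcd E \<in> H"
    using assms(1,2)
  proof (induction E)
    case empty
    then show ?case using assms(3) by simp
  next
    case (insert a F)
    obtain u v where "u * a + v * Gcd F = gcd a (Gcd F)" using bezout_int by blast
    then show ?case using add[OF mult[of a u] mult[of "Gcd F" v]] insert by simp
  qed
  then show ?thesis by (rule mult)
qed

context periodic_seminorm begin

text \<open>The ball of radius \<open>j\<close> around \<open>0\<close> in the Cayley graph of \<open>\<int>/l\<close> with generators \<open>E\<close>. As long as the
  balls grow, translates of \<open>E\<close> around points at distances \<open>0, 3, 6, \<dots>\<close> are disjoint.\<close>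

fun reach :: "int set \<Rightarrow> int \<Rightarrow> nat \<Rightarrow> int set" where
  "reach E l 0 = {0}"
| "reach E l (Suc j) = (\<lambda>(x, e). (x + e) mod l) ` (reach E l j \<times> E)"

declare reach.simps [simp del]

lemma reach_SucI: "x \<in> reach E l j \<Longrightarrow> e \<in> E \<Longrightarrow> (x + e) mod l \<in> reach E l (Suc j)"
  by (force simp: reach.simps)

lemma reach_subset: "0 < l \<Longrightarrow> reach E l j \<subseteq> {0..<l}"
  by (cases j) (auto simp: reach.simps)

lemma reach_mono:
  assumes "0 < l" "0 \<in> E"
  shows "reach E l j \<subseteq> reach E l (Suc j)"
proof
  fix x assume x: "x \<in> reach E l j"
  then have "x = (x + 0) mod l" using reach_subset[OF assms(1), of E j] by auto
  then show "x \<in> reach E l (Suc j)" using reach_SucI[OF x assms(2)] by simp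
qed

lemma finite_reach: "0 < l \<Longrightarrow> finite (reach E l j)"
  by (rule finite_subset[OF reach_subset]) auto

text \<open>One step costs at most \<open>t\<close> for the generator and another \<open>t\<close>
  for undoing a single wrap around \<open>l\<close>.\<close>

lemma reach_seminorm:
  assumes l: "0 < l" "f l \<le> t" and E: "\<And>e. e \<in> E \<Longrightarrow> \<bar>e\<bar> \<le> l \<and> f e \<le> t"
  shows "x \<in> reach E l j \<Longrightarrow> f x \<le> 2 * real j * t"
proof (induction j arbitrary: x)
  case 0
  then show ?case by (simp add: f_zero reach.simps)
next
  case (Suc j)
  then obtain y e where ye: "y \<in> reach E l j" "e \<in> E" "x = (y + e) mod l"
    by (auto simp: reach.simps)
  have y: "0 \<le> y" "y < l" using ye reach_subset[OF l(1), of E j] by auto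
  have fy: "f (y + e) \<le> 2 * real j * t + t"
    using f_triangle[of y e] Suc.IH[OF ye(1)] E[OF ye(2)] by linarith
  have t: "0 \<le> t" using l f_nonneg[of l] by linarith
  consider "y + e < 0" | "0 \<le> y + e" "y + e < l" | "l \<le> y + e" by linarith
  then have "f x \<le> f (y + e) + t"
  proof cases
    case 1
    have "x = (y + e + l) mod l" using ye by simp
    moreover have "(y + e + l) mod l = y + e + l"
      using 1 y E[OF ye(2)] by (intro mod_pos_pos_trivial) linarith+
    ultimately have "x = (y + e) + l" by simp
    then show ?thesis using f_triangle[of "y + e" l] l by simp
  next
    case 2
    then have "x = y + e" using ye by simp
    then show ?thesis using t by simp
  next
    case 3
    have "x = (y + e - l) mod l" using ye by simp
    moreover have "(y + e - l) mod l = y + e - l"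
      using 3 y E[OF ye(2)] by (intro mod_pos_pos_trivial) linarith+
    ultimately have "x = (y + e) + - l" by simp
    then show ?thesis using f_triangle[of "y + e" "- l"] l by (simp add: f_minus)
  qed
  then show ?case using fy by (simp add: algebra_simps)
qed

text \<open>The preimage \<open>G\<close> of a ball that has stopped growing is invariant under
  adding generators. Its stabiliser \<open>H\<close> is thus a subgroup of the integers containing
  \<open>E\<close>, hence all multiples of \<open>Gcd E\<close>.\<close>

lemma reach_stable:
  assumes l: "0 < l" "l \<in> E" and fin: "finite E" and sym: "\<And>e. e \<in> E \<Longrightarrow> - e \<in> E"
    and zero: "0 \<in> E" and stable: "reach E l (Suc j) = reach E l j"
    and y: "0 \<le> y * Gcd E" "y * Gcd E < l"
  shows "y * Gcd E \<in> reach E l j"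
proof -
  define G where "G = {z. z mod l \<in> reach E l j}"
  define H where "H = {h. \<forall>z. z \<in> G \<longleftrightarrow> z + h \<in> G}"
  have GE: "z + e \<in> G" if "z \<in> G" "e \<in> E" for z e
  proof -
    have "(z mod l + e) mod l \<in> reach E l (Suc j)" using that by (simp add: G_def reach_SucI)
    then show ?thesis using stable by (simp add: G_def mod_add_left_eq)
  qed
  have EH: "E \<subseteq> H"
  proof
    fix e assume e: "e \<in> E"
    have "z \<in> G \<longleftrightarrow> z + e \<in> G" for z
      using GE[of z e] GE[of "z + e" "- e"] e sym by auto
    then show "e \<in> H" by (simp add: H_def)
  qed
  have "y * Gcd E \<in> H"
  proof (rule Gcd_mem_subgroup[OF fin EH])
    show "0 \<in> H" by (simp add: H_def)
    show "a + b \<in> H" if "a \<in> H" "b \<in> H" for a b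
      using that by (simp add: H_def flip: add.assoc)
    show "- a \<in> H" if "a \<in> H" for a
      unfolding H_def
    proof (intro CollectI allI)
      fix z
      have "z + - a \<in> G \<longleftrightarrow> (z + - a) + a \<in> G" using that unfolding H_def by blast
      then show "z \<in> G \<longleftrightarrow> z + - a \<in> G" by simp
    qed
  qed
  moreover have "0 \<in> reach E l j"
    by (induction j) (use reach_mono[OF l(1) zero] in \<open>auto simp: reach.simps(1)\<close>)
  then have "0 \<in> G" by (simp add: G_def)
  ultimately have "0 + y * Gcd E \<in> G" unfolding H_def by blast
  then show ?thesis using y by (simp add: G_def)
qed

lemma reach_growth:
  assumes l: "0 < l" and sym: "\<And>e. e \<in> E \<Longrightarrow> - e \<in> E" and zero: "0 \<in> E"
    and grows: "\<And>j. j \<le> 3 * n \<Longrightarrow> reach E l (Suc j) \<noteq> reach E l j"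
  shows "i \<le> n \<Longrightarrow> (i + 1) * card (E \<inter> {0..<l}) \<le> card (reach E l (3 * i + 1))"
proof (induction i)
  case 0
  have "E \<inter> {0..<l} \<subseteq> reach E l (Suc 0)" by (force simp: reach.simps)
  from card_mono[OF finite_reach[OF l] this] show ?case by simp
next
  case (Suc i)
  \<comment> \<open>Yields a point \<open>x\<close> at distance exactly \<open>3 * i + 3\<close>.
    The translate of \<open>E\<close> around it stays in the ball of radius \<open>3 * i + 4\<close>
    and misses the ball of radius \<open>3 * i + 1\<close>, since one step back would bring
    \<open>x\<close> within distance \<open>3 * i + 2\<close>.\<close>
  have "reach E l (Suc (3 * i + 2)) \<noteq> reach E l (3 * i + 2)" using Suc.prems by (intro grows) simp
  then obtain x where x: "x \<in> reach E l (Suc (3 * i + 2))" "x \<notin> reach E l (3 * i + 2)"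
    using reach_mono[OF l zero, of "3 * i + 2"] by blast
  have x0: "0 \<le> x" "x < l" using x reach_subset[OF l] by fastforce+
  define Z where "Z = (\<lambda>e. (x + e) mod l) ` (E \<inter> {0..<l})"
  have "inj_on (\<lambda>e. (x + e) mod l) (E \<inter> {0..<l})"
  proof (rule inj_onI)
    fix a b assume ab: "a \<in> E \<inter> {0..<l}" "b \<in> E \<inter> {0..<l}" "(x + a) mod l = (x + b) mod l"
    then have "[x + a = x + b] (mod l)" by (simp add: cong_def)
    then have "[a = b] (mod l)" by (simp add: cong_add_lcancel)
    then show "a = b" using ab by (simp add: cong_def)
  qed
  then have cZ: "card Z = card (E \<inter> {0..<l})" by (simp add: Z_def card_image)
  have disj: "Z \<inter> reach E l (3 * i + 1) = {}"
  proof (rule ccontr)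
    assume "\<not> ?thesis"
    then obtain e where e: "e \<in> E" "(x + e) mod l \<in> reach E l (3 * i + 1)" by (auto simp: Z_def)
    have "((x + e) mod l + - e) mod l \<in> reach E l (Suc (3 * i + 1))"
      using e sym by (intro reach_SucI) auto
    moreover have "((x + e) mod l + - e) mod l = x"
      using x0 mod_diff_left_eq[of "x + e" l e] by simp
    ultimately show False using x(2) by simp
  qed
  have "Z \<subseteq> reach E l (Suc (Suc (3 * i + 2)))" using reach_SucI[OF x(1)] by (auto simp: Z_def)
  moreover have "reach E l (3 * i + 1) \<subseteq> reach E l (Suc (Suc (3 * i + 2)))"
    using reach_mono[OF l zero, of "3 * i + 1"] reach_mono[OF l zero, of "3 * i + 2"]
      reach_mono[OF l zero, of "Suc (3 * i + 2)"] by simp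
  ultimately have "card (Z \<union> reach E l (3 * i + 1)) \<le> card (reach E l (Suc (Suc (3 * i + 2))))"
    by (intro card_mono finite_reach l) blast
  moreover have "card (Z \<union> reach E l (3 * i + 1)) = card Z + card (reach E l (3 * i + 1))"
    using disj by (intro card_Un_disjoint finite_reach l) (auto simp: Z_def intro: finite_subset[of _ "{0..<l}"])
  moreover have eq: "3 * Suc i + 1 = Suc (Suc (3 * i + 2))" by simp
  ultimately show ?case unfolding eq using Suc cZ by simp
qed

text \<open>Reduce modulo the maximum \<open>m\<close> of the set \<open>E\<close> of small
  elements. If no ball of radius at most 153 were stable, the ball of radius 154 would hold 52
  disjoint translates of size \<open>n\<close>, and its 155 shifts by multiples of \<open>m\<close>
  would give \<open>155 * 52 * 0.7 * t = 5642 * t\<close> residues in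
  \<open>level (462 * t)\<close>, more than the \<open>5544 * t\<close> that \<open>lev\<close>
  allows. So some ball is stable, and every multiple of the gcd below \<open>m\<close> is within 153
  steps of 0, at cost \<open>2 * 153 * t = 306 * t\<close>.\<close>

lemma short_progression:
  assumes t: "25 \<le> t"
    and E: "36 / 25 * t \<le> real (card {y. 200 * \<bar>y\<bar> < p \<and> f y \<le> t})"
    and lev: "mu (level (462 * t)) \<le> 12 * (462 * t)"
  shows "\<exists>g l. 0 < g \<and> 0 < l \<and> g * l < p \<and> f (g * l) \<le> t \<and> 36 / 25 * t \<le> 2 * l + 1 \<and>
    (\<forall>x. 0 \<le> x \<and> x < l \<longrightarrow> f (g * x) \<le> 306 * t)"
proof -
  define E where "E = {y. 200 * \<bar>y\<bar> < p \<and> f y \<le> t}"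
  have "E \<subseteq> {- p..p}" by (auto simp: E_def)
  then have fin: "finite E" by (rule finite_subset) simp
  have zero: "0 \<in> E" using t by (simp add: E_def f_zero)
  have sym: "- e \<in> E" if "e \<in> E" for e using that by (simp add: E_def f_minus)
  have cE: "36 / 25 * t \<le> real (card E)" using E by (simp add: E_def)
  define m where "m = Max E"
  have mE: "m \<in> E" using Max_in[OF fin] zero by (auto simp: m_def)
  have ub: "\<bar>e\<bar> \<le> m" if "e \<in> E" for e
    using Max_ge[OF fin that] Max_ge[OF fin sym[OF that]] by (simp add: m_def abs_le_iff)
  have m0: "0 < m"
  proof (rule ccontr)
    assume "\<not> 0 < m"
    then have "E \<subseteq> {0}" using ub by fastforce
    then have "card E \<le> 1" using card_mono[of "{0::int}" E] by simp
    then show False using cE t by simp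
  qed
  have fm: "f m \<le> t" and mp: "200 * m < p" using mE m0 by (auto simp: E_def)
  define n where "n = card (E \<inter> {0..<m})"
  \<comment> \<open>Up to sign, \<open>E\<close> consists of its elements in \<open>{0..<m}\<close>
    and of \<open>m\<close>, so it has at most \<open>2 * n + 1\<close> elements. The rounding loss
    is where \<open>25 \<le> t\<close> enters: \<open>0.72 * t - 0.5\<close> is at least
    \<open>0.7 * t\<close>.\<close>
  have n: "0.7 * t \<le> real n"
  proof -
    have "E \<subseteq> (E \<inter> {0..<m}) \<union> uminus ` (E \<inter> {0..<m} - {0}) \<union> {m, - m}"
    proof
      fix e assume e: "e \<in> E"
      consider "0 \<le> e" "e < m" | "e = m" | "e = - m" | "e < 0" "- e < m" using ub[OF e] by linarith
      then show "e \<in> (E \<inter> {0..<m}) \<union> uminus ` (E \<inter> {0..<m} - {0}) \<union> {m, - m}"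
      proof cases
        case 4
        then have "- e \<in> E \<inter> {0..<m} - {0}" using sym[OF e] by simp
        then show ?thesis by force
      qed (use e in auto)
    qed
    then have "card E \<le> card ((E \<inter> {0..<m}) \<union> uminus ` (E \<inter> {0..<m} - {0}) \<union> {m, - m})"
      by (intro card_mono) (use fin in auto)
    also have "\<dots> \<le> card (E \<inter> {0..<m}) + card (uminus ` (E \<inter> {0..<m} - {0})) + card {m, - m}"
      by (meson add_mono card_Un_le le_refl order_trans)
    also have "card (uminus ` (E \<inter> {0..<m} - {0})) \<le> n - 1"
      using zero m0 fin by (simp add: card_image n_def)
    also have "card {m, - m} \<le> 2" by (simp add: card_insert_if)
    finally have "card E \<le> n + (n - 1) + 2" by (simp add: n_def)
    moreover have "n \<noteq> 0" using zero m0 fin by (auto simp: n_def)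
    ultimately have "real (card E) \<le> 2 * real n + 1" by linarith
    then show ?thesis using cE t by linarith
  qed
  have "\<exists>j\<le>153. reach E m (Suc j) = reach E m j"
  proof (rule ccontr)
    assume "\<not> ?thesis"
    then have "(51 + 1) * n \<le> card (reach E m (3 * 51 + 1))"
      unfolding n_def by (intro reach_growth[where n = 51] m0 sym zero) auto
    then have big: "52 * real n \<le> real (card (reach E m 154))" by simp
    \<comment> \<open>The radius 462 is \<open>2 * 154\<close> for the ball plus 154 for the
      multiple of \<open>m\<close>. All elements are below \<open>155 * m\<close> and hence below
      \<open>p\<close>, because \<open>E\<close> only has elements of size less than
      \<open>p / 200\<close>.\<close>
    define Y where "Y = (\<lambda>(x, i). x + i * m) ` (reach E m 154 \<times> {0..154::int})"
    have "inj_on (\<lambda>(x, i). x + i * m) (reach E m 154 \<times> {0..154::int})"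
    proof (rule inj_onI, clarify)
      fix x i x' i' assume a: "x \<in> reach E m 154" "x' \<in> reach E m 154" "x + i * m = x' + i' * m"
      have r: "0 \<le> x" "x < m" "0 \<le> x'" "x' < m" using a reach_subset[OF m0] by fastforce+
      have "i = (x + i * m) div m" "i' = (x' + i' * m) div m" using r by auto
      then have "i = i'" using a by simp
      then show "x = x' \<and> i = i'" using a by simp
    qed
    then have cY: "card Y = 155 * card (reach E m 154)"
      by (simp add: Y_def card_image card_cartesian_product)
    have "Y \<subseteq> level (462 * t)"
    proof (clarsimp simp: Y_def level_def)
      fix x and i :: int assume x: "x \<in> reach E m 154" and i: "0 \<le> i" "i \<le> 154"
      have "f x \<le> 2 * real 154 * t"
        by (rule reach_seminorm[OF m0 fm _ x]) (use ub in \<open>auto simp: E_def\<close>)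
      moreover have "f (int k * m) \<le> real k * t" for k
      proof (induction k)
        case (Suc k)
        then show ?case using f_triangle[of "int k * m" m] fm by (simp add: algebra_simps)
      qed (simp add: f_zero)
      from this[of "nat i"] have "f (i * m) \<le> real (nat i) * t" using i by simp
      moreover have "real (nat i) * t \<le> 154 * t" using i t by (intro mult_right_mono) auto
      ultimately show "f (x + i * m) \<le> 462 * t" using f_triangle[of x "i * m"] by linarith
    qed
    moreover have "Y \<subseteq> {0..<p}"
    proof (clarsimp simp: Y_def)
      fix x and i :: int assume x: "x \<in> reach E m 154" and i: "0 \<le> i" "i \<le> 154"
      have "0 \<le> x" "x < m" using x reach_subset[OF m0] by fastforce+
      moreover have "i * m \<le> 154 * m" using i m0 by (intro mult_right_mono) auto
      moreover have "0 \<le> i * m" using i m0 by simp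
      ultimately show "0 \<le> x + i * m \<and> x + i * m < p" using mp by linarith
    qed
    ultimately have "real (card Y) \<le> mu (level (462 * t))" by (rule card_le_mu)
    then have "real (card Y) \<le> 12 * (462 * t)" using lev by linarith
    moreover have "real (card Y) = 155 * real (card (reach E m 154))" using cY by simp
    ultimately show False using big n t by linarith
  qed
  then obtain j where j: "j \<le> 153" "reach E m (Suc j) = reach E m j" by auto
  define g where "g = Gcd E"
  have gm: "g dvd m" using mE by (simp add: g_def)
  have "g \<noteq> 0" using gm m0 by auto
  moreover have "g \<ge> 0" by (simp add: g_def)
  ultimately have g0: "0 < g" by simp
  define l where "l = m div g"
  have gl: "g * l = m" using gm by (simp add: l_def)
  have l0: "0 < l" using gl m0 g0 by (metis zero_less_mult_pos)
  have "f (g * x) \<le> 306 * t" if x: "0 \<le> x" "x < l" for x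
  proof -
    have "x * g < m" using x g0 gl by (metis mult_strict_left_mono mult.commute)
    moreover have "0 \<le> x * g" using x g0 by simp
    ultimately have "x * g \<in> reach E m j"
      unfolding g_def using reach_stable[OF m0 mE fin sym zero j(2)] by blast
    then have "f (x * g) \<le> 2 * real j * t"
      by (rule reach_seminorm[OF m0 fm, rotated]) (use ub in \<open>auto simp: E_def\<close>)
    also have "\<dots> \<le> 306 * t" using j t by (intro mult_right_mono) auto
    finally show ?thesis by (simp add: mult.commute)
  qed
  moreover have "36 / 25 * t \<le> 2 * l + 1"
  proof -
    have "E \<subseteq> (\<lambda>y. g * y) ` {- l..l}"
    proof
      fix e assume e: "e \<in> E"
      then obtain y where y: "e = g * y" unfolding g_def by (meson Gcd_dvd dvdE)
      have "\<bar>g * y\<bar> \<le> g * l" using ub[OF e] y gl by simp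
      then have "\<bar>y\<bar> \<le> l" using g0 by (simp add: abs_mult)
      then show "e \<in> (\<lambda>y. g * y) ` {- l..l}" using y by (auto simp: abs_le_iff)
    qed
    then have "card E \<le> card ((\<lambda>y. g * y) ` {- l..l})" by (intro card_mono) auto
    also have "\<dots> \<le> card {- l..l}" by (rule card_image_le) simp
    finally have "real (card E) \<le> 2 * l + 1" using l0 by simp
    then show ?thesis using cE by linarith
  qed
  ultimately show ?thesis using g0 l0 gl fm mp m0 by (intro exI[of _ g] exI[of _ l]) auto
qed

end

subsection \<open>Small shift loss and arcs\<close>

context periodic_seminorm begin

lemma seminorm_dilate: "periodic_seminorm p (\<lambda>y. f (j * y))"
proof unfold_locales
  show "f (j * (x + p)) = f (j * x)" for x
    using periodic_mult_fun[of f "j * x" j] f_periodic by (simp add: distrib_left)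
  show "f (j * (x + y)) \<le> f (j * x) + f (j * y)" for x y
    using f_triangle by (simp add: distrib_left)
qed (simp_all add: f_minus f_zero)

text \<open>Substituting \<open>d = j * y\<close>, with \<open>j\<close> the inverse of the
  frequency \<open>k\<close>, turns the elements with \<open>k * d\<close> near a multiple of
  \<open>p\<close> into integers \<open>y\<close> of size below \<open>p / 200\<close>;
  \<open>0.9 * 1.6 = 36 / 25\<close> times \<open>t\<close> of them remain. The final multiplier is
  \<open>j * g\<close>, where \<open>g\<close> is the common divisor found by packing.\<close>

lemma dilated_progression:
  assumes odd: "odd p" and t: "25 \<le> t" "8 / 5 * t \<le> mu (level t)"
    and lev: "mu (level (real fourier_order * t)) \<le> 12 * (real fourier_order * t)"
      "mu (level (462 * t)) \<le> 12 * (462 * t)"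
    and small: "24 * (real fourier_order * t) \<le> p"
  shows "\<exists>k l. coprime k p \<and> 0 < l \<and> f (k * l) \<le> t \<and> 36 / 25 * t \<le> 2 * l + 1 \<and>
    (\<forall>x. 0 \<le> x \<and> x < l \<longrightarrow> f (k * x) \<le> 306 * t)"
proof -
  obtain k where k: "coprime k p" "9 / 10 * mu (level t) \<le> mu {d \<in> level t. near_zero (k * d)}"
    using level_concentration[OF odd _ _ lev(1) small] t by auto
  obtain j where j: "[k * j = 1] (mod p)" using cong_solve_coprime_int[OF k(1)] by blast
  have cj: "coprime j p"
    using j by (metis coprime_iff_invertible_int mult.commute)
  interpret dil: periodic_seminorm p "\<lambda>y. f (j * y)" by (rule seminorm_dilate)
  have dlev: "mu (dil.level s) = mu (level s)" for s
    using mu_affine[OF periodic_level cj, of 0 s] by (simp add: level_def dil.level_def)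
  have near_cong: "near_zero x \<longleftrightarrow> near_zero y" if xy: "[x = y] (mod p)" for x y
  proof -
    have *: "near_zero y" if nz: "near_zero x" and c: "[x = y] (mod p)" for x y
    proof -
      obtain i where i: "200 * \<bar>x - i * p\<bar> < p" using nz unfolding near_zero_def by blast
      obtain m where "y = x + p * m" using c cong_iff_lin by blast
      then have "y - (i + m) * p = x - i * p" by (simp add: algebra_simps)
      then show ?thesis unfolding near_zero_def using i by (intro exI[of _ "i + m"]) simp
    qed
    show ?thesis using * xy cong_sym by blast
  qed
  let ?F = "{d \<in> level t. near_zero (k * d)}" and ?E = "{y. 200 * \<bar>y\<bar> < p \<and> f (j * y) \<le> t}"
  have perF: "periodic ?F"
  proof -
    have "near_zero (k * (x + p)) \<longleftrightarrow> near_zero (k * x)" for x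
      by (rule near_cong) (simp add: cong_def distrib_left)
    then show ?thesis using periodicD[OF periodic_level] by (simp add: periodic_def)
  qed
  have "mu ?F = mu {y. j * y + 0 \<in> ?F}" using mu_affine[OF perF cj, of 0] by simp
  also have "{y. j * y + 0 \<in> ?F} = {y. f (j * y) \<le> t \<and> near_zero y}"
  proof -
    have "near_zero (k * (j * y)) \<longleftrightarrow> near_zero y" for y
      by (rule near_cong) (use cong_mult[OF j cong_refl, of y] in \<open>simp add: mult.assoc\<close>)
    then show ?thesis by (auto simp: level_def)
  qed
  also have "mu \<dots> \<le> real (card ?E)"
  proof -
    have fin: "finite ?E" by (rule finite_subset[of _ "{- p..p}"]) auto
    have "{y. f (j * y) \<le> t \<and> near_zero y} \<inter> {0..<p} \<subseteq> (\<lambda>z. z mod p) ` ?E"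
    proof
      fix y assume y: "y \<in> {y. f (j * y) \<le> t \<and> near_zero y} \<inter> {0..<p}"
      then obtain i where i: "200 * \<bar>y - i * p\<bar> < p" by (auto simp: near_zero_def)
      have "f (j * (y + (- i) * p)) = f (j * y)"
        by (rule periodic_mult_fun) (rule dil.f_periodic)
      then have "y - i * p \<in> ?E" using y i by simp
      moreover have "y = (y - i * p) mod p" using y by (simp add: mod_diff_right_eq[symmetric])
      ultimately show "y \<in> (\<lambda>z. z mod p) ` ?E" by (rule rev_image_eqI)
    qed
    then have "card ({y. f (j * y) \<le> t \<and> near_zero y} \<inter> {0..<p}) \<le> card ?E"
      using card_mono[OF finite_imageI[OF fin], of _ "\<lambda>z. z mod p"] card_image_le[OF fin, of "\<lambda>z. z mod p"]
      by (meson order_trans)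
    then show ?thesis by (simp add: mu_card)
  qed
  finally have "36 / 25 * t \<le> real (card ?E)" using k(2) t by simp
  then obtain g l where gl: "0 < g" "0 < l" "g * l < p" "f (j * (g * l)) \<le> t" "36 / 25 * t \<le> 2 * l + 1"
      "\<And>x. 0 \<le> x \<and> x < l \<Longrightarrow> f (j * (g * x)) \<le> 306 * t"
    using dil.short_progression[of t] t lev dlev by auto
  have "g \<le> g * l" using gl by (simp add: mult_le_cancel_left1)
  then have "g < p" using gl(3) by linarith
  then have "\<not> p dvd g" using gl(1) zdvd_not_zless by blast
  then have "coprime p g" using prime_p by (intro prime_imp_coprime)
  then have "coprime (j * g) p" using cj by (simp add: coprime_commute)
  then show ?thesis using gl by (intro exI[of _ "j * g"] exI[of _ l]) (auto simp: mult.assoc)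
qed

end

context prime_modulus begin

definition cyc_arc :: "int \<Rightarrow> int \<Rightarrow> int set" where
  "cyc_arc x y = {z. \<exists>j. x \<le> z + j * p \<and> z + j * p < y}"

lemma periodic_arc: "periodic (cyc_arc x y)"
  unfolding periodic_def
proof
  fix z
  have "z + p + j * p = z + (j + 1) * p" "z + j * p = z + p + (j - 1) * p" for j
    by (simp_all add: algebra_simps)
  then show "z + p \<in> cyc_arc x y \<longleftrightarrow> z \<in> cyc_arc x y" unfolding cyc_arc_def mem_Collect_eq by metis
qed

lemma arc_rep:
  obtains z' where "[z' = z] (mod p)" "a \<le> z'" "z' < a + p"
proof
  show "[a + (z - a) mod p = z] (mod p)" by (simp add: cong_def mod_add_right_eq)
qed simp_all

lemma arcI: "x \<le> z \<Longrightarrow> z < y \<Longrightarrow> z \<in> cyc_arc x y"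
  unfolding cyc_arc_def by (intro CollectI exI[of _ 0]) simp

lemma sum_period_window:
  fixes g :: "int \<Rightarrow> real"
  assumes "\<And>x. g (x + p) = g x"
  shows "(\<Sum>x\<in>{a..<a + p}. g x) = (\<Sum>x\<in>{0..<p}. g x)"
proof -
  have "(\<Sum>x\<in>{a..<a + p}. g x) = (\<Sum>x\<in>{0..<p}. g (x + a))"
    by (rule sum.reindex_bij_witness[of _ "\<lambda>x. x + a" "\<lambda>x. x - a"]) auto
  then show ?thesis using sum_shift[of g a] assms by simp
qed

lemma variation_ge:
  fixes u :: "int \<Rightarrow> real"
  assumes "a \<le> b"
  shows "\<bar>u b - u a\<bar> \<le> (\<Sum>x\<in>{a..<b}. \<bar>u (x + 1) - u x\<bar>)"
  using assms
proof (induction b rule: int_ge_induct)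
  case (step i)
  have "{a..<i + 1} = insert i {a..<i}" using step by auto
  then have "(\<Sum>x\<in>{a..<i + 1}. \<bar>u (x + 1) - u x\<bar>) = \<bar>u (i + 1) - u i\<bar> + (\<Sum>x\<in>{a..<i}. \<bar>u (x + 1) - u x\<bar>)"
    by simp
  then show ?case using step by linarith
qed simp

definition window_count :: "int set \<Rightarrow> int \<Rightarrow> int \<Rightarrow> real" where
  "window_count A l x = (\<Sum>i\<in>{0..<l}. of_bool (x + i \<in> A))"

lemma window_count_periodic: "periodic A \<Longrightarrow> window_count A l (x + p) = window_count A l x"
proof -
  assume A: "periodic A"
  have "x + p + i \<in> A \<longleftrightarrow> x + i \<in> A" for i
    using periodicD[OF A, of "x + i"] by (simp add: algebra_simps)
  then show ?thesis by (simp add: window_count_def)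
qed

lemma window_count_Compl: "0 \<le> l \<Longrightarrow> window_count (- A) l x = l - window_count A l x"
proof -
  assume l: "0 \<le> l"
  have "window_count (- A) l x + window_count A l x = (\<Sum>i\<in>{0..<l}. 1)"
    unfolding window_count_def sum.distrib[symmetric] by (intro sum.cong) auto
  then show ?thesis using l by simp
qed

lemma window_count_step:
  assumes "0 \<le> l"
  shows "window_count A l (x + 1) - window_count A l x = of_bool (x + l \<in> A) - of_bool (x \<in> A)"
proof -
  define g :: "int \<Rightarrow> real" where "g i = of_bool (x + i \<in> A)" for i
  have "window_count A l (x + 1) = (\<Sum>i\<in>{1..<l + 1}. g i)"
    unfolding window_count_def g_def
    by (rule sum.reindex_bij_witness[of _ "\<lambda>i. i - 1" "\<lambda>i. i + 1"]) (auto simp: algebra_simps)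
  moreover have "insert 0 {1..<l + 1} = insert l {0..<l}" using assms by auto
  then have "(\<Sum>i\<in>insert 0 {1..<l + 1}. g i) = (\<Sum>i\<in>insert l {0..<l}. g i)" by (simp only:)
  then have "g 0 + (\<Sum>i\<in>{1..<l + 1}. g i) = g l + (\<Sum>i\<in>{0..<l}. g i)" by simp
  moreover have "window_count A l x = (\<Sum>i\<in>{0..<l}. g i)" by (simp only: window_count_def g_def)
  ultimately have "window_count A l (x + 1) - window_count A l x = g l - g 0" by linarith
  then show ?thesis by (simp add: g_def)
qed

text \<open>An element of \<open>A\<close> with a sparse window is lost by at least a tenth of the
  shifts below \<open>l\<close>, while each of these shifts loses at most \<open>K\<close>
  elements.\<close>

lemma few_sparse_windows:
  assumes "periodic A" and l: "0 < l" and K: "\<And>i. 0 \<le> i \<Longrightarrow> i < l \<Longrightarrow> shift_loss A i \<le> K"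
  shows "mu {x. x \<in> A \<and> window_count A l x < 9 / 10 * l} \<le> 10 * K"
proof -
  let ?F = "{x. x \<in> A \<and> window_count A l x < 9 / 10 * l}"
  have "mu ?F * (l / 10) = (\<Sum>x\<in>{0..<p}. of_bool (x \<in> ?F) * (l / 10))"
    by (simp only: mu_def sum_distrib_right)
  also have "\<dots> \<le> (\<Sum>x\<in>{0..<p}. of_bool (x \<in> A) * window_count (- A) l x)"
  proof (intro sum_mono)
    fix x
    have "0 \<le> window_count (- A) l x" unfolding window_count_def by (intro sum_nonneg) simp
    then show "of_bool (x \<in> ?F) * (l / 10) \<le> of_bool (x \<in> A) * window_count (- A) l x"
      using window_count_Compl[of l A x] l by auto
  qed
  also have "\<dots> = (\<Sum>x\<in>{0..<p}. \<Sum>i\<in>{0..<l}. of_bool (x \<in> A \<and> x + i \<notin> A))"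
    unfolding window_count_def sum_distrib_left by (intro sum.cong) auto
  also have "\<dots> = (\<Sum>i\<in>{0..<l}. \<Sum>x\<in>{0..<p}. of_bool (x \<in> A \<and> x + i \<notin> A))" by (rule sum.swap)
  also have "\<dots> = (\<Sum>i\<in>{0..<l}. shift_loss A i)"
    by (simp only: shift_loss_def mu_def mem_Collect_eq)
  also have "\<dots> \<le> (\<Sum>i\<in>{0..<l}. K)" by (intro sum_mono) (use K in auto)
  also have "\<dots> = l * K" using l by simp
  finally show ?thesis using l by (simp add: field_simps)
qed

text \<open>The window count is at least \<open>0.9 * l\<close> at most points of \<open>A\<close>
  and at most \<open>0.1 * l\<close> at most points outside. Its variation over a period is twice
  the shift loss of \<open>l\<close>, less than \<open>3.2 * l\<close>, whereas a pattern high, low,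
  high, low would need four changes of at least \<open>0.8 * l\<close>.\<close>

lemma near_arc:
  assumes per: "periodic A" and l: "0 < l" and fl: "shift_loss A l < 8 / 5 * l"
    and K: "\<And>i. 0 \<le> i \<Longrightarrow> i < l \<Longrightarrow> shift_loss A i \<le> K"
    and big: "10 * K < mu A" "10 * K < p - mu A"
  shows "\<exists>x y. x < y \<and> y < x + p \<and> mu (A - cyc_arc x y) \<le> 10 * K \<and> mu (cyc_arc x y - A) \<le> 10 * K"
proof -
  define u where "u = window_count A l"
  have uper: "u (x + p) = u x" for x by (simp add: u_def window_count_periodic[OF per])
  have ucong: "u x = u y" if "[x = y] (mod p)" for x y
    using that periodic_fun_mod[of u] uper unfolding cong_def by metis
  let ?NH = "{x. x \<in> A \<and> u x < 9 / 10 * l}" and ?NL = "{x. x \<notin> A \<and> 1 / 10 * l < u x}"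
  have NH: "mu ?NH \<le> 10 * K" using few_sparse_windows[OF per l K] by (simp add: u_def)
  have "mu {x. x \<in> - A \<and> window_count (- A) l x < 9 / 10 * l} \<le> 10 * K"
    using few_sparse_windows[OF periodic_Compl[OF per] l, of K] K shift_loss_Compl[OF per] by simp
  moreover have "{x. x \<in> - A \<and> window_count (- A) l x < 9 / 10 * l} = ?NL"
    using window_count_Compl[of l A] l by (auto simp: u_def)
  ultimately have NL: "mu ?NL \<le> 10 * K" by simp
  have tv: "(\<Sum>x\<in>{0..<p}. \<bar>u (x + 1) - u x\<bar>) = 2 * shift_loss A l"
  proof -
    have "(\<Sum>x\<in>{0..<p}. \<bar>u (x + 1) - u x\<bar>) =
        (\<Sum>x\<in>{0..<p}. of_bool (x \<in> {x. x \<in> A \<and> x + l \<notin> A}) + of_bool (x \<in> {x. x \<in> - A \<and> x + l \<notin> - A}))"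
      using window_count_step[of l A] l by (intro sum.cong refl) (simp add: u_def)
    also have "\<dots> = shift_loss A l + shift_loss (- A) l"
      by (simp only: sum.distrib shift_loss_def mu_def)
    finally show ?thesis by (simp add: shift_loss_Compl[OF per])
  qed
  have unimodal: False
    if "x1 < x2" "x2 < x3" "x3 < x4" "x4 < x1 + p" "9 / 10 * l \<le> u x1" "u x2 \<le> 1 / 10 * l"
      "9 / 10 * l \<le> u x3" "u x4 \<le> 1 / 10 * l" for x1 x2 x3 x4
  proof -
    let ?v = "\<lambda>x. \<bar>u (x + 1) - u x\<bar>"
    have split: "(\<Sum>x\<in>{a..<c}. ?v x) = (\<Sum>x\<in>{a..<b}. ?v x) + (\<Sum>x\<in>{b..<c}. ?v x)"
      if "a \<le> b" "b \<le> c" for a b c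
    proof -
      have "{a..<c} = {a..<b} \<union> {b..<c}" using that by auto
      then show ?thesis by (simp add: sum.union_disjoint)
    qed
    have "u (x + p + 1) = u (x + 1)" for x using uper[of "x + 1"] by (simp add: algebra_simps)
    then have "(\<Sum>x\<in>{x1..<x1 + p}. ?v x) = 2 * shift_loss A l"
      unfolding tv[symmetric] by (intro sum_period_window) (simp add: uper)
    moreover have "(\<Sum>x\<in>{x1..<x1 + p}. ?v x) = (\<Sum>x\<in>{x1..<x2}. ?v x) + (\<Sum>x\<in>{x2..<x3}. ?v x) +
        (\<Sum>x\<in>{x3..<x4}. ?v x) + (\<Sum>x\<in>{x4..<x1 + p}. ?v x)"
      using split[of x1 x2 "x1 + p"] split[of x2 x3 "x1 + p"] split[of x3 x4 "x1 + p"] that by linarith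
    ultimately show False
      using variation_ge[of x1 x2 u] variation_ge[of x2 x3 u] variation_ge[of x3 x4 u]
        variation_ge[of x4 "x1 + p" u] that uper[of x1] fl by linarith
  qed
  obtain h where h: "9 / 10 * l \<le> u h"
  proof -
    have "mu (A - ?NH) > 0"
      using mu_Diff[of A ?NH] mu_mono[of "A \<inter> ?NH" ?NH] NH big by simp
    then obtain x where "x \<in> A - ?NH" using mu_pos_nonempty by blast
    then have "9 / 10 * l \<le> u x" by auto
    then show ?thesis by (rule that)
  qed
  obtain w where w: "u w \<le> 1 / 10 * l"
  proof -
    have "mu (- A - ?NL) > 0"
      using mu_Diff[of "- A" ?NL] mu_mono[of "- A \<inter> ?NL" ?NL] NL big by (simp add: mu_Compl)
    then obtain x where "x \<in> - A - ?NL" using mu_pos_nonempty by blast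
    then have "u x \<le> 1 / 10 * l" by auto
    then show ?thesis by (rule that)
  qed
  \<comment> \<open>Seen from a high point \<open>h\<close>, the low points of one period range from
    \<open>a\<close> to \<open>b\<close>. The arc that starts after \<open>b\<close>, passes
    \<open>h\<close> and stops before \<open>a\<close> contains no low point, and by
    \<open>unimodal\<close> there is no high point between \<open>a\<close> and \<open>b\<close>. So
    \<open>A\<close> and this arc differ only within the two exceptional sets.\<close>
  define M where "M = {x \<in> {h<..<h + p}. u x \<le> 1 / 10 * l}"
  have lpos: "0 < real_of_int l" using l by simp
  have "M \<noteq> {}"
  proof -
    obtain w' where w': "[w' = w] (mod p)" "h \<le> w'" "w' < h + p" using arc_rep by blast
    have "u w' \<le> 1 / 10 * l" using ucong[OF w'(1)] w by simp
    moreover from this have "w' \<noteq> h" using h lpos by auto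
    ultimately show ?thesis using w' by (auto simp: M_def)
  qed
  moreover have fin: "finite M" by (rule finite_subset[of _ "{h<..<h + p}"]) (auto simp: M_def)
  ultimately have mM: "Min M \<in> M" "Max M \<in> M" by simp_all
  define a where "a = Min M"
  define b where "b = Max M"
  have ab: "h < a" "a \<le> b" "b < h + p" "u a \<le> 1 / 10 * l" "u b \<le> 1 / 10 * l"
    using mM fin by (auto simp: M_def a_def b_def)
  have notlow: "1 / 10 * l < u x" if "h < x" "x < h + p" "x < a \<or> b < x" for x
  proof (rule ccontr)
    assume "\<not> ?thesis"
    then have "x \<in> M" using that by (simp add: M_def)
    then have "a \<le> x" "x \<le> b" using fin by (auto simp: a_def b_def)
    then show False using that by simp
  qed
  define I where "I = cyc_arc (b + 1 - p) a"
  have "A - I \<subseteq> ?NH"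
  proof
    fix x assume x: "x \<in> A - I"
    obtain x' where x': "[x' = x] (mod p)" "a \<le> x'" "x' < a + p" using arc_rep by blast
    have "x' \<notin> I" using x periodic_cong_mem[OF periodic_arc x'(1)] by (simp add: I_def)
    have "x' \<le> b"
    proof (rule ccontr)
      assume "\<not> ?thesis"
      then have "x' - p \<in> I" using x' unfolding I_def by (intro arcI) auto
      moreover have "x' - p + p \<in> I \<longleftrightarrow> x' - p \<in> I" unfolding I_def by (rule periodicD[OF periodic_arc])
      ultimately show False using \<open>x' \<notin> I\<close> by simp
    qed
    have "u x' < 9 / 10 * l"
    proof (rule ccontr)
      assume c: "\<not> ?thesis"
      then have "x' \<noteq> a" "x' \<noteq> b" using ab lpos by auto
      then show False using unimodal[of h a x' b] c ab h x' \<open>x' \<le> b\<close> by simp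
    qed
    then show "x \<in> ?NH" using x ucong[OF x'(1)] by simp
  qed
  moreover have "I - A \<subseteq> ?NL"
  proof
    fix x assume x: "x \<in> I - A"
    then obtain j where j: "b + 1 - p \<le> x + j * p" "x + j * p < a" by (auto simp: I_def cyc_arc_def)
    define x' where "x' = x + j * p"
    have ux: "u x' = u x" unfolding x'_def using periodic_mult_fun[of u] uper by blast
    consider "h < x'" | "x' = h" | "x' < h" by linarith
    then have "1 / 10 * l < u x'"
    proof cases
      case 1
      then show ?thesis using notlow[of x'] j ab by (simp add: x'_def)
    next
      case 2
      then show ?thesis using h lpos by simp
    next
      case 3
      then show ?thesis using notlow[of "x' + p"] j ab uper[of x'] by (simp add: x'_def)
    qed
    then show "x \<in> ?NL" using x ux by simp
  qed
  ultimately have "mu (A - I) \<le> 10 * K" "mu (I - A) \<le> 10 * K"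
    using mu_mono[of "A - I" ?NH] mu_mono[of "I - A" ?NL] NH NL by linarith+
  moreover have "b + 1 - p < a" "a < b + 1 - p + p" using ab by linarith+
  ultimately show ?thesis unfolding I_def by blast
qed

end

subsection \<open>Sets whose sums avoid an arc\<close>

context prime_modulus begin

lemma window_count_card:
  "window_count B g w = real (card (B \<inter> {w..<w + g}))"
proof -
  have "window_count B g w = (\<Sum>x\<in>{w..<w + g}. of_bool (x \<in> B))"
    unfolding window_count_def
    by (rule sum.reindex_bij_witness[of _ "\<lambda>x. x - w" "\<lambda>i. w + i"]) auto
  then show ?thesis by (simp add: Int_commute Int_def)
qed

lemma mu_window:
  assumes "periodic B"
  shows "mu B = real (card (B \<inter> {w..<w + p}))"
proof -
  have "mu B = (\<Sum>x\<in>{w..<w + p}. of_bool (x \<in> B))"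
    unfolding mu_def by (rule sum_period_window[symmetric]) (simp add: periodicD[OF assms])
  then show ?thesis by (simp add: Int_commute Int_def)
qed

lemma arc_window_iff:
  assumes "w \<le> z" "z < w + p" "g \<le> p"
  shows "z \<in> cyc_arc w (w + g) \<longleftrightarrow> z < w + g"
proof
  assume "z \<in> cyc_arc w (w + g)"
  then obtain j where j: "w \<le> z + j * p" "z + j * p < w + g" by (auto simp: cyc_arc_def)
  have "j * p < 1 * p" using j assms by linarith
  then have "j < 1" using p_pos mult_less_cancel_right_pos by blast
  moreover have "(- 1) * p < j * p" using j assms by linarith
  then have "- 1 < j" using p_pos mult_less_cancel_right_pos by blast
  ultimately have "j = 0" by simp
  then show "z < w + g" using j by simp
qed (use assms arcI in blast)

lemma mu_Int_arc:
  assumes "periodic B" "g \<le> p"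
  shows "mu (B \<inter> cyc_arc w (w + g)) = window_count B g w"
proof -
  have "B \<inter> cyc_arc w (w + g) \<inter> {w..<w + p} = B \<inter> {w..<w + g}"
    using arc_window_iff[of w _ g] assms(2) by auto
  then show ?thesis
    using mu_window[OF periodic_Int[OF assms(1) periodic_arc], of w "w + g" w]
    by (simp add: window_count_card)
qed

lemma arc_shift_iff: "a + b \<in> cyc_arc c d \<longleftrightarrow> b \<in> cyc_arc (c - a) (d - a)"
proof -
  have "c \<le> a + b + j * p \<and> a + b + j * p < d \<longleftrightarrow> c - a \<le> b + j * p \<and> b + j * p < d - a" for j
    by linarith
  then show ?thesis by (simp add: cyc_arc_def)
qed

text \<open>The union of the sparse length-\<open>g\<close> windows meets each block of length \<open>g\<close> in the
  traces of at most two of these windows.\<close>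

lemma sparse_windows_block:
  assumes X: "\<And>x. x \<in> X \<Longrightarrow> window_count B g x \<le> s" and s: "0 \<le> s"
  shows "real (card (B \<inter> {y. \<exists>x\<in>X. x \<le> y \<and> y < x + g} \<inter> {q..<q + g})) \<le> 2 * s"
proof -
  let ?R = "{y. \<exists>x\<in>X. x \<le> y \<and> y < x + g}"
  define X1 where "X1 = X \<inter> {q - g<..q}"
  define X2 where "X2 = X \<inter> {q<..<q + g}"
  define W where "W x = B \<inter> {x..<x + g}" for x
  have finX: "finite X1" "finite X2" by (simp_all add: X1_def X2_def)
  have W: "real (card (W x)) \<le> s" if "x \<in> X" for x
    using X[OF that] by (simp add: W_def window_count_card)
  \<comment> \<open>Of the windows that start at or before \<open>q\<close> the last one reaches
    furthest into the block; of those that start later the first one covers most of it.\<close>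
  define W1 where "W1 = (if X1 = {} then {} else W (Max X1))"
  define W2 where "W2 = (if X2 = {} then {} else W (Min X2))"
  have c1: "real (card W1) \<le> s"
    using W[of "Max X1"] Max_in[OF finX(1)] s by (auto simp: W1_def X1_def)
  have c2: "real (card W2) \<le> s"
    using W[of "Min X2"] Min_in[OF finX(2)] s by (auto simp: W2_def X2_def)
  have "B \<inter> ?R \<inter> {q..<q + g} \<subseteq> W1 \<union> W2"
  proof
    fix y assume y: "y \<in> B \<inter> ?R \<inter> {q..<q + g}"
    then obtain x where x: "x \<in> X" "x \<le> y" "y < x + g" by auto
    show "y \<in> W1 \<union> W2"
    proof (cases "x \<le> q")
      case True
      then have "x \<in> X1" using x y by (auto simp: X1_def)
      then have "X1 \<noteq> {}" "x \<le> Max X1" using finX by auto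
      moreover have "z \<le> q" if "z \<in> X1" for z using that by (simp add: X1_def)
      then have "Max X1 \<le> q" using Max_in[OF finX(1) \<open>X1 \<noteq> {}\<close>] by blast
      ultimately have "x \<le> Max X1" "Max X1 \<le> q" "X1 \<noteq> {}" by auto
      then show ?thesis using x y by (auto simp: W1_def W_def)
    next
      case False
      then have "x \<in> X2" using x y by (auto simp: X2_def)
      then have "X2 \<noteq> {}" "Min X2 \<le> x" using finX by auto
      moreover have "q < z" if "z \<in> X2" for z using that by (simp add: X2_def)
      then have "q < Min X2" using Min_in[OF finX(2) \<open>X2 \<noteq> {}\<close>] by blast
      ultimately have "Min X2 \<le> x" "q < Min X2" "X2 \<noteq> {}" by auto
      then show ?thesis using x y by (auto simp: W2_def W_def)
    qed
  qed
  then have "card (B \<inter> ?R \<inter> {q..<q + g}) \<le> card (W1 \<union> W2)"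
    by (intro card_mono) (auto simp: W1_def W2_def W_def)
  also have "\<dots> \<le> card W1 + card W2" by (rule card_Un_le)
  finally show ?thesis using c1 c2 by linarith
qed

text \<open>At most \<open>p / g + 1\<close> blocks of length \<open>g\<close> cover a
  period.\<close>

lemma sparse_windows_total:
  assumes X: "\<And>x. x \<in> X \<Longrightarrow> window_count B g x \<le> s" and s: "0 \<le> s" and g: "0 < g"
  shows "mu (B \<inter> {y. \<exists>x\<in>X. x \<le> y \<and> y < x + g}) \<le> 2 * (p / g + 1) * s"
proof -
  let ?T = "B \<inter> {y. \<exists>x\<in>X. x \<le> y \<and> y < x + g}"
  have "?T \<inter> {0..<p} \<subseteq> (\<Union>j\<in>{0..p div g}. ?T \<inter> {j * g..<j * g + g})"
  proof
    fix y assume y: "y \<in> ?T \<inter> {0..<p}"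
    have "y = y div g * g + y mod g" by simp
    then have "y div g * g \<le> y" "y < y div g * g + g"
      using pos_mod_bound[OF g, of y] pos_mod_sign[OF g, of y] by linarith+
    moreover have "y div g \<in> {0..p div g}"
      using y g by (auto intro: zdiv_mono1 simp: pos_imp_zdiv_nonneg_iff)
    ultimately show "y \<in> (\<Union>j\<in>{0..p div g}. ?T \<inter> {j * g..<j * g + g})" using y by auto
  qed
  then have "card (?T \<inter> {0..<p}) \<le> card (\<Union>j\<in>{0..p div g}. ?T \<inter> {j * g..<j * g + g})"
    by (intro card_mono) auto
  also have "\<dots> \<le> (\<Sum>j\<in>{0..p div g}. card (?T \<inter> {j * g..<j * g + g}))"
    by (intro card_UN_le) simp
  finally have "real (card (?T \<inter> {0..<p})) \<le> real (\<Sum>j\<in>{0..p div g}. card (?T \<inter> {j * g..<j * g + g}))"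
    by (rule of_nat_mono)
  then have "mu ?T \<le> (\<Sum>j\<in>{0..p div g}. real (card (?T \<inter> {j * g..<j * g + g})))"
    unfolding mu_card of_nat_sum .
  also have "\<dots> \<le> (\<Sum>j\<in>{0..p div g}. 2 * s)"
    by (intro sum_mono sparse_windows_block X s)
  also have "\<dots> = (real_of_int (p div g) + 1) * (2 * s)"
    using g by (simp add: pos_imp_zdiv_nonneg_iff)
  also have "\<dots> \<le> (p / g + 1) * (2 * s)"
    using s g real_of_int_div4[of p g] by (intro mult_right_mono) auto
  finally show ?thesis by (simp add: mult_ac)
qed

text \<open>For most \<open>a\<close> in \<open>A\<close> the arc of length \<open>g\<close>
  starting at \<open>c - a\<close> meets \<open>B\<close> in few points, so the set \<open>X\<close>
  of starts of sparse windows is almost as large as \<open>A\<close>. \<open>B\<close> has few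
  points in the union \<open>R\<close> of these windows, and \<open>R\<close> has
  \<open>g - 1\<close> points more than \<open>X\<close> for each gap it leaves. By
  \<open>size\<close> there is room for one gap only, so the complement of \<open>R\<close> is an
  arc, and \<open>B\<close> nearly fills it.\<close>

lemma near_arc_of_sum_avoiding:
  assumes perA: "periodic A" and perB: "periodic B" and g: "0 < g" "g \<le> p" and s: "0 < s" "0 \<le> s'"
    and pairs: "(\<Sum>a\<in>{0..<p}. of_bool (a \<in> A) * mu {b. b \<in> B \<and> a + b \<in> cyc_arc c (c + g)}) \<le> s\<^sup>2"
    and size: "p \<le> mu A + mu B + g + s'"
    and Kdef: "K = 2 * (p / g + 1)" and gap: "(K + 1) * s + s' + 2 < g"
    and Abig: "s < mu A" and Bbig: "K * s < mu B"
  shows "\<exists>x y. x < y \<and> y \<le> x + p \<and> mu (B - cyc_arc x y) \<le> K * s \<and>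
    mu (cyc_arc x y - B) \<le> (K + 1) * s + s' + 1"
proof -
  define X where "X = {w. window_count B g w \<le> s}"
  define R where "R = {y. \<exists>x\<in>X. x \<le> y \<and> y < x + g}"
  have perX: "periodic X" by (simp add: X_def periodic_def window_count_periodic[OF perB])
  have perR: "periodic R"
    unfolding periodic_def
  proof
    fix y
    have "(\<exists>x\<in>X. x \<le> y + p \<and> y + p < x + g) \<longleftrightarrow> (\<exists>x\<in>X. x \<le> y \<and> y < x + g)"
    proof
      assume "\<exists>x\<in>X. x \<le> y + p \<and> y + p < x + g"
      then obtain x where x: "x \<in> X" "x \<le> y + p" "y + p < x + g" by auto
      have "x - p \<in> X" using periodicD[OF perX, of "x - p"] x by simp
      then show "\<exists>x\<in>X. x \<le> y \<and> y < x + g" using x by (intro bexI[of _ "x - p"]) auto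
    next
      assume "\<exists>x\<in>X. x \<le> y \<and> y < x + g"
      then obtain x where x: "x \<in> X" "x \<le> y" "y < x + g" by auto
      have "x + p \<in> X" using periodicD[OF perX, of x] x by simp
      then show "\<exists>x\<in>X. x \<le> y + p \<and> y + p < x + g" using x by (intro bexI[of _ "x + p"]) auto
    qed
    then show "y + p \<in> R \<longleftrightarrow> y \<in> R" by (simp add: R_def)
  qed
  have muX: "mu A - s \<le> mu X"
  proof -
    let ?F = "A - {a. c - a \<in> X}"
    have "mu ?F * s = (\<Sum>a\<in>{0..<p}. of_bool (a \<in> ?F) * s)" by (simp only: mu_def sum_distrib_right)
    also have "\<dots> \<le> (\<Sum>a\<in>{0..<p}. of_bool (a \<in> A) * mu {b. b \<in> B \<and> a + b \<in> cyc_arc c (c + g)})"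
    proof (intro sum_mono)
      fix a
      have "{b. b \<in> B \<and> a + b \<in> cyc_arc c (c + g)} = B \<inter> cyc_arc (c - a) (c - a + g)"
        by (simp add: arc_shift_iff[of a] Int_def diff_add_eq)
      then have "mu {b. b \<in> B \<and> a + b \<in> cyc_arc c (c + g)} = window_count B g (c - a)"
        using mu_Int_arc[OF perB g(2)] by simp
      then show "of_bool (a \<in> ?F) * s \<le> of_bool (a \<in> A) * mu {b. b \<in> B \<and> a + b \<in> cyc_arc c (c + g)}"
        using mu_nonneg[of "{b. b \<in> B \<and> a + b \<in> cyc_arc c (c + g)}"] by (auto simp: X_def)
    qed
    also note pairs
    finally have "mu ?F \<le> s" using s by (simp add: power2_eq_square)
    moreover have "mu (A \<inter> {a. c - a \<in> X}) \<le> mu X"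
      using mu_mono[of "A \<inter> {a. c - a \<in> X}" "{a. c - a \<in> X}"] mu_reflect[OF perX, of c] by simp
    ultimately show ?thesis using mu_Diff[of A "{a. c - a \<in> X}"] by simp
  qed
  have BR: "mu (B \<inter> R) \<le> K * s"
    unfolding R_def Kdef by (rule sparse_windows_total) (use s g in \<open>auto simp: X_def\<close>)
  have BnR: "mu (B - R) = mu B - mu (B \<inter> R)" by (rule mu_Diff)
  then obtain y where y: "y \<in> B" "y \<notin> R" using mu_pos_nonempty[of "B - R"] BR Bbig by auto
  obtain x0 where x0: "x0 \<in> X" using mu_pos_nonempty[of X] muX Abig by auto
  have clear: "x \<notin> X" if "z - g < x" "x \<le> z" "z \<notin> R" for x z
    using that by (auto simp: R_def)
  have Xrep: "\<exists>x\<in>X. a \<le> x \<and> x < a + p" for a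
  proof -
    obtain x where "[x = x0] (mod p)" "a \<le> x" "x < a + p" using arc_rep by blast
    then show ?thesis using periodic_cong_mem[OF perX] x0 by blast
  qed
  \<comment> \<open>Around the point \<open>y\<close> of \<open>B\<close> outside \<open>R\<close>:
    \<open>x1\<close> will be the last start of a sparse window before \<open>y\<close> and
    \<open>x2\<close> the first one after it, so that the gap of \<open>R\<close> at
    \<open>y\<close> begins at \<open>x1 + g\<close> and ends before \<open>x2\<close>.\<close>
  define X1 where "X1 = X \<inter> {y - p<..y}"
  define X2 where "X2 = X \<inter> {y<..y + p}"
  have ne: "X1 \<noteq> {}" "X2 \<noteq> {}"
  proof -
    obtain v where v: "v \<in> X" "y - p + 1 \<le> v" "v < y - p + 1 + p" using Xrep by blast
    obtain w where w: "w \<in> X" "y + 1 \<le> w" "w < y + 1 + p" using Xrep by blast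
    have "v \<in> X1" "w \<in> X2" using v w by (auto simp: X1_def X2_def)
    then show "X1 \<noteq> {}" "X2 \<noteq> {}" by auto
  qed
  have fin: "finite X1" "finite X2" by (simp_all add: X1_def X2_def)
  define x1 where "x1 = Max X1"
  define x2 where "x2 = Min X2"
  have x1: "x1 \<in> X" "y - p < x1" "x1 \<le> y" using Max_in[OF fin(1) ne(1)] by (auto simp: x1_def X1_def)
  have x2: "x2 \<in> X" "y < x2" using Min_in[OF fin(2) ne(2)] by (auto simp: x2_def X2_def)
  have x1g: "x1 + g \<le> y" using clear[of y x1] x1 y by force
  have x1p: "x1 + p \<in> X" using periodicD[OF perX] x1 by simp
  have "x1 + p \<in> X2" using x1p x1 by (simp add: X2_def)
  then have x21: "x2 \<le> x1 + p" using fin by (simp add: x2_def)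
  have between: "x \<notin> X" if "x1 < x" "x < x2" for x
  proof
    assume x: "x \<in> X"
    show False
    proof (cases "x \<le> y")
      case True
      then have "x \<in> X1" using x x1 that by (simp add: X1_def)
      then show False using that fin by (auto simp: x1_def dest: Max_ge)
    next
      case False
      then have "x \<in> X2" using x x21 x1 that by (simp add: X2_def)
      then show False using that fin by (auto simp: x2_def dest: Min_le)
    qed
  qed
  define Y where "Y = X \<inter> {x2..x1 + p}"
  have muY: "real (card Y) = mu X"
  proof -
    have "X \<inter> {x2..<x2 + p} = Y"
    proof
      show "X \<inter> {x2..<x2 + p} \<subseteq> Y"
      proof
        fix x assume x: "x \<in> X \<inter> {x2..<x2 + p}"
        have "x - p \<in> X" using periodicD[OF perX, of "x - p"] x by simp
        then have "\<not> x1 < x - p" using between[of "x - p"] x by auto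
        then show "x \<in> Y" using x by (simp add: Y_def)
      qed
      show "Y \<subseteq> X \<inter> {x2..<x2 + p}" using x1 x2 by (auto simp: Y_def)
    qed
    then show ?thesis using mu_window[OF perX, of x2] by simp
  qed
  have finY: "finite Y" by (simp add: Y_def)
  have YR: "Y \<subseteq> R"
  proof
    fix z assume "z \<in> Y"
    then have "z \<in> X" "z \<le> z \<and> z < z + g" using g by (auto simp: Y_def)
    then show "z \<in> R" unfolding R_def by blast
  qed
  \<comment> \<open>The window at \<open>x\<close> without its start. At the edge of a gap these
    \<open>g - 1\<close> points belong to \<open>R\<close> but not to \<open>X\<close>.\<close>
  define G where "G x = {x + 1..x + g - 1}" for x :: int
  have cG: "real (card (G x)) = g - 1" for x using g by (simp add: G_def)
  have GR: "G x \<subseteq> R" if "x \<in> X" for x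
  proof
    fix z assume "z \<in> G x"
    then have "x \<le> z \<and> z < x + g" by (auto simp: G_def)
    then show "z \<in> R" using that unfolding R_def by blast
  qed
  have YG: "Y \<inter> G (x1 + p) = {}" by (auto simp: Y_def G_def)
  have Grange: "G (x1 + p) \<subseteq> {x2..<x2 + p}" using x21 x1g x2 by (auto simp: G_def)
  have Yrange: "Y \<subseteq> {x2..<x2 + p}" using x1 x2 by (auto simp: Y_def)
  have R1: "mu X + g - 1 \<le> mu R"
  proof -
    have "real (card (Y \<union> G (x1 + p))) \<le> mu R"
      by (rule card_interval_le_mu[OF perR]) (use YR GR[OF x1p] Grange Yrange in auto)
    moreover have "card (Y \<union> G (x1 + p)) = card Y + card (G (x1 + p))"
      by (rule card_Un_disjoint[OF finY _ YG]) (simp add: G_def)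
    ultimately show ?thesis using muY cG[of "x1 + p"] by linarith
  qed
  have RB: "mu R \<le> p - mu B + K * s"
  proof -
    have "mu (B - R) \<le> mu (- R)" by (rule mu_mono) auto
    then show ?thesis using BnR BR by (simp add: mu_Compl)
  qed
  define T where "T = cyc_arc (x1 + g) x2"
  have "- R \<subseteq> T"
  proof
    fix z assume z: "z \<in> - R"
    obtain z' where z': "[z' = z] (mod p)" "x1 + g \<le> z'" "z' < x1 + g + p" using arc_rep by blast
    have zR: "z' \<notin> R" using z periodic_cong_mem[OF perR z'(1)] by simp
    show "z \<in> T"
    proof (cases "z' < x2")
      case True
      then have "z' \<in> T" unfolding T_def using z' by (intro arcI)
      then show ?thesis using periodic_cong_mem[OF periodic_arc z'(1)] by (simp add: T_def)
    next
      case False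
      have "\<not> x1 + p \<le> z'" using clear[of z' "x1 + p"] zR x1p z' by auto
      \<comment> \<open>A point \<open>z'\<close> outside \<open>R\<close> beyond \<open>x2\<close>
        would lie in a second gap: the last start \<open>x3\<close> before \<open>z'\<close> is also
        followed by \<open>g - 1\<close> points outside \<open>X\<close>. Then \<open>mu R\<close>
        would be at least \<open>mu X + 2 * (g - 1)\<close>, against \<open>RB\<close>,
        \<open>size\<close> and \<open>gap\<close>.\<close>
      define X3 where "X3 = X \<inter> {x2..z'}"
      have fin3: "finite X3" by (simp add: X3_def)
      have ne3: "X3 \<noteq> {}" using x2 False by (auto simp: X3_def)
      define x3 where "x3 = Max X3"
      have x3: "x3 \<in> X" "x2 \<le> x3" "x3 \<le> z'" using Max_in[OF fin3 ne3] by (auto simp: x3_def X3_def)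
      have x3g: "x3 + g \<le> z'" using clear[of z' x3] x3 zR by force
      have YG3: "Y \<inter> G x3 = {}"
      proof (rule ccontr)
        assume "\<not> ?thesis"
        then obtain x where "x \<in> Y" "x \<in> G x3" by blast
        then have x: "x \<in> X" "x3 < x" "x < x3 + g" "x2 \<le> x" by (simp_all add: Y_def G_def)
        then have "x \<in> X3" using x3g by (simp add: X3_def)
        then have "x \<le> x3" using fin3 by (simp add: x3_def)
        then show False using x by simp
      qed
      have GG: "G x3 \<inter> G (x1 + p) = {}" using x3g \<open>\<not> x1 + p \<le> z'\<close> by (auto simp: G_def)
      have G3range: "G x3 \<subseteq> {x2..<x2 + p}"
        using x3 x3g \<open>\<not> x1 + p \<le> z'\<close> x1 x2 by (auto simp: G_def)
      have "real (card (Y \<union> G x3 \<union> G (x1 + p))) \<le> mu R"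
      proof (rule card_interval_le_mu[OF perR])
        show "Y \<union> G x3 \<union> G (x1 + p) \<subseteq> R" using YR GR[OF x1p] GR[OF x3(1)] by blast
        show "Y \<union> G x3 \<union> G (x1 + p) \<subseteq> {x2..<x2 + p}" using Yrange Grange G3range by blast
      qed
      moreover have finG: "finite (G x)" for x by (simp add: G_def)
      have "card (Y \<union> G x3 \<union> G (x1 + p)) = card Y + card (G x3) + card (G (x1 + p))"
      proof -
        have "card (Y \<union> G x3 \<union> G (x1 + p)) = card (Y \<union> G x3) + card (G (x1 + p))"
          by (rule card_Un_disjoint) (use finY finG YG GG in blast)+
        moreover have "card (Y \<union> G x3) = card Y + card (G x3)"
          by (rule card_Un_disjoint) (use finY finG YG3 in blast)+
        ultimately show ?thesis by simp
      qed
      ultimately have "real (card Y) + (g - 1) + (g - 1) \<le> mu R"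
        using cG[of x3] cG[of "x1 + p"] by linarith
      moreover have "(K + 1) * s = K * s + s" by (simp add: distrib_right)
      ultimately have False using muY muX RB size gap by linarith
      then show ?thesis ..
    qed
  qed
  moreover have "T \<subseteq> - R"
  proof
    fix z assume "z \<in> T"
    then obtain j where j: "x1 + g \<le> z + j * p" "z + j * p < x2" by (auto simp: T_def cyc_arc_def)
    have "z + j * p \<notin> R"
    proof
      assume "z + j * p \<in> R"
      then obtain x where "x \<in> X" "x \<le> z + j * p" "z + j * p < x + g" by (auto simp: R_def)
      then show False using between[of x] j by auto
    qed
    then show "z \<in> - R" using periodic_mult[OF perR] by simp
  qed
  ultimately have T: "T = - R" by auto
  have "mu (B - T) \<le> K * s"
  proof -
    have "B - T = B \<inter> R" using T by auto
    then show ?thesis using BR by simp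
  qed
  moreover have "mu (T - B) \<le> (K + 1) * s + s' + 1"
  proof -
    have "T \<inter> B = B - R" using T by auto
    then have "mu (T - B) = (p - mu R) - (mu B - mu (B \<inter> R))"
      using mu_Diff[of T B] mu_Compl[of R] T BnR by simp
    moreover have "(K + 1) * s = K * s + s" by (simp add: distrib_right)
    ultimately show ?thesis using R1 muX size BR by linarith
  qed
  ultimately show ?thesis using x1g x2 x21 g unfolding T_def
    by (intro exI[of _ "x1 + g"] exI[of _ x2]) auto
qed

end

subsection \<open>Pairs with sum outside a given set\<close>

context prime_modulus begin

definition bad_pairs :: "int set \<Rightarrow> int set \<Rightarrow> int set \<Rightarrow> real" where
  "bad_pairs S A B = (\<Sum>a\<in>{0..<p}. of_bool (a \<in> A) * mu {b. b \<in> B \<and> a + b \<notin> S})"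

lemma bad_pairs_double:
  "bad_pairs S A B = (\<Sum>a\<in>{0..<p}. \<Sum>b\<in>{0..<p}. of_bool (a \<in> A \<and> b \<in> B \<and> a + b \<notin> S))"
  by (simp only: bad_pairs_def mu_def mem_Collect_eq sum_distrib_left of_bool_conj)

lemma bad_pairs_commute: "bad_pairs S A B = bad_pairs S B A"
proof -
  have "bad_pairs S A B = (\<Sum>b\<in>{0..<p}. \<Sum>a\<in>{0..<p}. of_bool (a \<in> A \<and> b \<in> B \<and> a + b \<notin> S))"
    unfolding bad_pairs_double by (rule sum.swap)
  also have "\<dots> = bad_pairs S B A"
    unfolding bad_pairs_double by (intro sum.cong refl) (auto simp: add.commute)
  finally show ?thesis .
qed

text \<open>A new bad pair \<open>(u, v)\<close> has \<open>u\<close> in \<open>B + e\<close> but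
  not in \<open>A\<close>. It is sent to the pair \<open>(v + e, u - e)\<close> of
  \<open>A \<times> B\<close>, which has the same sum. The second entry of the image has been
  removed from \<open>B\<close>, because \<open>u\<close> is not in \<open>A\<close>, so the image
  is not one of the surviving old pairs.\<close>

lemma bad_pairs_transform:
  assumes perA: "periodic A" and perB: "periodic B" and perS: "periodic S"
  shows "bad_pairs S (A \<union> {x. x - e \<in> B}) (B \<inter> {x. x + e \<in> A}) \<le> bad_pairs S A B"
proof -
  define k where "k u v = (of_bool (u \<notin> A \<and> u - e \<in> B \<and> v \<in> B \<and> v + e \<in> A \<and> u + v \<notin> S) :: real)" for u v
  have shift: "x + p - y \<in> C \<longleftrightarrow> x - y \<in> C" "x + p + y \<in> C \<longleftrightarrow> x + y \<in> C"
    "y + (x + p) \<in> C \<longleftrightarrow> y + x \<in> C" if "periodic C" for x y C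
    using periodicD[OF that, of "x - y"] periodicD[OF that, of "x + y"] periodicD[OF that, of "y + x"]
    by (simp_all add: algebra_simps)
  have k1: "k (u + p) v = k u v" for u v
    using shift[OF perS] shift[OF perB] periodicD[OF perA] by (simp add: k_def)
  have k2: "k u (v + p) = k u v" for u v
    using shift[OF perS] shift[OF perA] periodicD[OF perB] by (simp add: k_def)
  have "bad_pairs S (A \<union> {x. x - e \<in> B}) (B \<inter> {x. x + e \<in> A}) =
      (\<Sum>u\<in>{0..<p}. \<Sum>v\<in>{0..<p}. of_bool (u \<in> A \<and> v \<in> B \<and> v + e \<in> A \<and> u + v \<notin> S) + k u v)"
    unfolding bad_pairs_double by (intro sum.cong refl) (auto simp: k_def)
  also have "\<dots> = (\<Sum>u\<in>{0..<p}. \<Sum>v\<in>{0..<p}. of_bool (u \<in> A \<and> v \<in> B \<and> v + e \<in> A \<and> u + v \<notin> S)) +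
      (\<Sum>u\<in>{0..<p}. \<Sum>v\<in>{0..<p}. k u v)"
    by (simp only: sum.distrib)
  also have "(\<Sum>u\<in>{0..<p}. \<Sum>v\<in>{0..<p}. k u v) = (\<Sum>u\<in>{0..<p}. \<Sum>v\<in>{0..<p}. k (u + e) v)"
    by (rule sum_shift[symmetric]) (simp only: k1)
  also have "\<dots> = (\<Sum>u\<in>{0..<p}. \<Sum>v\<in>{0..<p}. k (u + e) (v + - e))"
    by (intro sum.cong refl sum_shift[symmetric]) (rule k2)
  also have "\<dots> = (\<Sum>v\<in>{0..<p}. \<Sum>u\<in>{0..<p}. k (u + e) (v + - e))" by (rule sum.swap)
  also have "(\<Sum>u\<in>{0..<p}. \<Sum>v\<in>{0..<p}. of_bool (u \<in> A \<and> v \<in> B \<and> v + e \<in> A \<and> u + v \<notin> S)) + \<dots> =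
      (\<Sum>a\<in>{0..<p}. \<Sum>b\<in>{0..<p}. of_bool (a \<in> A \<and> b \<in> B \<and> b + e \<in> A \<and> a + b \<notin> S) + k (b + e) (a + - e))"
    by (simp only: sum.distrib)
  also have "\<dots> \<le> bad_pairs S A B"
    unfolding bad_pairs_double by (intro sum_mono) (auto simp: k_def add.commute)
  finally show ?thesis .
qed

lemma bad_pairs_dilate:
  assumes perA: "periodic A" and perB: "periodic B" and perS: "periodic S" and k: "coprime k p"
  shows "bad_pairs {x. k * x \<in> S} {x. k * x \<in> A} {x. k * x \<in> B} = bad_pairs S A B"
proof -
  have per: "periodic {b. b \<in> B \<and> a + b \<notin> S}" for a
    using periodic_Diff[OF perB periodic_shift[OF perS, of a]] by (simp add: set_diff_eq add.commute)
  have "mu {b. k * b \<in> B \<and> k * (a + b) \<notin> S} = mu {b. b \<in> B \<and> k * a + b \<notin> S}" for a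
    using mu_affine[OF per k, of 0 "k * a"] by (simp add: distrib_left)
  then have "bad_pairs {x. k * x \<in> S} {x. k * x \<in> A} {x. k * x \<in> B} =
      (\<Sum>a\<in>{0..<p}. of_bool (k * a + 0 \<in> A) * mu {b. b \<in> B \<and> (k * a + 0) + b \<notin> S})"
    by (simp add: bad_pairs_def)
  also have "\<dots> = bad_pairs S A B"
    unfolding bad_pairs_def
  proof (rule sum_affine[OF _ k])
    fix a
    have "a + p + b \<in> S \<longleftrightarrow> a + b \<in> S" for b
      using periodicD[OF perS, of "a + b"] by (simp add: algebra_simps)
    then show "of_bool (a + p \<in> A) * mu {b. b \<in> B \<and> a + p + b \<notin> S} = of_bool (a \<in> A) * mu {b. b \<in> B \<and> a + b \<notin> S}"
      using periodicD[OF perA] by simp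
  qed
  finally show ?thesis .
qed

section \<open>Representation counts, energy and popular differences\<close>

definition reps :: "int set \<Rightarrow> int set \<Rightarrow> int \<Rightarrow> real" where
  "reps A B x = mu {a. a \<in> A \<and> x - a \<in> B}"

lemma sum_reps:
  assumes perB: "periodic B" and perZ: "periodic Z"
  shows "(\<Sum>x\<in>{0..<p}. of_bool (x \<in> Z) * reps A B x) =
    (\<Sum>a\<in>{0..<p}. of_bool (a \<in> A) * mu {b. b \<in> B \<and> a + b \<in> Z})"
proof -
  have "(\<Sum>x\<in>{0..<p}. of_bool (x \<in> Z) * reps A B x) =
      (\<Sum>x\<in>{0..<p}. \<Sum>a\<in>{0..<p}. of_bool (x \<in> Z) * (of_bool (a \<in> A) * of_bool (x - a \<in> B)))"
    by (simp only: reps_def mu_def mem_Collect_eq sum_distrib_left of_bool_conj)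
  also have "\<dots> = (\<Sum>a\<in>{0..<p}. \<Sum>x\<in>{0..<p}. of_bool (x \<in> Z) * (of_bool (a \<in> A) * of_bool (x - a \<in> B)))"
    by (rule sum.swap)
  also have "\<dots> = (\<Sum>a\<in>{0..<p}. of_bool (a \<in> A) * mu {x. x - a \<in> B \<and> x \<in> Z})"
    by (simp only: mu_def mem_Collect_eq sum_distrib_left of_bool_conj mult_ac)
  also have "\<dots> = (\<Sum>a\<in>{0..<p}. of_bool (a \<in> A) * mu {b. b \<in> B \<and> a + b \<in> Z})"
  proof (intro sum.cong refl)
    fix a
    have "periodic {x. x - a \<in> B \<and> x \<in> Z}"
      using periodic_Int[OF periodic_shift[OF perB, of "- a"] perZ] by (simp add: Int_def)
    from mu_shift[OF this, of a] have "mu {x. x - a \<in> B \<and> x \<in> Z} = mu {b. b \<in> B \<and> a + b \<in> Z}"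
      by (simp add: add.commute)
    then show "of_bool (a \<in> A) * mu {x. x - a \<in> B \<and> x \<in> Z} = of_bool (a \<in> A) * mu {b. b \<in> B \<and> a + b \<in> Z}"
      by simp
  qed
  finally show ?thesis .
qed

lemma sum_reps_good:
  assumes "periodic B" "periodic S"
  shows "(\<Sum>x\<in>{0..<p}. of_bool (x \<in> S) * reps A B x) = mu A * mu B - bad_pairs S A B"
proof -
  have "mu {b. b \<in> B \<and> a + b \<in> S} = mu B - mu {b. b \<in> B \<and> a + b \<notin> S}" for a
    using mu_Diff[of B "{b. a + b \<notin> S}"] by (simp add: set_diff_eq Int_def)
  then have "(\<Sum>x\<in>{0..<p}. of_bool (x \<in> S) * reps A B x) =
      (\<Sum>a\<in>{0..<p}. of_bool (a \<in> A) * mu B) - bad_pairs S A B"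
    unfolding sum_reps[OF assms] bad_pairs_def
    by (simp only: right_diff_distrib sum_subtractf)
  then show ?thesis by (simp only: mu_def sum_distrib_right)
qed

lemma reps_le:
  assumes "periodic B"
  shows "reps A B x \<le> mu B"
  using mu_mono[of "{a. a \<in> A \<and> x - a \<in> B}" "{a. x - a \<in> B}"] mu_reflect[OF assms, of x]
  by (auto simp: reps_def)

lemma mu_two_shifts:
  assumes "periodic B" "periodic C"
  shows "mu {x. x - a \<in> B \<and> x - a' \<in> C} = mu {z. z \<in> B \<and> z + (a - a') \<in> C}"
proof -
  have "periodic {x. x - a \<in> B \<and> x - a' \<in> C}"
    using periodic_Int[OF periodic_shift[OF assms(1), of "- a"] periodic_shift[OF assms(2), of "- a'"]]
    by (simp add: Int_def)
  from mu_shift[OF this, of a] show ?thesis by (simp add: add_diff_eq)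
qed

text \<open>Both sides count the solutions of \<open>a + b = c + d\<close> modulo \<open>p\<close>;
  on the right \<open>z\<close> is \<open>b\<close>, and \<open>d\<close> is
  \<open>z + (a - c)\<close>.\<close>

lemma sum_reps_product:
  assumes perB: "periodic B" and perD: "periodic D"
  shows "(\<Sum>x\<in>{0..<p}. reps A B x * reps C D x) =
    (\<Sum>a\<in>{0..<p}. \<Sum>c\<in>{0..<p}. of_bool (a \<in> A) * of_bool (c \<in> C) * mu {z. z \<in> B \<and> z + (a - c) \<in> D})"
proof -
  define w :: "int \<Rightarrow> int \<Rightarrow> int \<Rightarrow> real" where
    "w x a c = (of_bool (a \<in> A) * of_bool (x - a \<in> B)) * (of_bool (c \<in> C) * of_bool (x - c \<in> D))" for x a c
  have "(\<Sum>x\<in>{0..<p}. reps A B x * reps C D x) = (\<Sum>x\<in>{0..<p}. \<Sum>a\<in>{0..<p}. \<Sum>c\<in>{0..<p}. w x a c)"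
    by (simp only: w_def reps_def mu_def mem_Collect_eq sum_product of_bool_conj)
  also have "\<dots> = (\<Sum>a\<in>{0..<p}. \<Sum>x\<in>{0..<p}. \<Sum>c\<in>{0..<p}. w x a c)"
    by (rule sum.swap)
  also have "\<dots> = (\<Sum>a\<in>{0..<p}. \<Sum>c\<in>{0..<p}. \<Sum>x\<in>{0..<p}. w x a c)"
    by (intro sum.cong refl sum.swap)
  also have "\<dots> = (\<Sum>a\<in>{0..<p}. \<Sum>c\<in>{0..<p}. of_bool (a \<in> A) * of_bool (c \<in> C) * mu {x. x - a \<in> B \<and> x - c \<in> D})"
    unfolding mu_def sum_distrib_left w_def by (intro sum.cong refl) auto
  finally show ?thesis by (simp only: mu_two_shifts[OF perB perD])
qed

lemma reps_commute:
  assumes "periodic A" "periodic B"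
  shows "reps A B x = reps B A x"
proof -
  have "periodic {a. a \<in> A \<and> x - a \<in> B}"
    using periodic_Int[OF assms(1) periodic_reflect[OF assms(2), of x]] by (simp add: Int_def)
  from mu_reflect[OF this, of x] show ?thesis by (simp add: reps_def conj_commute)
qed

text \<open>Nearly all of the \<open>mu A * mu B\<close> pairs have their sum in \<open>S\<close>,
  which has at most \<open>3 * mu A\<close> elements. Cauchy--Schwarz gives the constant
  \<open>0.99^2 / 3\<close>, a little more than \<open>8 / 25\<close>.\<close>

lemma energy_ge:
  assumes perB: "periodic B" and perS: "periodic S" and B: "mu B \<le> mu A" "0 < mu B"
    and bad: "bad_pairs S A B \<le> (mu B)\<^sup>2 / 100" and S: "mu S \<le> mu A + 2 * mu B"
  shows "8 / 25 * (mu A * (mu B * mu B)) \<le> (\<Sum>x\<in>{0..<p}. (reps A B x)\<^sup>2)"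
proof -
  define Q where "Q = (\<Sum>x\<in>{0..<p}. (reps A B x)\<^sup>2)"
  have "(mu B)\<^sup>2 \<le> mu A * mu B" using B unfolding power2_eq_square by (intro mult_right_mono) auto
  then have "99 / 100 * (mu A * mu B) \<le> mu A * mu B - bad_pairs S A B" using bad by simp
  then have "(99 / 100 * (mu A * mu B))\<^sup>2 \<le> (mu A * mu B - bad_pairs S A B)\<^sup>2"
    by (intro power_mono) auto
  also have "\<dots> = (\<Sum>x\<in>{0..<p}. of_bool (x \<in> S) * reps A B x)\<^sup>2"
    by (simp only: sum_reps_good[OF perB perS])
  also have "\<dots> \<le> (\<Sum>x\<in>{0..<p}. (of_bool (x \<in> S))\<^sup>2) * Q"
    unfolding Q_def by (rule Cauchy_Schwarz_ineq_sum)
  also have "(\<Sum>x\<in>{0..<p}. (of_bool (x \<in> S) :: real)\<^sup>2) = mu S"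
    unfolding mu_def by (intro sum.cong) auto
  also have "mu S * Q \<le> 3 * mu A * Q"
    using S B by (intro mult_right_mono) (auto simp: Q_def intro!: sum_nonneg)
  finally have "mu A * (9801 / 30000 * (mu A * (mu B * mu B))) \<le> mu A * Q"
    by (simp add: power2_eq_square algebra_simps)
  then have "9801 / 30000 * (mu A * (mu B * mu B)) \<le> Q"
    using B by (simp only: mult_le_cancel_left_pos)
  moreover have "0 \<le> mu A * (mu B * mu B)" by simp
  ultimately show ?thesis unfolding Q_def by linarith
qed

definition good_part :: "int set \<Rightarrow> int set \<Rightarrow> int set \<Rightarrow> real \<Rightarrow> int set" where
  "good_part S A B \<tau> = {y. y \<in> B \<and> mu {a. a \<in> A \<and> y + a \<notin> S} \<le> \<tau>}"

lemma periodic_good_part: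
  assumes "periodic S" "periodic B"
  shows "periodic (good_part S A B \<tau>)"
proof -
  have "y + p + a \<in> S \<longleftrightarrow> y + a \<in> S" for y a
    using periodicD[OF assms(1), of "y + a"] by (simp add: algebra_simps)
  then show ?thesis using periodicD[OF assms(2)] by (simp add: periodic_def good_part_def)
qed

lemma mu_good_part:
  assumes \<tau>: "0 < \<tau>"
  shows "mu B - bad_pairs S A B / \<tau> \<le> mu (good_part S A B \<tau>)"
proof -
  have "mu (B - good_part S A B \<tau>) * \<tau> = (\<Sum>y\<in>{0..<p}. of_bool (y \<in> B - good_part S A B \<tau>) * \<tau>)"
    by (simp only: mu_def sum_distrib_right)
  also have "\<dots> \<le> (\<Sum>y\<in>{0..<p}. of_bool (y \<in> B) * mu {a. a \<in> A \<and> y + a \<notin> S})"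
    by (intro sum_mono) (auto simp: good_part_def)
  also have "\<dots> = bad_pairs S A B" unfolding bad_pairs_commute[of S A B] by (simp add: bad_pairs_def)
  finally have "mu (B - good_part S A B \<tau>) \<le> bad_pairs S A B / \<tau>" using \<tau> by (simp add: pos_le_divide_eq)
  moreover have "B \<inter> good_part S A B \<tau> = good_part S A B \<tau>" by (auto simp: good_part_def)
  ultimately show ?thesis using mu_Diff[of B "good_part S A B \<tau>"] by simp
qed

text \<open>Both translates of \<open>A\<close> lie in \<open>S\<close> up to \<tau> exceptions, so
  inside \<open>S\<close> they overlap in at least \<open>2 * (mu A - \<tau>) - mu S\<close>
  elements.\<close>

lemma shift_loss_good_part:
  assumes perA: "periodic A" and perS: "periodic S"
    and y: "y \<in> good_part S A B \<tau>" "y' \<in> good_part S A B \<tau>"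
  shows "shift_loss A (y - y') \<le> mu S - mu A + 2 * \<tau>"
proof -
  define P where "P y = {z. z \<in> S \<and> z - y \<in> A}" for y
  have P: "mu A - \<tau> \<le> mu (P y)" if y: "y \<in> good_part S A B \<tau>" for y
  proof -
    have "periodic (P y)"
      using periodic_Int[OF perS periodic_shift[OF perA, of "- y"]] by (simp add: P_def Int_def)
    from mu_shift[OF this, of y] have "mu (P y) = mu {a. a \<in> A \<and> y + a \<in> S}"
      by (simp add: P_def conj_commute add.commute)
    moreover have "mu {a. a \<in> A \<and> y + a \<in> S} = mu A - mu {a. a \<in> A \<and> y + a \<notin> S}"
      using mu_Diff[of A "{a. y + a \<notin> S}"] by (simp add: set_diff_eq Int_def)
    ultimately show ?thesis using y by (simp add: good_part_def)
  qed
  have "mu (P y \<union> P y') \<le> mu S" by (intro mu_mono) (auto simp: P_def)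
  moreover have "mu (P y \<inter> P y') \<le> mu {z. z - y \<in> A \<and> z - y' \<in> A}" by (intro mu_mono) (auto simp: P_def)
  ultimately show ?thesis
    using P[OF y(1)] P[OF y(2)] mu_Un_Int[of "P y" "P y'"]
    by (simp add: shift_loss_alt mu_two_shifts[OF perA perA])
qed

lemma sum_product_indicator:
  "(\<Sum>a\<in>{0..<p}. \<Sum>b\<in>{0..<p}. of_bool (a \<in> A) * of_bool (b \<in> B) * c) = mu A * mu B * c"
  unfolding mu_def sum_product unfolding sum_distrib_right ..

text \<open>If \<open>12 * mu B\<close> is at most the size of \<open>A\<close> and of its
  complement, the differences of a large part of \<open>B\<close> lie in a level set of
  \<open>shift_loss A\<close> with at most \<open>36 * mu B\<close> elements, and pigeonhole gives a
  popular one. Otherwise \<open>mu A\<close> is at most \<open>12 / \<beta>\<close> times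
  \<open>mu B\<close>, and the energy of \<open>A\<close> and \<open>B\<close> is too large for all
  differences of \<open>B\<close> to be unpopular.\<close>

lemma popular_difference:
  fixes \<beta> :: real
  assumes perA: "periodic A" and perB: "periodic B" and perS: "periodic S"
    and m: "100 \<le> mu B" "mu B \<le> mu A"
    and bad: "bad_pairs S A B \<le> (mu B)\<^sup>2 / 100" and S: "mu S \<le> mu A + 2 * mu B"
    and \<beta>: "0 < \<beta>" "\<beta> \<le> 1" and sz: "mu A \<le> (1 - \<beta>) * p"
  shows "\<exists>d. \<not> p dvd d \<and> \<beta> / 100 * mu B < mu {z. z \<in> B \<and> z + d \<in> B}"
proof (rule ccontr)
  assume "\<not> ?thesis"
  then have small: "mu {z. z \<in> B \<and> z + d \<in> B} \<le> \<beta> / 100 * mu B" if "\<not> p dvd d" for d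
    using that by force
  define m where "m = mu B"
  show False
  proof (cases "12 * m \<le> mu A \<and> 12 * m \<le> p - mu A")
    case True
    define G where "G = good_part S A B (m / 10)"
    have perG: "periodic G" unfolding G_def by (rule periodic_good_part[OF perS perB])
    have "mu B - bad_pairs S A B / (m / 10) \<le> mu G"
      unfolding G_def using m by (intro mu_good_part) (simp add: m_def)
    moreover have "bad_pairs S A B / (m / 10) \<le> m / 10"
      using bad m by (simp add: m_def field_simps power2_eq_square)
    ultimately have G: "9 / 10 * m \<le> mu G" by (simp add: m_def)
    have GB: "G \<subseteq> B" by (auto simp: G_def good_part_def)
    let ?D = "{d. shift_loss A d \<le> 3 * m}"
    have D: "mu ?D \<le> 36 * m"
      using shift_loss_level_card[OF perA, of "3 * m"] True m by (simp add: m_def)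
    have "mu G * mu G = (\<Sum>d\<in>{0..<p}. mu {x. x \<in> G \<and> x + d \<in> G})"
      using sum_correlation[OF perG perG] by simp
    also have "\<dots> \<le> (\<Sum>d\<in>{0..<p}. (if d = 0 then m else 0) + of_bool (d \<in> ?D) * (m / 100))"
    proof (intro sum_mono)
      fix d assume d: "d \<in> {0..<p}"
      show "mu {x. x \<in> G \<and> x + d \<in> G} \<le> (if d = 0 then m else 0) + of_bool (d \<in> ?D) * (m / 100)"
      proof (cases "d = 0")
        case True
        have "mu {x. x \<in> G \<and> x + d \<in> G} \<le> m" using GB unfolding m_def by (intro mu_mono) auto
        then show ?thesis using True m by (simp add: m_def)
      next
        case False
        then have "\<not> p dvd d" using d by (auto dest: zdvd_imp_le)
        have le: "mu {x. x \<in> G \<and> x + d \<in> G} \<le> m / 100"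
        proof -
          have "mu {x. x \<in> G \<and> x + d \<in> G} \<le> mu {x. x \<in> B \<and> x + d \<in> B}"
            using GB by (intro mu_mono) auto
          moreover have "\<beta> / 100 * m \<le> 1 / 100 * m"
            using \<beta> m by (intro mult_right_mono) (auto simp: m_def)
          ultimately show ?thesis using small[OF \<open>\<not> p dvd d\<close>] by (simp add: m_def)
        qed
        show ?thesis
        proof (cases "d \<in> ?D")
          case True
          then show ?thesis using le False by simp
        next
          case out: False
          have "{x. x \<in> G \<and> x + d \<in> G} = {}"
          proof (rule ccontr)
            assume "\<not> ?thesis"
            then obtain x where x: "x \<in> G" "x + d \<in> G" by auto
            have "shift_loss A (x + d - x) \<le> mu S - mu A + 2 * (m / 10)"
              using shift_loss_good_part[OF perA perS] x unfolding G_def by blast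
            then show False using out S m by (simp add: m_def)
          qed
          then have "mu {x. x \<in> G \<and> x + d \<in> G} = mu {}" by (rule arg_cong)
          then show ?thesis using False out by simp
        qed
      qed
    qed
    also have "\<dots> = m + mu ?D * (m / 100)"
      by (simp only: sum.distrib sum_distrib_right[symmetric] mu_def) simp
    also have "\<dots> \<le> m + 36 * m * (m / 100)"
      using D m by (intro add_left_mono mult_right_mono) (auto simp: m_def)
    \<comment> \<open>This contradicts \<open>mu G \<ge> 0.9 * m\<close>: \<open>0.81\<close>
      exceeds \<open>0.36\<close>, and \<open>100 \<le> m\<close> makes the diagonal term
      \<open>m\<close> negligible.\<close>
    finally have "mu G * mu G \<le> m + 36 / 100 * (m * m)" by simp
    moreover have "(9 / 10 * m) * (9 / 10 * m) \<le> mu G * mu G"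
      using G m by (intro mult_mono) (auto simp: m_def)
    ultimately have "45 / 100 * (m * m) \<le> m" by simp
    moreover have "100 * m \<le> m * m" using m by (simp add: m_def)
    ultimately show False using m by (simp add: m_def)
  next
    case False
    have Am: "\<beta> * mu A \<le> 12 * m"
    proof (cases "12 * m \<le> mu A")
      case True
      then have "p - mu A < 12 * m" using False by simp
      moreover have "\<beta> * mu A \<le> \<beta> * p" using \<beta> mu_le_p by (intro mult_left_mono) auto
      ultimately show ?thesis using sz by (simp add: algebra_simps)
    next
      case False
      moreover have "\<beta> * mu A \<le> 1 * mu A" using \<beta> by (intro mult_right_mono) auto
      ultimately show ?thesis by simp
    qed
    define Q where "Q = (\<Sum>x\<in>{0..<p}. (reps A B x)\<^sup>2)"
    have Qlow: "8 / 25 * (mu A * (m * m)) \<le> Q"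
      unfolding Q_def m_def using m by (intro energy_ge[OF perB perS _ _ bad S]) auto
    have "Q \<le> (\<Sum>a\<in>{0..<p}. \<Sum>a'\<in>{0..<p}. (if a' = a then of_bool (a \<in> A) * m else 0) +
        of_bool (a \<in> A) * of_bool (a' \<in> A) * (\<beta> / 100 * m))"
      unfolding Q_def power2_eq_square sum_reps_product[OF perB perB]
    proof (intro sum_mono)
      fix a a' assume a: "a \<in> {0..<p}" "a' \<in> {0..<p}"
      have bm: "0 \<le> \<beta> / 100 * m" using \<beta> by (simp add: m_def)
      show "of_bool (a \<in> A) * of_bool (a' \<in> A) * mu {z. z \<in> B \<and> z + (a - a') \<in> B} \<le>
          (if a' = a then of_bool (a \<in> A) * m else 0) + of_bool (a \<in> A) * of_bool (a' \<in> A) * (\<beta> / 100 * m)"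
      proof (cases "a' = a")
        case True
        then show ?thesis using bm by (simp add: m_def)
      next
        case False
        have "a mod p \<noteq> a' mod p" using False a by simp
        then have "\<not> p dvd (a - a')" by (simp add: mod_eq_dvd_iff)
        then show ?thesis using small[of "a - a'"] False by (simp add: m_def)
      qed
    qed
    also have "\<dots> = mu A * m + mu A * mu A * (\<beta> / 100 * m)"
    proof -
      have "(\<Sum>a\<in>{0..<p}. \<Sum>a'\<in>{0..<p}. (if a' = a then of_bool (a \<in> A) * m else 0)) = (\<Sum>a\<in>{0..<p}. of_bool (a \<in> A) * m)"
        by (intro sum.cong refl) (simp add: sum.delta)
      also have "\<dots> = mu A * m" by (simp only: mu_def sum_distrib_right)
      finally have 1: "(\<Sum>a\<in>{0..<p}. \<Sum>a'\<in>{0..<p}. (if a' = a then of_bool (a \<in> A) * m else 0)) = mu A * m" .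
      have 2: "(\<Sum>a\<in>{0..<p}. \<Sum>a'\<in>{0..<p}. of_bool (a \<in> A) * of_bool (a' \<in> A) * (\<beta> / 100 * m)) = mu A * mu A * (\<beta> / 100 * m)"
        by (rule sum_product_indicator)
      show ?thesis by (simp only: sum.distrib 1 2)
    qed
    also have "\<dots> \<le> mu A * m + mu A * (12 / 100 * (m * m))"
    proof -
      have "mu A * mu A * (\<beta> / 100 * m) = mu A * (m / 100 * (\<beta> * mu A))" by simp
      also have "\<dots> \<le> mu A * (m / 100 * (12 * m))"
        using Am by (intro mult_left_mono) (auto simp: m_def)
      finally show ?thesis by simp
    qed
    finally have Qup: "Q \<le> mu A * (m + 12 / 100 * (m * m))" by (simp add: algebra_simps)
    then have "mu A * (8 / 25 * (m * m)) \<le> mu A * (m + 12 / 100 * (m * m))" using Qlow by simp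
    then have "8 / 25 * (m * m) \<le> m + 12 / 100 * (m * m)"
      using m by (simp only: mult_le_cancel_left_pos)
    moreover have "100 * m \<le> m * m" using m by (simp add: m_def)
    ultimately show False using m by (simp add: m_def)
  qed
qed

text \<open>If no shift were balanced, the shifts \<open>e\<close> with \<open>B + e\<close> almost inside \<open>A\<close> would be invariant under
  a popular difference of \<open>B\<close>, hence exhaust \<open>\<int>/p\<close>.\<close>

lemma balanced_shift:
  fixes \<beta> :: real
  assumes perA: "periodic A" and perB: "periodic B" and perS: "periodic S"
    and m: "100 \<le> mu B" "mu B \<le> mu A"
    and bad: "bad_pairs S A B \<le> (mu B)\<^sup>2 / 100" and S: "mu S \<le> mu A + 2 * mu B"
    and \<beta>: "0 < \<beta>" "\<beta> \<le> 1" and sz: "mu A \<le> (1 - \<beta>) * p"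
  shows "\<exists>e. \<beta> / 200 * mu B \<le> mu (B \<inter> {x. x + e \<in> A}) \<and>
    mu (B \<inter> {x. x + e \<in> A}) \<le> (1 - \<beta> / 200) * mu B"
proof (rule ccontr)
  assume contra: "\<not> ?thesis"
  define \<delta> where "\<delta> = \<beta> / 200"
  define m where "m = mu B"
  define C where "C e = mu {z. z \<in> B \<and> z + e \<in> A}" for e
  have C_eq: "C e = mu (B \<inter> {x. x + e \<in> A})" for e by (simp add: C_def Int_def)
  have gap: "(1 - \<delta>) * m < C e" if "\<delta> * m \<le> C e" for e
    using contra that unfolding C_eq \<delta>_def m_def by (meson not_le)
  obtain d where d: "\<not> p dvd d" "\<beta> / 100 * m < mu {z. z \<in> B \<and> z + d \<in> B}"
    using popular_difference[OF assms] by (auto simp: m_def)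
  define E where "E = {e. \<delta> * m \<le> C e}"
  have Cper: "C (e + p) = C e" for e
  proof -
    have "z + (e + p) \<in> A \<longleftrightarrow> z + e \<in> A" for z
      using periodicD[OF perA, of "z + e"] by (simp add: algebra_simps)
    then show ?thesis by (simp add: C_def)
  qed
  have perE: "periodic E" by (simp add: E_def periodic_def Cper)
  \<comment> \<open>Moving from \<open>e\<close> to \<open>e + d\<close> loses at most
    \<open>shift_loss B (- d)\<close> elements, less than \<open>m - 2 * \<delta> * m\<close> as
    \<open>d\<close> is popular. A count above \<open>(1 - \<delta>) * m\<close> therefore stays
    above \<open>\<delta> * m\<close>.\<close>
  have inv: "e + d \<in> E" if "e \<in> E" for e
  proof -
    have "{z. z \<in> B \<and> z + e \<in> A} \<subseteq> {z. z - d \<in> B \<and> z - (- e) \<in> A} \<union> {z. z \<in> B \<and> z + (- d) \<notin> B}" by auto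
    from mu_mono[OF this] have "C e \<le> mu {z. z - d \<in> B \<and> z - (- e) \<in> A} + shift_loss B (- d)"
      unfolding C_def shift_loss_def by (meson mu_Un_le order_trans)
    also have "mu {z. z - d \<in> B \<and> z - (- e) \<in> A} = C (e + d)"
      using mu_two_shifts[OF perB perA, of d "- e"] by (simp add: C_def add.commute)
    also have "shift_loss B (- d) = m - mu {z. z \<in> B \<and> z + d \<in> B}"
      using shift_loss_minus[OF perB] by (simp add: shift_loss_alt m_def)
    finally have "C e \<le> C (e + d) + m - mu {z. z \<in> B \<and> z + d \<in> B}" by simp
    moreover have "(1 - \<delta>) * m < C e" using gap that by (simp add: E_def)
    moreover have "\<beta> / 100 * m = 2 * (\<delta> * m)" by (simp add: \<delta>_def)
    moreover have "(1 - \<delta>) * m = m - \<delta> * m" by (simp add: algebra_simps)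
    ultimately have "\<delta> * m \<le> C (e + d)" using d by linarith
    then show ?thesis by (simp add: E_def)
  qed
  \<comment> \<open>Otherwise all correlations are below \<open>\<delta> * m\<close>, too little for
    the energy.\<close>
  have "\<exists>e. e \<in> E"
  proof (rule ccontr)
    assume none: "\<not> ?thesis"
    define Q where "Q = (\<Sum>x\<in>{0..<p}. (reps A B x)\<^sup>2)"
    have "Q = (\<Sum>x\<in>{0..<p}. reps A B x * reps B A x)"
      using reps_commute[OF perA perB] by (simp add: Q_def power2_eq_square)
    also have "\<dots> \<le> (\<Sum>a\<in>{0..<p}. \<Sum>b\<in>{0..<p}. of_bool (a \<in> A) * of_bool (b \<in> B) * (\<delta> * m))"
      unfolding sum_reps_product[OF perB perA] C_def[symmetric]
    proof (intro sum_mono mult_left_mono)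
      show "C (a - b) \<le> \<delta> * m" for a b using none by (simp add: E_def not_le less_imp_le)
    qed simp
    also have "\<dots> = mu A * m * (\<delta> * m)"
      unfolding m_def by (rule sum_product_indicator)
    also have "\<dots> \<le> mu A * m * (1 / 200 * m)"
      using \<beta> by (intro mult_left_mono mult_right_mono) (auto simp: \<delta>_def m_def)
    finally have Qup: "Q \<le> mu A * (m * m) / 200" by simp
    moreover have "8 / 25 * (mu A * (m * m)) \<le> Q"
      unfolding Q_def m_def using m by (intro energy_ge[OF perB perS _ _ bad S]) auto
    moreover have "0 < mu A * (m * m)" using m by (simp add: m_def)
    ultimately show False by linarith
  qed
  then obtain e where "e \<in> E" by blast
  then have "E = UNIV" using invariant_eq_UNIV[OF perE _ d(1) inv] by blast
  have all: "(1 - \<delta>) * m \<le> C e" for e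
  proof -
    have "e \<in> E" using \<open>E = UNIV\<close> by simp
    then show ?thesis using gap[of e] by (simp add: E_def less_imp_le)
  qed
  \<comment> \<open>The average of \<open>C\<close> over all shifts is \<open>m * mu A / p\<close>,
    at most \<open>(1 - \<beta>) * m\<close>, so it cannot be as large as
    \<open>(1 - \<delta>) * m\<close>.\<close>
  have "p * ((1 - \<delta>) * m) = (\<Sum>e\<in>{0..<p}. (1 - \<delta>) * m)" by simp
  also have "\<dots> \<le> (\<Sum>e\<in>{0..<p}. C e)" by (intro sum_mono all)
  also have "\<dots> = m * mu A" unfolding C_def using sum_correlation[OF perB perA] by (simp add: m_def)
  finally have "m * (p * (1 - \<delta>)) \<le> m * mu A" by (simp add: mult_ac)
  then have "p * (1 - \<delta>) \<le> mu A" using m by (simp add: m_def)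
  also note sz
  finally have "p * (1 - \<delta>) \<le> p * (1 - \<beta>)" by (simp add: mult.commute)
  then have "1 - \<delta> \<le> 1 - \<beta>" using p_pos by (simp only: mult_le_cancel_left_pos of_int_0_less_iff)
  then show False using \<beta> by (simp add: \<delta>_def)
qed

text \<open>Balanced shifts are applied until the second set first has at most
  \<open>\<kappa> * m\<close> elements. Each step shrinks it but keeps at least the proportion
  \<open>\<beta> / 200\<close>, so the last step cannot overshoot the lower bound. The bound on the
  bad pairs is in terms of \<open>\<kappa> * m\<close> and thus suffices for
  \<open>balanced_shift\<close> as long as the process runs.\<close>

lemma shrink_pair:
  fixes \<beta> \<kappa> m :: real
  assumes perA: "periodic A" and perB: "periodic B" and perS: "periodic S"
    and m: "m = mu B" "m \<le> mu A" "100 \<le> \<kappa> * m" and \<kappa>: "0 < \<kappa>" "\<kappa> \<le> 1"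
    and bad: "bad_pairs S A B \<le> (\<kappa> * m)\<^sup>2 / 100" and S: "mu S \<le> mu A + mu B + \<kappa> * m"
    and \<beta>: "0 < \<beta>" "\<beta> \<le> 1" and sz: "mu A + mu B \<le> (1 - \<beta>) * p"
  shows "\<exists>A' B'. periodic A' \<and> periodic B' \<and> mu A' + mu B' = mu A + mu B \<and>
    bad_pairs S A' B' \<le> bad_pairs S A B \<and> \<beta> / 200 * (\<kappa> * m) \<le> mu B' \<and> mu B' \<le> \<kappa> * m"
proof -
  have km: "\<kappa> * m \<le> m" using \<kappa> m by (simp add: mult_left_le_one_le)
  have "\<beta> / 200 * (\<kappa> * m) \<le> 1 * (\<kappa> * m)" using \<beta> m by (intro mult_right_mono) auto
  then have start: "\<beta> / 200 * (\<kappa> * m) \<le> mu B" using km m(1) by linarith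
  have "\<exists>A' B'. periodic A' \<and> periodic B' \<and> mu A' + mu B' = mu A + mu B \<and>
      bad_pairs S A' B' \<le> bad_pairs S A B \<and> \<beta> / 200 * (\<kappa> * m) \<le> mu B' \<and> mu B' \<le> \<kappa> * m"
    if "periodic A1" "periodic B1" "mu A1 + mu B1 = mu A + mu B" "mu B1 \<le> m"
      "bad_pairs S A1 B1 \<le> bad_pairs S A B" "\<beta> / 200 * (\<kappa> * m) \<le> mu B1" for A1 B1
    using that
  proof (induction "card (B1 \<inter> {0..<p})" arbitrary: A1 B1 rule: less_induct)
    case less
    show ?case
    proof (cases "mu B1 \<le> \<kappa> * m")
      case True
      then show ?thesis using less.prems by blast
    next
      case False
      have "bad_pairs S A1 B1 \<le> (\<kappa> * m)\<^sup>2 / 100" using less.prems(5) bad by linarith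
      moreover have "(\<kappa> * m)\<^sup>2 \<le> (mu B1)\<^sup>2" using False m by (intro power_mono) auto
      ultimately have bad1: "bad_pairs S A1 B1 \<le> (mu B1)\<^sup>2 / 100" by simp
      have AB: "mu A1 \<le> (1 - \<beta>) * p" using less.prems(3) sz mu_nonneg[of B1] by linarith
      obtain e where e: "\<beta> / 200 * mu B1 \<le> mu (B1 \<inter> {x. x + e \<in> A1})"
          "mu (B1 \<inter> {x. x + e \<in> A1}) \<le> (1 - \<beta> / 200) * mu B1"
        using balanced_shift[OF less.prems(1,2) perS _ _ bad1 _ \<beta> AB] False less.prems m S by force
      define B2 where "B2 = B1 \<inter> {x. x + e \<in> A1}"
      define A2 where "A2 = A1 \<union> {x. x - e \<in> B1}"
      have B1pos: "0 < mu B1" using False m by linarith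
      have "\<beta> / 200 * mu B1 > 0" using B1pos \<beta> by simp
      then have lt: "mu B2 < mu B1" using e(2) by (simp add: B2_def algebra_simps)
      have per2: "periodic A2" "periodic B2"
        using periodic_Un[OF less.prems(1) periodic_shift[OF less.prems(2), of "- e"]]
          periodic_Int[OF less.prems(2) periodic_shift[OF less.prems(1), of e]]
        by (simp_all add: A2_def B2_def)
      have sum2: "mu A2 + mu B2 = mu A + mu B"
        using e_transform_card[OF less.prems(1,2), of e] less.prems(3) by (simp add: A2_def B2_def)
      have bad2: "bad_pairs S A2 B2 \<le> bad_pairs S A B"
        using bad_pairs_transform[OF less.prems(1,2) perS, of e] less.prems(5)
        unfolding A2_def B2_def by linarith
      have low2: "\<beta> / 200 * (\<kappa> * m) \<le> mu B2"
      proof -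
        have "\<beta> / 200 * (\<kappa> * m) \<le> \<beta> / 200 * mu B1" using \<beta> False by (intro mult_left_mono) auto
        then show ?thesis using e(1) by (simp add: B2_def)
      qed
      have "card (B2 \<inter> {0..<p}) < card (B1 \<inter> {0..<p})" using lt by (simp add: mu_card)
      moreover have "mu B2 \<le> m" using lt less.prems(4) by linarith
      ultimately show ?thesis using less.hyps[OF _ per2 sum2 _ bad2 low2] by blast
    qed
  qed
  from this[OF perA perB] show ?thesis using m start by simp
qed

end

section \<open>Arcs for the shrunken pair and for the original one\<close>

context prime_modulus begin

lemma Compl_arc:
  assumes "x \<le> y" "y \<le> x + p"
  shows "- cyc_arc x y = cyc_arc y (x + p)"
proof -
  have "z \<notin> cyc_arc x y \<longleftrightarrow> z \<in> cyc_arc y (x + p)" for z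
  proof -
    obtain z' where z': "[z' = z] (mod p)" "y \<le> z'" "z' < y + p" using arc_rep by blast
    have mem: "z' \<in> cyc_arc a b \<longleftrightarrow> z \<in> cyc_arc a b" for a b
      by (rule periodic_cong_mem[OF periodic_arc z'(1)])
    have 1: "z' \<in> cyc_arc y (x + p) \<longleftrightarrow> z' < x + p"
      using arc_window_iff[of y z' "x + p - y"] z' assms by simp
    have 2: "z' \<in> cyc_arc x y \<longleftrightarrow> \<not> z' < x + p"
    proof (cases "z' < x + p")
      case True
      then show ?thesis using arc_window_iff[of x z' "y - x"] z' assms by simp
    next
      case False
      then have "z' - p \<in> cyc_arc x y" using z' by (intro arcI) auto
      then show ?thesis using periodicD[OF periodic_arc, of "z' - p" x y] False by simp
    qed
    show ?thesis using mem 1 2 by blast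
  qed
  then show ?thesis by auto
qed

lemma mu_arc:
  assumes "x \<le> y" "y \<le> x + p"
  shows "mu (cyc_arc x y) = y - x"
proof -
  have "mu (UNIV \<inter> cyc_arc x (x + (y - x))) = window_count UNIV (y - x) x"
    using assms by (intro mu_Int_arc) auto
  also have "\<dots> = y - x" using assms by (simp add: window_count_def)
  finally show ?thesis by simp
qed

text \<open>Each residue of \<open>S - J\<close> is the sum of at most \<open>mu B\<close>
  pairs.\<close>

lemma bad_pairs_change:
  assumes "periodic B" "periodic S" "periodic J"
  shows "bad_pairs J A B \<le> bad_pairs S A B + mu (S - J) * mu B"
proof -
  have "bad_pairs J A B \<le> (\<Sum>a\<in>{0..<p}. of_bool (a \<in> A) * mu {b. b \<in> B \<and> a + b \<notin> S} +
      of_bool (a \<in> A) * mu {b. b \<in> B \<and> a + b \<in> S - J})"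
    unfolding bad_pairs_def
  proof (intro sum_mono)
    fix a
    have "mu {b. b \<in> B \<and> a + b \<notin> J} \<le> mu ({b. b \<in> B \<and> a + b \<notin> S} \<union> {b. b \<in> B \<and> a + b \<in> S - J})"
      by (intro mu_mono) auto
    also have "\<dots> \<le> mu {b. b \<in> B \<and> a + b \<notin> S} + mu {b. b \<in> B \<and> a + b \<in> S - J}" by (rule mu_Un_le)
    finally show "of_bool (a \<in> A) * mu {b. b \<in> B \<and> a + b \<notin> J} \<le>
      of_bool (a \<in> A) * mu {b. b \<in> B \<and> a + b \<notin> S} + of_bool (a \<in> A) * mu {b. b \<in> B \<and> a + b \<in> S - J}"
      by simp
  qed
  also have "\<dots> = bad_pairs S A B + (\<Sum>x\<in>{0..<p}. of_bool (x \<in> S - J) * reps A B x)"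
    unfolding sum.distrib bad_pairs_def sum_reps[OF assms(1) periodic_Diff[OF assms(2,3)]] ..
  also have "(\<Sum>x\<in>{0..<p}. of_bool (x \<in> S - J) * reps A B x) \<le> (\<Sum>x\<in>{0..<p}. of_bool (x \<in> S - J) * mu B)"
    by (intro sum_mono mult_left_mono reps_le assms) simp
  also have "\<dots> = mu (S - J) * mu B" by (simp only: mu_def sum_distrib_right)
  finally show ?thesis by simp
qed

text \<open>Differences of the good part \<open>G\<close> of \<open>B\<close> have shift loss at
  most \<open>b + b / 20 + 2 * (b / 20)\<close>, which is the radius \<open>t\<close>. By
  Cauchy--Davenport there are at least \<open>1.9 * b - 1\<close> of them, and
  \<open>1.6 * t\<close> is only \<open>1.84 * b\<close>. This yields an arc close to a dilate of
  \<open>A\<close>. A translate of it is close to the dilate of \<open>S\<close>, since a single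
  element of \<open>G\<close> already moves nearly all of \<open>A\<close> into
  \<open>S\<close>.\<close>

lemma arc_of_small_pair:
  fixes b H :: real
  assumes perA: "periodic A" and perB: "periodic B" and perS: "periodic S" and odd: "odd p"
    and b: "b = mu B" "25 \<le> b" "2 * b \<le> p"
    and bad: "bad_pairs S A B \<le> (b / 20)\<^sup>2" and S: "mu S \<le> mu A + b + b / 20"
    and H: "fourier_order \<le> H" "3060 \<le> H"
    and sz: "24 * (H * (23 / 20 * b)) \<le> mu A" "24 * (H * (23 / 20 * b)) \<le> p - mu A"
  shows "\<exists>k x y. coprime k p \<and> x < y \<and> y < x + p \<and>
    mu ({z. k * z \<in> S} - cyc_arc x y) \<le> 3521 * b \<and> y - x \<le> mu A + 3519 * b"
proof -
  define t where "t = 23 / 20 * b"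
  define G where "G = good_part S A B (b / 20)"
  have t: "25 \<le> t" using b by (simp add: t_def)
  have Ht: "real fourier_order * t \<le> H * t" "3060 * t \<le> H * t"
    using H t by (auto intro: mult_right_mono)
  have fo: "1 \<le> real fourier_order" using fourier_order(1) by simp
  have perG: "periodic G" unfolding G_def by (rule periodic_good_part[OF perS perB])
  have "b - bad_pairs S A B / (b / 20) \<le> mu G"
    unfolding G_def b(1) using b by (intro mu_good_part) simp
  moreover have "bad_pairs S A B / (b / 20) \<le> b / 20"
    using bad b(2) by (simp add: field_simps power2_eq_square)
  ultimately have G: "19 / 20 * b \<le> mu G" by simp
  interpret sl: periodic_seminorm p "shift_loss A" by (rule shift_loss_seminorm[OF perA])
  have card_level: "mu (sl.level s) \<le> 12 * s" if "1 \<le> s" "s \<le> H * t" for s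
  proof -
    have "4 * s \<le> mu A" "4 * s \<le> p - mu A" using that sz[folded t_def] by linarith+
    then show ?thesis using shift_loss_level_card[OF perA that(1)] by (simp add: sl.level_def)
  qed
  obtain y0 where y0: "y0 \<in> G" using mu_pos_nonempty[of G] G b by auto
  have lower: "8 / 5 * t \<le> mu (sl.level t)"
  proof -
    have perG': "periodic {x. 0 - x \<in> G}" by (rule periodic_reflect[OF perG])
    have "min (real_of_int p) (mu G + mu {x. 0 - x \<in> G} - 1) \<le> mu (sl.level t)"
    proof (rule cauchy_davenport[OF perG perG' sl.periodic_level])
      show "G \<noteq> {}" using y0 by auto
      have "- y0 \<in> {x. 0 - x \<in> G}" using y0 by simp
      then show "{x. 0 - x \<in> G} \<noteq> {}" by blast
      fix u v assume uv: "u \<in> G" "v \<in> {x. 0 - x \<in> G}"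
      have "shift_loss A (u - (0 - v)) \<le> mu S - mu A + 2 * (b / 20)"
        using uv unfolding G_def by (intro shift_loss_good_part[OF perA perS]) auto
      then show "u + v \<in> sl.level t" using S by (simp add: sl.level_def t_def)
    qed
    moreover have "mu {x. 0 - x \<in> G} = mu G" by (rule mu_reflect[OF perG])
    ultimately have "min (real_of_int p) (2 * mu G - 1) \<le> mu (sl.level t)" by simp
    then show ?thesis using G b by (simp add: t_def min_def split: if_splits)
  qed
  have Hp: "24 * (real fourier_order * t) \<le> p"
    using sz(1) mu_le_p[of A] Ht(1) by (simp add: t_def)
  obtain k l where kl: "coprime k p" "0 < l" "shift_loss A (k * l) \<le> t" "36 / 25 * t \<le> 2 * l + 1"
      "\<And>x. 0 \<le> x \<Longrightarrow> x < l \<Longrightarrow> shift_loss A (k * x) \<le> 306 * t"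
  proof -
    have "1 * t \<le> real fourier_order * t" using fo t by (intro mult_right_mono) auto
    then have "mu (sl.level (real fourier_order * t)) \<le> 12 * (real fourier_order * t)"
      using t Ht by (intro card_level) linarith+
    moreover have "mu (sl.level (462 * t)) \<le> 12 * (462 * t)" using t Ht by (intro card_level) linarith+
    ultimately show ?thesis using sl.dilated_progression[OF odd t lower _ _ Hp] that by blast
  qed
  define A1 where "A1 = {z. k * z \<in> A}"
  define S1 where "S1 = {z. k * z \<in> S}"
  have perA1: "periodic A1" and perS1: "periodic S1"
    using periodic_affine[OF perA, of k 0] periodic_affine[OF perS, of k 0] by (auto simp: A1_def S1_def)
  have muA1: "mu A1 = mu A" and muS1: "mu S1 = mu S"
    using mu_affine[OF perA kl(1), of 0] mu_affine[OF perS kl(1), of 0] by (simp_all add: A1_def S1_def)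
  have loss1: "shift_loss A1 d = shift_loss A (k * d)" for d
    unfolding A1_def by (rule shift_loss_dilate[OF perA kl(1)])
  obtain x y where xy: "x < y" "y < x + p" "mu (A1 - cyc_arc x y) \<le> 10 * (306 * t)"
      "mu (cyc_arc x y - A1) \<le> 10 * (306 * t)"
  proof -
    \<comment> \<open>As \<open>l\<close> is at least \<open>0.72 * t - 0.5\<close>,
      \<open>8 / 5 * l\<close> exceeds \<open>t\<close>.\<close>
    have "shift_loss A1 l < 8 / 5 * l" using kl t by (simp add: loss1)
    moreover have "shift_loss A1 i \<le> 306 * t" if "0 \<le> i" "i < l" for i using kl that by (simp add: loss1)
    moreover have "10 * (306 * t) < mu A1" "10 * (306 * t) < p - mu A1"
      using sz Ht t unfolding muA1 t_def by linarith+
    ultimately show ?thesis using near_arc[OF perA1 kl(2)] that by blast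
  qed
  obtain j where j: "[k * j = 1] (mod p)" using cong_solve_coprime_int[OF kl(1)] by blast
  define b1 where "b1 = j * y0"
  have kb: "[k * b1 = y0] (mod p)"
    using cong_mult[OF j cong_refl, of y0] by (simp add: b1_def mult.assoc)
  let ?AS = "{z. z - b1 \<in> A1}"
  have perAS: "periodic ?AS" using periodic_shift[OF perA1, of "- b1"] by simp
  have good: "mu A - b / 20 \<le> mu (S1 \<inter> ?AS)"
  proof -
    have "mu (S1 \<inter> ?AS) = mu {a. a + b1 \<in> S1 \<inter> ?AS}"
      by (rule mu_shift[symmetric]) (rule periodic_Int[OF perS1 perAS])
    also have "{a. a + b1 \<in> S1 \<inter> ?AS} = {a. k * a + 0 \<in> {a. a \<in> A \<and> y0 + a \<in> S}}"
    proof -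
      have "k * (a + b1) \<in> S \<longleftrightarrow> y0 + k * a \<in> S" for a
        using cong_add[OF cong_refl kb, of "k * a"]
        by (intro periodic_cong_mem[OF perS]) (simp add: distrib_left add.commute)
      then show ?thesis by (auto simp: S1_def A1_def)
    qed
    also have "mu \<dots> = mu {a. a \<in> A \<and> y0 + a \<in> S}"
    proof (rule mu_affine[OF _ kl(1)])
      show "periodic {a. a \<in> A \<and> y0 + a \<in> S}"
        using periodic_Int[OF perA periodic_shift[OF perS, of y0]] by (simp add: Int_def add.commute)
    qed
    also have "\<dots> = mu A - mu {a. a \<in> A \<and> y0 + a \<notin> S}"
      using mu_Diff[of A "{a. y0 + a \<notin> S}"] by (simp add: set_diff_eq Int_def)
    finally show ?thesis using y0 by (simp add: G_def good_part_def)
  qed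
  let ?J = "cyc_arc (x + b1) (y + b1)"
  have "S1 - ?J \<subseteq> (S1 - ?AS) \<union> (?AS - ?J)" by auto
  then have "mu (S1 - ?J) \<le> mu (S1 - ?AS) + mu (?AS - ?J)"
    by (meson mu_Un_le mu_mono order_trans)
  also have "mu (?AS - ?J) = mu (A1 - cyc_arc x y)"
  proof -
    have "mu {z. z + (- b1) \<in> A1 - cyc_arc x y} = mu (A1 - cyc_arc x y)"
      by (intro mu_shift periodic_Diff perA1 periodic_arc)
    moreover have "z \<in> ?J \<longleftrightarrow> z - b1 \<in> cyc_arc x y" for z
      using arc_shift_iff[of b1 "z - b1"] by simp
    ultimately show ?thesis by (simp add: set_diff_eq)
  qed
  also have "mu (S1 - ?AS) \<le> b + b / 10" using mu_Diff[of S1 ?AS] good S muS1 by simp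
  \<comment> \<open>The arc contributes \<open>3060 * 23 / 20 = 3519\<close>, the elements of
    \<open>S\<close> outside the translate of \<open>A\<close> contribute
    \<open>1.1\<close>.\<close>
  finally have SJ: "mu (S1 - ?J) \<le> 3521 * b" using xy(3) b by (simp add: t_def)
  have "y - x = mu (cyc_arc x y)" using xy by (simp add: mu_arc)
  also have "\<dots> = mu (cyc_arc x y - A1) + mu (cyc_arc x y \<inter> A1)" by (simp add: mu_Diff)
  also have "\<dots> \<le> 10 * (306 * t) + mu A1" using xy(4) mu_mono[of "cyc_arc x y \<inter> A1" A1] by simp
  finally have "y - x \<le> mu A + 3519 * b" by (simp add: muA1 t_def)
  then show ?thesis using kl(1) xy SJ unfolding S1_def
    by (intro exI[of _ k] exI[of _ "x + b1"] exI[of _ "y + b1"]) auto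
qed

text \<open>The shrunken pair places a dilate of \<open>S\<close> near an arc \<open>J\<close>. In
  the same dilation the sums of the original sets mostly avoid the complement of \<open>J\<close>,
  an arc of length \<open>g\<close>, so \<open>near_arc_of_sum_avoiding\<close> applies to the pair
  in both orders. In units of \<open>\<theta> * m / \<beta>\<close> the error is
  \<open>803 = 2 * 366 + 61 + 10\<close>, with \<open>366 = 6 * 61\<close> from each
  \<open>K * s\<close>, \<open>61\<close> from \<open>s\<close> and \<open>10\<close> from
  \<open>s'\<close>.\<close>

lemma near_arcs_of_few_bad_pairs:
  fixes \<beta> \<theta> \<kappa> m H :: real
  assumes perA: "periodic A" and perB: "periodic B" and perS: "periodic S"
    and m: "m = mu B" "m \<le> mu A" and \<beta>: "0 < \<beta>" "\<beta> \<le> 1" and sz: "mu A + mu B \<le> (1 - \<beta>) * p"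
    and H: "fourier_order \<le> H" "3060 \<le> H" and \<theta>: "0 < \<theta>" "\<kappa> = \<theta>\<^sup>2" "48 * H * \<kappa> \<le> \<beta>"
    and big: "5000 \<le> \<beta> * \<kappa> * m"
    and bad: "bad_pairs S A B \<le> (\<beta> * \<kappa> * m / 4000)\<^sup>2"
    and S: "mu S \<le> mu A + mu B + \<beta> * \<kappa> * m / 4000"
    and err: "803 * \<theta> / \<beta> * m + 2 < \<beta> / 2 * m"
  shows "\<exists>k x y x' y'. coprime k p \<and> x < y \<and> y \<le> x + p \<and> x' < y' \<and> y' \<le> x' + p \<and>
    mu ({z. k * z \<in> A} - cyc_arc x y) + mu (cyc_arc x y - {z. k * z \<in> A}) \<le> 803 * \<theta> / \<beta> * m + 1 \<and>
    mu ({z. k * z \<in> B} - cyc_arc x' y') + mu (cyc_arc x' y' - {z. k * z \<in> B}) \<le> 803 * \<theta> / \<beta> * m + 1"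
proof -
  have m0: "0 \<le> m" using m by simp
  have \<kappa>0: "0 < \<kappa>" using \<theta> by simp
  have "48 * 3060 * \<kappa> \<le> 48 * H * \<kappa>" using H \<kappa>0 by (intro mult_right_mono) auto
  then have \<kappa>s: "146880 * \<kappa> \<le> \<beta>" using \<theta>(3) by linarith
  have \<kappa>1: "\<kappa> \<le> 1" using \<kappa>s \<beta> \<kappa>0 by linarith
  \<comment> \<open>Small enough for \<open>3519 * \<theta> \<le> 10\<close>, which controls
    \<open>s'\<close>.\<close>
  have \<theta>s: "\<theta> \<le> 1 / 352"
  proof (rule power2_le_imp_le)
    show "\<theta>\<^sup>2 \<le> (1 / 352)\<^sup>2" using \<kappa>s \<beta> \<theta>(2) by (simp add: power2_eq_square)
  qed simp
  have km0: "0 \<le> \<kappa> * m" using \<kappa>0 m0 by simp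
  have bkm: "\<beta> * \<kappa> * m \<le> \<kappa> * m" using \<beta> km0 by (simp add: mult.assoc mult_left_le_one_le)
  have mp: "m \<le> p" using m mu_le_p by simp
  have mpos: "0 < m"
  proof (rule ccontr)
    assume "\<not> ?thesis"
    then have "m = 0" using m0 by simp
    then show False using big by simp
  qed
  have bad_shrink: "bad_pairs S A B \<le> (\<kappa> * m)\<^sup>2 / 100"
  proof -
    have "(\<beta> * \<kappa> * m / 4000)\<^sup>2 \<le> (\<kappa> * m / 10)\<^sup>2"
      using bkm km0 \<beta> \<kappa>0 m0 by (intro power_mono) auto
    also have "\<dots> = (\<kappa> * m)\<^sup>2 / 100" by (simp add: power2_eq_square)
    finally show ?thesis using bad by linarith
  qed
  obtain A' B' where AB': "periodic A'" "periodic B'" "mu A' + mu B' = mu A + mu B"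
      "bad_pairs S A' B' \<le> bad_pairs S A B" "\<beta> / 200 * (\<kappa> * m) \<le> mu B'" "mu B' \<le> \<kappa> * m"
    using shrink_pair[OF perA perB perS m(1,2) _ \<kappa>0 \<kappa>1 bad_shrink _ \<beta> sz] big bkm S by force
  define b where "b = mu B'"
  have b: "\<beta> * \<kappa> * m / 200 \<le> b" "b \<le> \<kappa> * m" "25 \<le> b" using AB' big by (auto simp: b_def)
  have bm: "146880 * b \<le> \<beta> * m"
    using b(2) mult_right_mono[OF \<kappa>s m0] by (simp add: mult.assoc)
  have \<beta>m: "\<beta> * m \<le> m" using \<beta> m0 by (simp add: mult_left_le_one_le)
  have \<beta>mp: "\<beta> * m \<le> \<beta> * p" using \<beta> mp by (intro mult_left_mono) auto
  have A'm: "m \<le> mu A'" using AB'(3,6) m \<kappa>1 m0 mult_left_le_one_le[of m \<kappa>] \<kappa>0 by linarith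
  have A'p: "\<beta> * p \<le> p - mu A'"
  proof -
    have "(1 - \<beta>) * p = p - \<beta> * p" by (simp add: left_diff_distrib)
    then show ?thesis using AB'(3) sz mu_nonneg[of B'] by linarith
  qed
  have "odd p"
  proof -
    have "2 < p" using mp \<beta>m bm b by linarith
    then show ?thesis using prime_p prime_odd_int by blast
  qed
  have bad': "bad_pairs S A' B' \<le> (b / 20)\<^sup>2"
  proof -
    have "(\<beta> * \<kappa> * m / 4000)\<^sup>2 \<le> (b / 20)\<^sup>2" using b(1) \<beta> \<kappa>0 m0 by (intro power_mono) auto
    then show ?thesis using bad AB'(4) by linarith
  qed
  have S': "mu S \<le> mu A' + b + b / 20" using S AB'(3) b(1) by (simp add: b_def)
  have Hb: "24 * (H * (23 / 20 * b)) \<le> \<beta> * m"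
  proof -
    have "24 * (H * (23 / 20 * b)) \<le> 48 * H * b" using H b by simp
    also have "\<dots> \<le> 48 * H * (\<kappa> * m)" using H b by (intro mult_left_mono) auto
    also have "\<dots> \<le> \<beta> * m" using mult_right_mono[OF \<theta>(3) m0] by (simp add: mult.assoc)
    finally show ?thesis .
  qed
  obtain k x y where kxy: "coprime k p" "x < y" "y < x + p"
      "mu ({z. k * z \<in> S} - cyc_arc x y) \<le> 3521 * b" "y - x \<le> mu A' + 3519 * b"
  proof -
    have "2 * b \<le> p" using bm \<beta>m mp b by linarith
    then show ?thesis
      using arc_of_small_pair[OF AB'(1,2) perS \<open>odd p\<close> b_def b(3) _ bad' S' H] Hb \<beta>m A'm \<beta>mp A'p that
      by force
  qed
  define A0 where "A0 = {z. k * z \<in> A}"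
  define B0 where "B0 = {z. k * z \<in> B}"
  define S0 where "S0 = {z. k * z \<in> S}"
  have per0: "periodic A0" "periodic B0" "periodic S0"
    using periodic_affine[OF perA, of k 0] periodic_affine[OF perB, of k 0] periodic_affine[OF perS, of k 0]
    by (auto simp: A0_def B0_def S0_def)
  have mu0: "mu A0 = mu A" "mu B0 = m"
    using mu_affine[OF perA kxy(1), of 0] mu_affine[OF perB kxy(1), of 0] m by (simp_all add: A0_def B0_def)
  define J where "J = cyc_arc x y"
  define g where "g = x + p - y"
  have g: "0 < g" "g \<le> p" using kxy by (auto simp: g_def)
  have CJ: "- J = cyc_arc y (y + g)" using Compl_arc[of x y] kxy by (simp add: J_def g_def)
  \<comment> \<open>\<open>61^2 = 3721\<close> exceeds \<open>1 + 3521\<close>, the factor of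
    \<open>\<kappa> * m^2\<close> in the bound for the bad pairs of \<open>J\<close>.\<close>
  define s where "s = 61 * \<theta> * m"
  define s' where "s' = 3519 * b"
  have s: "0 < s" "0 \<le> s'" using \<theta> mpos b by (auto simp: s_def s'_def)
  have pairs: "bad_pairs J A0 B0 \<le> s\<^sup>2"
  proof -
    have "bad_pairs J A0 B0 \<le> bad_pairs S0 A0 B0 + mu (S0 - J) * mu B0"
      unfolding J_def by (intro bad_pairs_change per0 periodic_arc)
    also have "bad_pairs S0 A0 B0 = bad_pairs S A B"
      unfolding A0_def B0_def S0_def by (rule bad_pairs_dilate[OF perA perB perS kxy(1)])
    also have "bad_pairs S A B \<le> \<kappa> * m * m"
    proof -
      have "(\<kappa> * m)\<^sup>2 / 100 \<le> (\<kappa> * m)\<^sup>2" by simp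
      also have "\<dots> \<le> \<kappa> * m * m"
        unfolding power2_eq_square using \<kappa>1 m0 km0 mult_left_le_one_le[of m \<kappa>] \<kappa>0 by (intro mult_left_mono) auto
      finally show ?thesis using bad_shrink by linarith
    qed
    also have "mu (S0 - J) * mu B0 \<le> 3521 * (\<kappa> * m) * m"
    proof -
      have "mu (S0 - J) \<le> 3521 * (\<kappa> * m)" using kxy(4) b(2) by (simp add: S0_def J_def)
      then show ?thesis unfolding mu0 using m0 by (intro mult_right_mono)
    qed
    also have "\<kappa> * m * m + 3521 * (\<kappa> * m) * m \<le> s\<^sup>2"
      using \<theta>(1) m0 by (simp add: s_def \<theta>(2) power2_eq_square)
    finally show ?thesis by simp
  qed
  \<comment> \<open>Of the free proportion \<beta> outside \<open>A'\<close> at least half remains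
    outside the arc, since \<open>3519 * b\<close> is at most half of
    \<open>\<beta> * p\<close>.\<close>
  have gbig: "\<beta> / 2 * p \<le> g"
  proof -
    have "real_of_int g = p - (y - x)" by (simp add: g_def)
    also have "\<dots> \<ge> p - mu A' - 3519 * b" using kxy(5) by simp
    finally show ?thesis using A'p bm \<beta>mp b(3) by linarith
  qed
  have size: "p \<le> mu A0 + mu B0 + g + s'"
  proof -
    have "real_of_int g = x + p - y" by (simp add: g_def)
    then show ?thesis using kxy(5) AB'(3) mu_nonneg[of B'] m(1) unfolding s'_def mu0 by linarith
  qed
  define K where "K = 2 * (p / g + 1)"
  have K: "K \<le> 6 / \<beta>"
  proof -
    have "p / g \<le> 2 / \<beta>" using gbig g \<beta> by (simp add: field_simps)
    moreover have "1 \<le> 1 / \<beta>" using \<beta> by simp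
    ultimately have "K \<le> 2 * (2 / \<beta> + 1 / \<beta>)" by (simp add: K_def)
    then show ?thesis by simp
  qed
  define \<eta> where "\<eta> = \<theta> * m / \<beta>"
  have \<eta>: "\<theta> * m \<le> \<eta>" using \<beta> \<theta> m0 by (simp add: \<eta>_def pos_le_divide_eq mult_left_le)
  have Ks: "K * s \<le> 366 * \<eta>"
  proof -
    have "K * s \<le> 6 / \<beta> * s" using K s by (intro mult_right_mono) auto
    then show ?thesis by (simp add: s_def \<eta>_def)
  qed
  have s\<eta>: "s \<le> 61 * \<eta>" using \<eta> by (simp add: s_def)
  have s'\<eta>: "s' \<le> 10 * \<eta>"
  proof -
    have "s' \<le> 3519 * (\<kappa> * m)" using b(2) by (simp add: s'_def)
    also have "\<dots> = 3519 * \<theta> * (\<theta> * m)" by (simp add: \<theta>(2) power2_eq_square)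
    also have "\<dots> \<le> 10 * (\<theta> * m)" using \<theta>s \<theta> m0 by (intro mult_right_mono) auto
    finally show ?thesis using \<eta> by linarith
  qed
  have K1: "(K + 1) * s = K * s + s" by (simp add: distrib_right)
  have err': "803 * \<eta> + 2 < \<beta> / 2 * m" using err by (simp add: \<eta>_def)
  have \<eta>0: "0 \<le> \<eta>" using \<beta> \<theta> m0 by (simp add: \<eta>_def)
  have gap: "(K + 1) * s + s' + 2 < g"
    using K1 Ks s\<eta> s'\<eta> err' \<eta>0 gbig \<beta>mp by linarith
  have mbig: "K * s < m" "s < m" using Ks s\<eta> err' \<eta>0 \<beta>m by linarith+
  have near: "\<exists>x y. x < y \<and> y \<le> x + p \<and> mu (C - cyc_arc x y) + mu (cyc_arc x y - C) \<le> 803 * \<eta> + 1"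
    if C: "periodic C" "periodic D" "bad_pairs J D C \<le> s\<^sup>2" "m \<le> mu C" "m \<le> mu D" "p \<le> mu D + mu C + g + s'" for C D
  proof -
    have "(\<Sum>a\<in>{0..<p}. of_bool (a \<in> D) * mu {b. b \<in> C \<and> a + b \<in> cyc_arc y (y + g)}) \<le> s\<^sup>2"
      using C(3) unfolding bad_pairs_def CJ[symmetric] by simp
    moreover have "s < mu D" "K * s < mu C" using mbig C by linarith+
    ultimately obtain x y where "x < y" "y \<le> x + p" "mu (C - cyc_arc x y) \<le> K * s"
        "mu (cyc_arc x y - C) \<le> (K + 1) * s + s' + 1"
      using near_arc_of_sum_avoiding[OF C(2,1) g s _ C(6) K_def gap] by blast
    moreover from this have "mu (C - cyc_arc x y) + mu (cyc_arc x y - C) \<le> 803 * \<eta> + 1"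
      using K1 Ks s\<eta> s'\<eta> by linarith
    ultimately show ?thesis by blast
  qed
  obtain x1 y1 where 1: "x1 < y1" "y1 \<le> x1 + p" "mu (A0 - cyc_arc x1 y1) + mu (cyc_arc x1 y1 - A0) \<le> 803 * \<eta> + 1"
    using near[OF per0(1,2)] pairs bad_pairs_commute[of J A0 B0] mu0 m size by (auto simp: add_ac)
  obtain x2 y2 where 2: "x2 < y2" "y2 \<le> x2 + p" "mu (B0 - cyc_arc x2 y2) + mu (cyc_arc x2 y2 - B0) \<le> 803 * \<eta> + 1"
    using near[OF per0(2,1)] pairs mu0 m size by auto
  show ?thesis
    using kxy(1) 1 2 unfolding A0_def B0_def \<eta>_def
    by (intro exI[of _ k] exI[of _ x1] exI[of _ y1] exI[of _ x2] exI[of _ y2]) simp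
qed

end

subsection \<open>Random subsets\<close>

lemma card_nsets_containing:
  assumes fin: "finite A" and F: "F \<subseteq> A" "card F \<le> c"
  shows "card {N \<in> nsets A c. F \<subseteq> N} = (card A - card F) choose (c - card F)"
proof -
  have finF: "finite F" using fin F finite_subset by blast
  have "bij_betw (\<lambda>N. N - F) {N \<in> nsets A c. F \<subseteq> N} (nsets (A - F) (c - card F))"
  proof (rule bij_betw_byWitness[where f' = "\<lambda>M. M \<union> F"])
    show "\<forall>N\<in>{N \<in> nsets A c. F \<subseteq> N}. N - F \<union> F = N" by auto
    show "\<forall>M\<in>nsets (A - F) (c - card F). M \<union> F - F = M" by (auto simp: nsets_def)
    show "(\<lambda>N. N - F) ` {N \<in> nsets A c. F \<subseteq> N} \<subseteq> nsets (A - F) (c - card F)"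
      using finF by (auto simp: nsets_def card_Diff_subset)
    show "(\<lambda>M. M \<union> F) ` nsets (A - F) (c - card F) \<subseteq> {N \<in> nsets A c. F \<subseteq> N}"
    proof
      fix N assume "N \<in> (\<lambda>M. M \<union> F) ` nsets (A - F) (c - card F)"
      then obtain M where M: "N = M \<union> F" "M \<subseteq> A - F" "finite M" "card M = c - card F"
        by (auto simp: nsets_def)
      have "M \<inter> F = {}" using M by auto
      then have "card N = c" using card_Un_disjoint[OF M(3) finF] M F by simp
      then show "N \<in> {N \<in> nsets A c. F \<subseteq> N}" using M F finF by (auto simp: nsets_def)
    qed
  qed
  then have "card {N \<in> nsets A c. F \<subseteq> N} = card (nsets (A - F) (c - card F))" by (rule bij_betw_same_card)
  then show ?thesis using finF F by (simp add: card_Diff_subset)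
qed

lemma sum_nsets_mem:
  assumes fin: "finite A" and c: "1 \<le> c" and a: "a \<in> A"
  shows "(\<Sum>N\<in>nsets A c. of_bool (a \<in> N)) = real c / card A * card (nsets A c)"
proof -
  have "(\<Sum>N\<in>nsets A c. of_bool (a \<in> N)) = real (card {N \<in> nsets A c. {a} \<subseteq> N})"
    using finite_imp_finite_nsets[OF fin] by (simp add: Int_def)
  also have "card {N \<in> nsets A c. {a} \<subseteq> N} = (card A - 1) choose (c - 1)"
    using card_nsets_containing[OF fin, of "{a}" c] a c by simp
  finally have s: "(\<Sum>N\<in>nsets A c. of_bool (a \<in> N)) = real ((card A - 1) choose (c - 1))" .
  obtain k where k: "c = Suc k" using c by (cases c) auto
  have "c * (card A choose c) = card A * ((card A - 1) choose (c - 1))"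
    using binomial_absorption[of k "card A"] k by simp
  then have "real c * real (card A choose c) = real (card A) * real ((card A - 1) choose (c - 1))"
    by (metis of_nat_mult)
  moreover have "card A \<noteq> 0" using fin a by auto
  ultimately show ?thesis unfolding s by (simp add: field_simps)
qed

text \<open>Drawing without replacement is negatively correlated: the factor
  \<open>(c - 1) / (n - 1)\<close> for the second element is at most \<open>c / n\<close>.\<close>

lemma sum_nsets_mem2:
  assumes fin: "finite A" and c: "1 \<le> c" "c \<le> card A" and a: "a \<in> A" "a' \<in> A" "a \<noteq> a'"
  shows "(\<Sum>N\<in>nsets A c. of_bool (a \<in> N) * of_bool (a' \<in> N)) \<le> (real c / card A)\<^sup>2 * card (nsets A c)"
\<comment> \<open>For \<open>c = 1\<close> truncated subtraction would turn the binomial coefficient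
  used below into 1, while no singleton contains both elements.\<close>
proof (cases "c = 1")
  case True
  have "(\<Sum>N\<in>nsets A c. of_bool (a \<in> N) * of_bool (a' \<in> N) :: real) = 0"
  proof (intro sum.neutral ballI)
    fix N assume "N \<in> nsets A c"
    then obtain x where "N = {x}" using True by (auto simp: nsets_def card_1_singleton_iff)
    then show "of_bool (a \<in> N) * of_bool (a' \<in> N) = (0 :: real)" using a by auto
  qed
  then show ?thesis by simp
next
  case False
  have c2: "card {a, a'} = 2" "2 \<le> c" using a False c by auto
  have "(\<Sum>N\<in>nsets A c. of_bool (a \<in> N) * of_bool (a' \<in> N)) = real (card {N \<in> nsets A c. {a, a'} \<subseteq> N})"
    using finite_imp_finite_nsets[OF fin] by (simp add: Int_def flip: of_bool_conj)
  also have "card {N \<in> nsets A c. {a, a'} \<subseteq> N} = (card A - 2) choose (c - 2)"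
    using card_nsets_containing[OF fin, of "{a, a'}" c] a c2 by simp
  finally have s: "(\<Sum>N\<in>nsets A c. of_bool (a \<in> N) * of_bool (a' \<in> N)) = real ((card A - 2) choose (c - 2))" .
  obtain k where k: "c = Suc (Suc k)" using c2 by (metis Suc_1 Suc_le_D le_Suc_ex numeral_2_eq_2 add_Suc)
  define n where "n = card A"
  have n: "c \<le> n" using c by (simp add: n_def)
  have 1: "c * (n choose c) = n * ((n - 1) choose (c - 1))"
    using binomial_absorption[of "Suc k" n] k by simp
  have 2: "(c - 1) * ((n - 1) choose (c - 1)) = (n - 1) * ((n - 2) choose (c - 2))"
    using binomial_absorption[of k "n - 1"] k by (simp add: numeral_2_eq_2)
  have r1: "real c * real (n choose c) = real n * real ((n - 1) choose (c - 1))" using 1 by (metis of_nat_mult)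
  have r2: "real (c - 1) * real ((n - 1) choose (c - 1)) = real (n - 1) * real ((n - 2) choose (c - 2))"
    using 2 by (metis of_nat_mult)
  have n1: "0 < real (n - 1)" "0 < real n" using n c2 by auto
  have "real ((n - 2) choose (c - 2)) = real (c - 1) * real ((n - 1) choose (c - 1)) / real (n - 1)"
    unfolding r2 by (rule nonzero_mult_div_cancel_left[symmetric]) (use n1 in auto)
  also have "real ((n - 1) choose (c - 1)) = real c * real (n choose c) / real n"
    unfolding r1 by (rule nonzero_mult_div_cancel_left[symmetric]) (use n1 in auto)
  also have "real (c - 1) * (real c * real (n choose c) / real n) / real (n - 1) =
      real (c - 1) / real (n - 1) * (real c / real n) * real (n choose c)"
    by (simp only: times_divide_eq_left times_divide_eq_right divide_divide_eq_left mult_ac)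
  finally have "real ((n - 2) choose (c - 2)) = real (c - 1) / real (n - 1) * (real c / real n) * real (n choose c)" .
  also have "\<dots> \<le> (real c / real n) * (real c / real n) * real (n choose c)"
  proof (intro mult_right_mono)
    have "real (c - 1) * real n \<le> real c * real (n - 1)" using n c2 by (simp add: of_nat_diff algebra_simps)
    then show "real (c - 1) / real (n - 1) \<le> real c / real n" using n1 by (simp add: field_simps)
  qed auto
  finally show ?thesis unfolding s by (simp add: n_def power2_eq_square)
qed

text \<open>In the application \<open>I\<close> holds the first coordinates of the representations
  of a sum, and \<psi> gives the second ones. The number \<open>X\<close> of representations inside
  the random pair has mean \<open>r * q\<close>. As \<psi> is injective, distinct representations
  are not positively correlated, so the mean of \<open>X^2\<close> is at most
  \<open>r * q * (1 + r * q)\<close>, and Cauchy--Schwarz bounds the probability that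
  \<open>X\<close> is positive. All quantities are multiplied by the number \<open>T\<close> of
  pairs of subsets.\<close>

lemma second_moment_hits:
  fixes A :: "'a set" and B :: "'b set" and I :: "'a set" and \<psi> :: "'a \<Rightarrow> 'b"
  assumes fin: "finite A" "finite B" and c1: "1 \<le> c1" "c1 \<le> card A" and c2: "1 \<le> c2" "c2 \<le> card B"
    and I: "I \<subseteq> A" "inj_on \<psi> I" "\<psi> ` I \<subseteq> B"
    and q: "q = real c1 * real c2 / (real (card A) * real (card B))"
  shows "real (card (nsets A c1)) * real (card (nsets B c2)) * (real (card I) * q / (1 + real (card I) * q)) \<le>
    (\<Sum>(A', B')\<in>nsets A c1 \<times> nsets B c2. of_bool (\<exists>a\<in>I. a \<in> A' \<and> \<psi> a \<in> B'))"
proof -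
  let ?Z = "nsets A c1 \<times> nsets B c2"
  define T where "T = real (card (nsets A c1)) * real (card (nsets B c2))"
  define r where "r = real (card I)"
  define w :: "'a \<Rightarrow> 'a set \<times> 'b set \<Rightarrow> real" where
    "w a z = of_bool (a \<in> fst z) * of_bool (\<psi> a \<in> snd z)" for a z
  define X where "X z = (\<Sum>a\<in>I. w a z)" for z :: "'a set \<times> 'b set"
  define h where "h z = (of_bool (\<exists>a\<in>I. a \<in> fst z \<and> \<psi> a \<in> snd z) :: real)" for z :: "'a set \<times> 'b set"
  have finI: "finite I" using I fin finite_subset by blast
  have prod: "(\<Sum>z\<in>?Z. g (fst z) * k (snd z)) = (\<Sum>N\<in>nsets A c1. g N) * (\<Sum>N\<in>nsets B c2. k N)"
    for g k :: "_ \<Rightarrow> real"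
    by (simp add: sum_product sum.cartesian_product case_prod_unfold)
  have q0: "0 \<le> q" by (simp add: q)
  have T0: "0 < T" using c1 c2 by (simp add: T_def zero_less_binomial)
  have one: "(\<Sum>z\<in>?Z. w a z) = q * T" if "a \<in> I" for a
  proof -
    have a: "a \<in> A" "\<psi> a \<in> B" using that I by auto
    have "(\<Sum>z\<in>?Z. w a z) =
        (\<Sum>N\<in>nsets A c1. of_bool (a \<in> N)) * (\<Sum>N\<in>nsets B c2. of_bool (\<psi> a \<in> N) :: real)"
      unfolding w_def by (rule prod)
    then show ?thesis
      unfolding sum_nsets_mem[OF fin(1) c1(1) a(1)] sum_nsets_mem[OF fin(2) c2(1) a(2)]
      by (simp add: q T_def)
  qed
  have "(\<Sum>z\<in>?Z. X z) = (\<Sum>a\<in>I. \<Sum>z\<in>?Z. w a z)"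
    unfolding X_def by (rule sum.swap)
  also have "\<dots> = (\<Sum>a\<in>I. q * T)" by (intro sum.cong refl one)
  finally have EX: "(\<Sum>z\<in>?Z. X z) = r * (q * T)" by (simp add: r_def)
  have two: "(\<Sum>z\<in>?Z. w a z * w a' z) \<le> (if a' = a then q * T else 0) + q\<^sup>2 * T"
    if a: "a \<in> I" "a' \<in> I" for a a'
  proof (cases "a' = a")
    case True
    have "(\<Sum>z\<in>?Z. w a z * w a' z) = (\<Sum>z\<in>?Z. w a z)"
      using True by (intro sum.cong refl) (simp add: w_def)
    then show ?thesis using one[OF a(1)] True T0 by simp
  next
    case False
    have "(\<Sum>z\<in>?Z. w a z * w a' z) =
        (\<Sum>z\<in>?Z. (of_bool (a \<in> fst z) * of_bool (a' \<in> fst z)) * (of_bool (\<psi> a \<in> snd z) * of_bool (\<psi> a' \<in> snd z)) :: real)"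
      by (intro sum.cong refl) (simp add: w_def)
    also have "\<dots> = (\<Sum>N\<in>nsets A c1. of_bool (a \<in> N) * of_bool (a' \<in> N)) * (\<Sum>N\<in>nsets B c2. of_bool (\<psi> a \<in> N) * of_bool (\<psi> a' \<in> N))"
      by (rule prod)
    also have "\<dots> \<le> ((real c1 / card A)\<^sup>2 * card (nsets A c1)) * ((real c2 / card B)\<^sup>2 * card (nsets B c2))"
    proof (rule mult_mono)
      show "(\<Sum>N\<in>nsets A c1. of_bool (a \<in> N) * of_bool (a' \<in> N)) \<le> (real c1 / card A)\<^sup>2 * card (nsets A c1)"
        using a I False by (intro sum_nsets_mem2 fin c1) auto
      show "(\<Sum>N\<in>nsets B c2. of_bool (\<psi> a \<in> N) * of_bool (\<psi> a' \<in> N)) \<le> (real c2 / card B)\<^sup>2 * card (nsets B c2)"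
        using a I False by (intro sum_nsets_mem2 fin c2) (auto dest: inj_onD)
    qed (auto intro!: sum_nonneg)
    also have "\<dots> = q\<^sup>2 * T" by (simp add: q T_def power_mult_distrib power_divide)
    finally show ?thesis using False by simp
  qed
  have "(\<Sum>z\<in>?Z. (X z)\<^sup>2) = (\<Sum>z\<in>?Z. \<Sum>a\<in>I. \<Sum>a'\<in>I. w a z * w a' z)"
    by (simp only: X_def power2_eq_square sum_product)
  also have "\<dots> = (\<Sum>a\<in>I. \<Sum>z\<in>?Z. \<Sum>a'\<in>I. w a z * w a' z)"
    by (rule sum.swap)
  also have "\<dots> = (\<Sum>a\<in>I. \<Sum>a'\<in>I. \<Sum>z\<in>?Z. w a z * w a' z)"
    by (intro sum.cong refl sum.swap)
  also have "\<dots> \<le> (\<Sum>a\<in>I. \<Sum>a'\<in>I. (if a' = a then q * T else 0) + q\<^sup>2 * T)"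
    by (intro sum_mono two)
  also have "\<dots> = (\<Sum>a\<in>I. q * T + r * (q\<^sup>2 * T))"
    using finI by (intro sum.cong refl) (simp add: sum.distrib r_def)
  also have "\<dots> = r * (q * T) * (1 + r * q)" by (simp add: r_def algebra_simps power2_eq_square)
  finally have EX2: "(\<Sum>z\<in>?Z. (X z)\<^sup>2) \<le> r * (q * T) * (1 + r * q)" .
  have hX: "h z * X z = X z" for z
  proof (cases "\<exists>a\<in>I. a \<in> fst z \<and> \<psi> a \<in> snd z")
    case False
    then have "X z = 0" unfolding X_def w_def by (intro sum.neutral) auto
    then show ?thesis by simp
  qed (simp add: h_def)
  have "(r * (q * T))\<^sup>2 = (\<Sum>z\<in>?Z. h z * X z)\<^sup>2" by (simp only: hX EX)
  also have "\<dots> \<le> (\<Sum>z\<in>?Z. (h z)\<^sup>2) * (\<Sum>z\<in>?Z. (X z)\<^sup>2)" by (rule Cauchy_Schwarz_ineq_sum)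
  also have "(\<Sum>z\<in>?Z. (h z)\<^sup>2) = (\<Sum>z\<in>?Z. h z)" by (intro sum.cong refl) (simp add: h_def)
  also have "(\<Sum>z\<in>?Z. h z) * (\<Sum>z\<in>?Z. (X z)\<^sup>2) \<le> (\<Sum>z\<in>?Z. h z) * (r * (q * T) * (1 + r * q))"
    by (intro mult_left_mono EX2 sum_nonneg) (simp add: h_def)
  finally have main: "(r * (q * T)) * (r * (q * T)) \<le> (r * (q * T)) * ((\<Sum>z\<in>?Z. h z) * (1 + r * q))"
    by (simp add: power2_eq_square mult_ac)
  have pos: "0 < 1 + r * q" using q0 by (simp add: r_def add_pos_nonneg)
  have "T * (r * q / (1 + r * q)) \<le> (\<Sum>z\<in>?Z. h z)"
  proof (cases "r * q = 0")
    case True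
    then show ?thesis by (auto intro!: sum_nonneg simp: h_def)
  next
    case False
    moreover have "0 \<le> r * q" using q0 by (simp add: r_def)
    ultimately have "0 < r * q" by linarith
    then have "0 < r * q * T" using T0 by (rule mult_pos_pos)
    then have "0 < r * (q * T)" by (simp only: mult.assoc)
    then have "r * (q * T) \<le> (\<Sum>z\<in>?Z. h z) * (1 + r * q)" using main by (simp only: mult_le_cancel_left_pos)
    then show ?thesis using pos by (simp add: pos_divide_le_eq mult_ac)
  qed
  then show ?thesis by (simp add: T_def r_def h_def case_prod_unfold)
qed

section \<open>The expected sumset modulo \<open>p\<close> and the popular sums\<close>

context prime_modulus begin

lemma residues_p: "residues p"
  using prime_p by (simp add: residues_def prime_gt_1_int)

definition lift :: "int set \<Rightarrow> int set" where
  "lift A = {x. x mod p \<in> A}"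

lemma periodic_lift: "periodic (lift A)" by (simp add: periodic_def lift_def)

lemma mu_lift:
  assumes "A \<subseteq> {0..<p}"
  shows "mu (lift A) = card A"
proof -
  have "lift A \<inter> {0..<p} = A" using assms by (auto simp: lift_def)
  then show ?thesis by (simp add: mu_card)
qed

lemma expected_sumset_card_eq:
  assumes fin: "finite A" "finite B" and c: "c1 \<le> card A" "c2 \<le> card B"
  shows "expected_sumset_card (residue_ring p) A c1 B c2 =
    (\<Sum>(A', B')\<in>nsets A c1 \<times> nsets B c2. real (card (A' <+>\<^bsub>residue_ring p\<^esub> B'))) /
      (real (card (nsets A c1)) * real (card (nsets B c2)))"
proof -
  have f: "finite (nsets A c1)" "finite (nsets B c2)"
    using finite_imp_finite_nsets fin by blast+
  have "0 < card (nsets A c1)" "0 < card (nsets B c2)" using c by (simp_all add: zero_less_binomial)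
  then have ne: "nsets A c1 \<noteq> {}" "nsets B c2 \<noteq> {}" unfolding card_gt_0_iff by blast+
  have "expected_sumset_card (residue_ring p) A c1 B c2 =
      (\<Sum>z\<in>nsets A c1 \<times> nsets B c2. pmf (pair_pmf (pmf_of_set (nsets A c1)) (pmf_of_set (nsets B c2))) z *
        (case z of (A', B') \<Rightarrow> real (card (A' <+>\<^bsub>residue_ring p\<^esub> B'))))"
    unfolding expected_sumset_card_def
    by (subst integral_measure_pmf[of "nsets A c1 \<times> nsets B c2"]) (use f ne in \<open>auto simp: set_pmf_of_set\<close>)
  also have "\<dots> = (\<Sum>z\<in>nsets A c1 \<times> nsets B c2. (case z of (A', B') \<Rightarrow> real (card (A' <+>\<^bsub>residue_ring p\<^esub> B'))) /
      (real (card (nsets A c1)) * real (card (nsets B c2))))"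
  proof (intro sum.cong refl)
    fix z assume "z \<in> nsets A c1 \<times> nsets B c2"
    then obtain A' B' where z: "z = (A', B')" "A' \<in> nsets A c1" "B' \<in> nsets B c2" by blast
    have "pmf (pair_pmf (pmf_of_set (nsets A c1)) (pmf_of_set (nsets B c2))) z =
        1 / (real (card (nsets A c1)) * real (card (nsets B c2)))"
      unfolding z(1) pmf_pair pmf_of_set[OF ne(1) f(1)] pmf_of_set[OF ne(2) f(2)]
      using z(2,3) by (simp del: card_nsets)
    then show "pmf (pair_pmf (pmf_of_set (nsets A c1)) (pmf_of_set (nsets B c2))) z *
        (case z of (A', B') \<Rightarrow> real (card (A' <+>\<^bsub>residue_ring p\<^esub> B'))) =
        (case z of (A', B') \<Rightarrow> real (card (A' <+>\<^bsub>residue_ring p\<^esub> B'))) /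
          (real (card (nsets A c1)) * real (card (nsets B c2)))"
      by (simp only: times_divide_eq_left mult_1_left)
  qed
  finally show ?thesis by (simp only: sum_divide_distrib)
qed

text \<open>By linearity of expectation each residue \<open>x\<close> contributes its own hitting
  probability, bounded by the second moment with \<psi> mapping \<open>a\<close> to
  \<open>(x - a) mod p\<close>.\<close>

lemma expected_sumset_card_ge:
  assumes sub: "A \<subseteq> {0..<p}" "B \<subseteq> {0..<p}" and c1: "1 \<le> c1" "c1 \<le> card A" and c2: "1 \<le> c2" "c2 \<le> card B"
    and q: "q = real c1 * real c2 / (real (card A) * real (card B))"
  shows "(\<Sum>x\<in>{0..<p}. reps (lift A) (lift B) x * q / (1 + reps (lift A) (lift B) x * q)) \<le>
    expected_sumset_card (residue_ring p) A c1 B c2"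
proof -
  interpret residues p "residue_ring p" by (rule residues_p) simp
  have fin: "finite A" "finite B" using sub finite_subset by blast+
  let ?Z = "nsets A c1 \<times> nsets B c2"
  define T where "T = real (card (nsets A c1)) * real (card (nsets B c2))"
  have T0: "0 < T" using c1 c2 by (simp add: T_def zero_less_binomial)
  define I where "I x = {a \<in> A. (x - a) mod p \<in> B}" for x
  have I: "real (card (I x)) = reps (lift A) (lift B) x" for x
  proof -
    have "{a. a \<in> lift A \<and> x - a \<in> lift B} \<inter> {0..<p} = I x"
      using sub by (auto simp: I_def lift_def)
    then show ?thesis by (simp add: reps_def mu_card)
  qed
  define hit where "hit x z = (of_bool (\<exists>a\<in>I x. a \<in> fst z \<and> (x - a) mod p \<in> snd z) :: real)" for x and z :: "int set \<times> int set"
  have hits: "T * (reps (lift A) (lift B) x * q / (1 + reps (lift A) (lift B) x * q)) \<le> (\<Sum>z\<in>?Z. hit x z)" for x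
  proof -
    have "inj_on (\<lambda>a. (x - a) mod p) (I x)"
    proof (rule inj_onI)
      fix a b assume ab: "a \<in> I x" "b \<in> I x" "(x - a) mod p = (x - b) mod p"
      have "p dvd (x - a) - (x - b)" using ab(3) by (simp only: mod_eq_dvd_iff)
      then have "p dvd b - a" by simp
      then have "b mod p = a mod p" by (simp only: mod_eq_dvd_iff)
      moreover have "a \<in> {0..<p}" "b \<in> {0..<p}" using ab sub by (auto simp: I_def)
      ultimately show "a = b" by simp
    qed
    moreover have "I x \<subseteq> A" "(\<lambda>a. (x - a) mod p) ` I x \<subseteq> B" by (auto simp: I_def)
    ultimately show ?thesis
      using second_moment_hits[OF fin c1 c2 _ _ _ q, of "I x" "\<lambda>a. (x - a) mod p"]
      by (simp add: T_def I hit_def case_prod_unfold)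
  qed
  have sumset: "(\<Sum>x\<in>{0..<p}. hit x (A', B')) \<le> real (card (A' <+>\<^bsub>residue_ring p\<^esub> B'))"
    if "A' \<in> nsets A c1" "B' \<in> nsets B c2" for A' B'
  proof -
    have "(\<Sum>x\<in>{0..<p}. hit x (A', B')) = real (card ({0..<p} \<inter> {x. \<exists>a\<in>I x. a \<in> A' \<and> (x - a) mod p \<in> B'}))"
      by (simp add: hit_def)
    also have "\<dots> \<le> real (card (A' <+>\<^bsub>residue_ring p\<^esub> B'))"
    proof (intro of_nat_mono card_mono)
      show "{0..<p} \<inter> {x. \<exists>a\<in>I x. a \<in> A' \<and> (x - a) mod p \<in> B'} \<subseteq> A' <+>\<^bsub>residue_ring p\<^esub> B'"
      proof
        fix x assume "x \<in> {0..<p} \<inter> {x. \<exists>a\<in>I x. a \<in> A' \<and> (x - a) mod p \<in> B'}"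
        then obtain a where a: "a \<in> A'" "(x - a) mod p \<in> B'" "0 \<le> x" "x < p" by auto
        have "x = (a + (x - a) mod p) mod p" using a by (simp add: mod_add_right_eq)
        then have "x = a \<oplus>\<^bsub>residue_ring p\<^esub> ((x - a) mod p)" by (simp add: res_add_eq)
        then show "x \<in> A' <+>\<^bsub>residue_ring p\<^esub> B'" unfolding set_add_def' using a by blast
      qed
      have "finite A'" "finite B'" using that by (auto simp: nsets_def)
      then show "finite (A' <+>\<^bsub>residue_ring p\<^esub> B')" unfolding set_add_def' by simp
    qed
    finally show ?thesis .
  qed
  have "T * (\<Sum>x\<in>{0..<p}. reps (lift A) (lift B) x * q / (1 + reps (lift A) (lift B) x * q)) \<le>
      (\<Sum>x\<in>{0..<p}. \<Sum>z\<in>?Z. hit x z)"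
    unfolding sum_distrib_left by (intro sum_mono hits)
  also have "\<dots> = (\<Sum>z\<in>?Z. \<Sum>x\<in>{0..<p}. hit x z)" by (rule sum.swap)
  also have "\<dots> \<le> (\<Sum>z\<in>?Z. case z of (A', B') \<Rightarrow> real (card (A' <+>\<^bsub>residue_ring p\<^esub> B')))"
    by (intro sum_mono) (use sumset in auto)
  also have "\<dots> = T * expected_sumset_card (residue_ring p) A c1 B c2"
    unfolding expected_sumset_card_eq[OF fin c1(2) c2(2)] T_def[symmetric] using T0 by simp
  finally show ?thesis using T0 by (simp only: mult_le_cancel_left_pos)
qed

text \<open>\<open>S\<close> collects the residues whose expected number of representations is at
  least \<open>Y\<close>. Each of them contributes at least \<open>Y / (1 + Y)\<close> to the
  expectation, so \<open>S\<close> is small. A residue outside \<open>S\<close> contributes at least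
  \<open>q / (1 + Y)\<close> per representation, so these representations are few. A large
  \<open>Y\<close> improves the first bound at the cost of the second.\<close>

lemma popular_sums:
  assumes sub: "A \<subseteq> {0..<p}" "B \<subseteq> {0..<p}" and c1: "1 \<le> c1" "c1 \<le> card A" and c2: "1 \<le> c2" "c2 \<le> card B"
    and q: "q = real c1 * real c2 / (real (card A) * real (card B))" and Y: "0 < Y"
    and M: "expected_sumset_card (residue_ring p) A c1 B c2 \<le> M"
  shows "\<exists>S. periodic S \<and> mu S \<le> M * (1 + 1 / Y) \<and> bad_pairs S (lift A) (lift B) \<le> (1 + Y) * M / q"
proof -
  define r where "r = reps (lift A) (lift B)"
  have q0: "0 < q" using c1 c2 by (simp add: q)
  have r0: "0 \<le> r x" for x by (simp add: r_def reps_def)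
  have total: "(\<Sum>x\<in>{0..<p}. r x * q / (1 + r x * q)) \<le> M"
    using expected_sumset_card_ge[OF sub c1 c2 q] M unfolding r_def by linarith
  have rper: "r (x + p) = r x" for x
  proof -
    have "x + p - a \<in> lift B \<longleftrightarrow> x - a \<in> lift B" for a
      using periodicD[OF periodic_lift, of "x - a" B] by (simp add: algebra_simps)
    then show ?thesis by (simp add: r_def reps_def)
  qed
  define S where "S = {x. Y \<le> r x * q}"
  have perS: "periodic S" by (simp add: S_def periodic_def rper)
  have "mu S * (Y / (1 + Y)) = (\<Sum>x\<in>{0..<p}. of_bool (x \<in> S) * (Y / (1 + Y)))"
    by (simp only: mu_def sum_distrib_right)
  also have "\<dots> \<le> (\<Sum>x\<in>{0..<p}. r x * q / (1 + r x * q))"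
  proof (intro sum_mono)
    fix x
    have "0 \<le> r x * q" using r0 q0 by simp
    moreover have "Y / (1 + Y) \<le> r x * q / (1 + r x * q)" if "Y \<le> r x * q"
      using that Y by (simp add: field_simps)
    ultimately show "of_bool (x \<in> S) * (Y / (1 + Y)) \<le> r x * q / (1 + r x * q)" by (simp add: S_def)
  qed
  also note total
  finally have "mu S \<le> M * (1 + 1 / Y)" using Y by (simp add: field_simps)
  moreover have "bad_pairs S (lift A) (lift B) \<le> (1 + Y) * M / q"
  proof -
    have "bad_pairs S (lift A) (lift B) = (\<Sum>x\<in>{0..<p}. of_bool (x \<in> - S) * r x)"
      unfolding r_def sum_reps[OF periodic_lift periodic_Compl[OF perS]] by (simp add: bad_pairs_def)
    also have "\<dots> \<le> (\<Sum>x\<in>{0..<p}. (1 + Y) / q * (r x * q / (1 + r x * q)))"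
    proof (intro sum_mono)
      fix x
      have rq: "0 \<le> r x * q" using r0 q0 by simp
      have "r x \<le> (1 + Y) / q * (r x * q / (1 + r x * q))" if "r x * q < Y"
      proof -
        have "r x * (1 + r x * q) \<le> r x * (1 + Y)" using that r0 by (intro mult_left_mono) auto
        then show ?thesis using q0 rq by (simp add: field_simps add_pos_nonneg)
      qed
      moreover have "0 \<le> (1 + Y) / q * (r x * q / (1 + r x * q))"
        using rq q0 Y r0[of x] by (intro mult_nonneg_nonneg divide_nonneg_nonneg) auto
      moreover have "r x * q < Y" if "x \<notin> S" using that by (simp add: S_def)
      ultimately show "of_bool (x \<in> - S) * r x \<le> (1 + Y) / q * (r x * q / (1 + r x * q))"
        by (cases "x \<in> S") (simp_all only: Compl_iff of_bool_eq not_True_eq_False not_False_eq_True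
            mult_zero_left mult_1_left simp_thms)
    qed
    also have "\<dots> = (1 + Y) / q * (\<Sum>x\<in>{0..<p}. r x * q / (1 + r x * q))" by (simp only: sum_distrib_left)
    also have "\<dots> \<le> (1 + Y) / q * M" using total Y q0 by (intro mult_left_mono) auto
    finally show ?thesis by simp
  qed
  ultimately show ?thesis using perS by blast
qed

end

subsection \<open>Arithmetic progressions\<close>

context prime_modulus begin

text \<open>Multiplication by \<open>k\<close> maps an arc to a progression with difference
  \<open>k mod p\<close>. One \<open>k\<close> serves both sets, which is what gives the
  progressions a common difference.\<close>

lemma arith_prog_of_arc:
  assumes k: "coprime k p" and xy: "x < y"
  shows "\<exists>P. arith_prog (residue_ring p) (k mod p) P \<and> P \<subseteq> {0..<p} \<and> {z. k * z \<in> lift P} = cyc_arc x y"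
proof -
  interpret residues p "residue_ring p" by (rule residues_p) simp
  define d where "d = k mod p"
  have pow: "[i] \<cdot>\<^bsub>residue_ring p\<^esub> d = (int i * k) mod p" for i :: nat
  proof (induction i)
    case 0
    then show ?case by (simp add: res_zero_eq)
  next
    case (Suc i)
    have "[Suc i] \<cdot>\<^bsub>residue_ring p\<^esub> d = [i] \<cdot>\<^bsub>residue_ring p\<^esub> d \<oplus>\<^bsub>residue_ring p\<^esub> d" by simp
    also have "\<dots> = ((int i * k) mod p + k mod p) mod p" unfolding Suc by (simp add: res_add_eq d_def)
    also have "\<dots> = (int (Suc i) * k) mod p" by (simp add: mod_add_eq algebra_simps)
    finally show ?case .
  qed
  define P where "P = {(k * x) mod p \<oplus>\<^bsub>residue_ring p\<^esub> [i] \<cdot>\<^bsub>residue_ring p\<^esub> d | i::nat. i < nat (y - x)}"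
  have term_eq: "(k * x) mod p \<oplus>\<^bsub>residue_ring p\<^esub> [i] \<cdot>\<^bsub>residue_ring p\<^esub> d = (k * (x + int i)) mod p" for i
    by (simp add: pow res_add_eq mod_add_eq algebra_simps)
  have P: "w \<in> P \<longleftrightarrow> (\<exists>z. x \<le> z \<and> z < y \<and> w = (k * z) mod p)" for w
  proof
    assume "w \<in> P"
    then obtain i where i: "i < nat (y - x)" "w = (k * (x + int i)) mod p" by (auto simp: P_def term_eq)
    have "x \<le> x + int i" "x + int i < y" using i(1) by linarith+
    then show "\<exists>z. x \<le> z \<and> z < y \<and> w = (k * z) mod p" using i(2) by blast
  next
    assume "\<exists>z. x \<le> z \<and> z < y \<and> w = (k * z) mod p"
    then obtain z where z: "x \<le> z" "z < y" "w = (k * z) mod p" by blast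
    have "w = (k * (x + int (nat (z - x)))) mod p" "nat (z - x) < nat (y - x)" using z by auto
    then show "w \<in> P" unfolding P_def term_eq by blast
  qed
  have "\<not> p dvd k" using k prime_p by (metis coprime_common_divisor dvd_refl not_prime_unit)
  then have "d \<noteq> 0" by (simp add: d_def dvd_eq_mod_eq_0)
  then have "arith_prog (residue_ring p) d P"
    unfolding arith_prog_def
  proof (intro conjI bexI exI)
    show "d \<in> carrier (residue_ring p)" by (simp add: d_def)
    show "d \<noteq> \<zero>\<^bsub>residue_ring p\<^esub>" using \<open>d \<noteq> 0\<close> by (simp add: res_zero_eq)
    show "1 \<le> nat (y - x)" using xy by simp
    show "P = {(k * x) mod p \<oplus>\<^bsub>residue_ring p\<^esub> [i] \<cdot>\<^bsub>residue_ring p\<^esub> d | i::nat. i < nat (y - x)}"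
      by (rule P_def)
    show "(k * x) mod p \<in> carrier (residue_ring p)" by simp
  qed
  moreover have "P \<subseteq> {0..<p}" using P by auto
  moreover have "{z. k * z \<in> lift P} = cyc_arc x y"
  proof (rule Set.set_eqI)
    fix z
    have "k * z \<in> lift P \<longleftrightarrow> (\<exists>z'. x \<le> z' \<and> z' < y \<and> [z' = z] (mod p))"
    proof -
      have "(k * z) mod p = (k * z') mod p \<longleftrightarrow> [z' = z] (mod p)" for z'
        using cong_mult_lcancel[OF k, of z' z] unfolding cong_def by metis
      then show ?thesis by (simp add: lift_def P)
    qed
    also have "\<dots> \<longleftrightarrow> z \<in> cyc_arc x y"
    proof
      assume "\<exists>z'. x \<le> z' \<and> z' < y \<and> [z' = z] (mod p)"
      then obtain z' where z': "x \<le> z'" "z' < y" "[z' = z] (mod p)" by blast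
      then show "z \<in> cyc_arc x y" using periodic_cong_mem[OF periodic_arc z'(3)] arcI by blast
    next
      assume "z \<in> cyc_arc x y"
      then obtain j where "x \<le> z + j * p" "z + j * p < y" by (auto simp: cyc_arc_def)
      moreover have "[z + j * p = z] (mod p)" by (simp add: cong_def)
      ultimately show "\<exists>z'. x \<le> z' \<and> z' < y \<and> [z' = z] (mod p)" by blast
    qed
    finally show "z \<in> {z. k * z \<in> lift P} \<longleftrightarrow> z \<in> cyc_arc x y" by simp
  qed
  ultimately show ?thesis unfolding d_def by blast
qed

lemma card_sym_diff_lift:
  assumes "A \<subseteq> {0..<p}" "P \<subseteq> {0..<p}" and k: "coprime k p"
  shows "real (card (sym_diff A P)) =
    mu ({z. k * z \<in> lift A} - {z. k * z \<in> lift P}) + mu ({z. k * z \<in> lift P} - {z. k * z \<in> lift A})"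
proof -
  have diff: "mu ({z. k * z \<in> lift C} - {z. k * z \<in> lift D}) = card (C - D)" if "C \<subseteq> {0..<p}" for C D
  proof -
    have "{z. k * z \<in> lift C} - {z. k * z \<in> lift D} = {z. k * z + 0 \<in> lift (C - D)}"
      by (auto simp: lift_def)
    then have "mu ({z. k * z \<in> lift C} - {z. k * z \<in> lift D}) = mu (lift (C - D))"
      by (simp only: mu_affine[OF periodic_lift k])
    then show ?thesis using that mu_lift[of "C - D"] by auto
  qed
  have "finite A" "finite P" using assms finite_subset by blast+
  then have "card (sym_diff A P) = card (A - P) + card (P - A)" by (intro card_Un_disjoint) auto
  then show ?thesis using diff[OF assms(1)] diff[OF assms(2)] by simp
qed

lemma progressions_of_few_bad_pairs:
  fixes \<beta> \<theta> \<kappa> m H :: real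
  assumes sub: "A \<subseteq> {0..<p}" "B \<subseteq> {0..<p}" and perS: "periodic S"
    and m: "m = card B" "m \<le> card A" and \<beta>: "0 < \<beta>" "\<beta> \<le> 1" and sz: "real (card A) + card B \<le> (1 - \<beta>) * p"
    and H: "fourier_order \<le> H" "3060 \<le> H" and \<theta>: "0 < \<theta>" "\<kappa> = \<theta>\<^sup>2" "48 * H * \<kappa> \<le> \<beta>"
    and big: "5000 \<le> \<beta> * \<kappa> * m"
    and bad: "bad_pairs S (lift A) (lift B) \<le> (\<beta> * \<kappa> * m / 4000)\<^sup>2"
    and S: "mu S \<le> real (card A) + card B + \<beta> * \<kappa> * m / 4000"
    and err: "803 * \<theta> / \<beta> * m + 2 < \<beta> / 2 * m"
  shows "\<exists>d P Q. arith_prog (residue_ring p) d P \<and> arith_prog (residue_ring p) d Q \<and>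
    card (sym_diff A P) \<le> 803 * \<theta> / \<beta> * m + 1 \<and> card (sym_diff B Q) \<le> 803 * \<theta> / \<beta> * m + 1"
proof -
  note mus = mu_lift[OF sub(1)] mu_lift[OF sub(2)]
  obtain k x y x' y' where k: "coprime k p" "x < y" "x' < y'"
    "mu ({z. k * z \<in> lift A} - cyc_arc x y) + mu (cyc_arc x y - {z. k * z \<in> lift A}) \<le> 803 * \<theta> / \<beta> * m + 1"
    "mu ({z. k * z \<in> lift B} - cyc_arc x' y') + mu (cyc_arc x' y' - {z. k * z \<in> lift B}) \<le> 803 * \<theta> / \<beta> * m + 1"
    using near_arcs_of_few_bad_pairs[OF periodic_lift periodic_lift perS _ _ \<beta> _ H \<theta> big bad _ err]
      m sz S unfolding mus by blast
  obtain P where P: "arith_prog (residue_ring p) (k mod p) P" "P \<subseteq> {0..<p}" "{z. k * z \<in> lift P} = cyc_arc x y"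
    using arith_prog_of_arc[OF k(1,2)] by blast
  obtain Q where Q: "arith_prog (residue_ring p) (k mod p) Q" "Q \<subseteq> {0..<p}" "{z. k * z \<in> lift Q} = cyc_arc x' y'"
    using arith_prog_of_arc[OF k(1,3)] by blast
  show ?thesis
    using P Q k card_sym_diff_lift[OF sub(1) P(2) k(1)] card_sym_diff_lift[OF sub(2) Q(2) k(1)]
    by (intro exI[of _ "k mod p"] exI[of _ P] exI[of _ Q]) auto
qed

text \<open>The comparability of the two sizes bounds the expectation by a multiple of
  \<open>m\<close>, and a large \<open>c\<close> then makes the number of bad pairs a tiny multiple
  of \<open>m^2\<close>.\<close>

lemma progressions_of_small_expected_sumset:
  fixes \<beta> \<theta> \<epsilon> \<alpha> H c :: real
  assumes sub: "A \<subseteq> {0..<p}" "B \<subseteq> {0..<p}"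
    and c1: "1 \<le> c1" "c1 \<le> card A" and c2: "1 \<le> c2" "c2 \<le> card B"
    and prod: "c * max (card A) (card B) \<le> real c1 * real c2"
    and \<alpha>: "0 < \<alpha>" "\<alpha> * card B \<le> card A" "card A \<le> inverse \<alpha> * card B"
    and \<beta>: "0 < \<beta>" "\<beta> \<le> 1" and sz: "real (card A) + card B \<le> (1 - \<beta>) * p"
    and H: "fourier_order \<le> H" "3060 \<le> H" and \<theta>: "0 < \<theta>" "48 * H * \<theta>\<^sup>2 \<le> \<beta>"
    and \<epsilon>: "\<epsilon> = \<beta> * \<theta>\<^sup>2 / 8000"
    and m: "m = real (min (card A) (card B))"
    and E: "expected_sumset_card (residue_ring p) A c1 B c2 \<le> real (card A) + card B - 1 + \<epsilon> * m"
    and c: "5000 / (\<beta> * \<theta>\<^sup>2) \<le> c" "(1 + 3 / (\<alpha> * \<epsilon>)) * (3 / \<alpha>) / (2 * \<epsilon>)\<^sup>2 \<le> c"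
    and err: "803 * \<theta> / \<beta> * m + 2 < \<beta> / 2 * m"
  shows "\<exists>d P Q. arith_prog (residue_ring p) d P \<and> arith_prog (residue_ring p) d Q \<and>
    card (sym_diff A P) \<le> 803 * \<theta> / \<beta> * m + 1 \<and> card (sym_diff B Q) \<le> 803 * \<theta> / \<beta> * m + 1"
proof -
  define n where "n = real (max (card A) (card B))"
  have mn: "real (card A) * real (card B) = m * n" by (auto simp: m n_def min_def max_def)
  have m1: "1 \<le> m" "m \<le> n" using c1 c2 by (auto simp: m n_def)
  have AB2: "real (card A) + card B \<le> 2 * n" by (simp add: n_def)
  have n\<alpha>: "n \<le> m / \<alpha>" using \<alpha> by (auto simp: m n_def max_def min_def field_simps)
  have \<epsilon>0: "0 < \<epsilon>" using \<beta> \<theta> by (simp add: \<epsilon>)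
  have "48 * 3060 * \<theta>\<^sup>2 \<le> 48 * H * \<theta>\<^sup>2" using H by (intro mult_right_mono) auto
  then have \<theta>1: "\<theta>\<^sup>2 \<le> 1" using \<theta>(2) \<beta>(2) by linarith
  have \<epsilon>1: "\<epsilon> \<le> 1" using \<theta>1 \<beta> mult_mono[of \<beta> 1 "\<theta>\<^sup>2" 1] by (simp add: \<epsilon>)
  define M where "M = real (card A) + card B - 1 + \<epsilon> * m"
  have "\<epsilon> * m \<le> 1 * n" using \<epsilon>1 m1 \<epsilon>0 by (intro mult_mono) auto
  then have M: "M \<le> 3 * n" "M \<le> 3 * (m / \<alpha>)" using AB2 n\<alpha> by (simp_all add: M_def)
  have M0: "0 \<le> M"
  proof -
    have "1 \<le> real (card A)" using c1 by simp
    moreover have "0 \<le> \<epsilon> * m" using \<epsilon>0 m1 by simp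
    ultimately show ?thesis unfolding M_def by linarith
  qed
  define q where "q = real c1 * real c2 / (real (card A) * real (card B))"
  \<comment> \<open>Chosen so that the excess \<open>M / Y\<close> in the size of \<open>S\<close>
    is at most \<open>\<epsilon> * m\<close>.\<close>
  define Y where "Y = 3 / (\<alpha> * \<epsilon>)"
  have Y0: "0 < Y" using \<alpha> \<epsilon>0 by (simp add: Y_def)
  obtain S where S: "periodic S" "mu S \<le> M * (1 + 1 / Y)" "bad_pairs S (lift A) (lift B) \<le> (1 + Y) * M / q"
    using popular_sums[OF sub c1 c2 q_def Y0, of M] E by (auto simp: M_def)
  have "M / Y \<le> 3 * (m / \<alpha>) / Y" using M Y0 by (intro divide_right_mono) auto
  also have "\<dots> = \<epsilon> * m" using \<alpha> \<epsilon>0 by (simp add: Y_def field_simps)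
  finally have MY: "M / Y \<le> \<epsilon> * m" .
  have "M * (1 + 1 / Y) = M + M / Y" by (simp add: distrib_left)
  then have muS: "mu S \<le> real (card A) + card B + 2 * \<epsilon> * m"
    using S(2) MY unfolding M_def by linarith
  have c0: "0 < c"
  proof -
    have "0 < 5000 / (\<beta> * \<theta>\<^sup>2)" using \<beta> \<theta> by simp
    then show ?thesis using c by linarith
  qed
  have cn: "c * n \<le> real c1 * real c2" using prod by (simp add: n_def)
  \<comment> \<open>The product \<open>c1 * c2\<close> cannot exceed \<open>m * n\<close>, so a
    large \<open>c\<close> also forces both sets to be large.\<close>
  have cm: "c \<le> m"
  proof -
    have "real c1 * real c2 \<le> real (card A) * real (card B)" using c1 c2 by (intro mult_mono) auto
    then have "c * n \<le> m * n" using cn mn by linarith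
    then show ?thesis using m1 by simp
  qed
  have bad: "bad_pairs S (lift A) (lift B) \<le> (2 * \<epsilon> * m)\<^sup>2"
  proof -
    have c12: "0 < real c1 * real c2" using c1 c2 by simp
    have "(1 + Y) * M / q = (1 + Y) * M * (m * n / (real c1 * real c2))"
      unfolding q_def mn by simp
    also have "\<dots> \<le> (1 + Y) * (3 * (m / \<alpha>)) * (m / c)"
    proof (intro mult_mono)
      have "m * (c * n) \<le> m * (real c1 * real c2)" using cn m1 by (intro mult_left_mono) auto
      then show "m * n / (real c1 * real c2) \<le> m / c" using c12 c0 by (simp add: field_simps)
    qed (use M M0 Y0 m1 \<alpha> c0 c12 in auto)
    also have "\<dots> = (1 + Y) * (3 / \<alpha>) / c * m\<^sup>2" by (simp add: power2_eq_square)
    also have "\<dots> \<le> (2 * \<epsilon>)\<^sup>2 * m\<^sup>2"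
    proof (intro mult_right_mono)
      show "(1 + Y) * (3 / \<alpha>) / c \<le> (2 * \<epsilon>)\<^sup>2"
      proof -
        have "0 < (2 * \<epsilon>)\<^sup>2" using \<epsilon>0 by simp
        then have "(1 + Y) * (3 / \<alpha>) \<le> c * (2 * \<epsilon>)\<^sup>2"
          using c(2) unfolding Y_def by (simp only: pos_divide_le_eq)
        then show ?thesis using c0 by (simp only: pos_divide_le_eq mult.commute)
      qed
    qed simp
    finally show ?thesis using S(3) by (simp add: power_mult_distrib)
  qed
  have e2: "2 * \<epsilon> * m = \<beta> * \<theta>\<^sup>2 * m / 4000" by (simp add: \<epsilon>)
  have big: "5000 \<le> \<beta> * \<theta>\<^sup>2 * m"
  proof -
    have "5000 / (\<beta> * \<theta>\<^sup>2) \<le> m" using c(1) cm by linarith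
    then show ?thesis using \<beta> \<theta> by (simp add: pos_divide_le_eq mult.commute)
  qed
  show ?thesis
  proof (cases "card B \<le> card A")
    case True
    then have "m = card B" "m \<le> card A" by (auto simp: m)
    then show ?thesis
      using progressions_of_few_bad_pairs[OF sub S(1) _ _ \<beta> sz H \<theta>(1) refl \<theta>(2) big _ _ err]
        bad muS unfolding e2 by blast
  next
    case False
    then have mA: "m = card A" "m \<le> card B" by (auto simp: m)
    have "bad_pairs S (lift B) (lift A) \<le> (\<beta> * \<theta>\<^sup>2 * m / 4000)\<^sup>2"
      using bad unfolding e2 bad_pairs_commute[of S "lift B"] .
    moreover have "mu S \<le> real (card B) + card A + \<beta> * \<theta>\<^sup>2 * m / 4000"
      using muS unfolding e2 by linarith
    moreover have "real (card B) + card A \<le> (1 - \<beta>) * p" using sz by linarith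
    ultimately show ?thesis
      using progressions_of_few_bad_pairs[OF sub(2,1) S(1) mA \<beta> _ H \<theta>(1) refl \<theta>(2) big _ _ err]
      by blast
  qed
qed

end

theorem theorem6:
  shows "\<forall>\<beta> \<gamma> :: real. 0 < \<beta> \<longrightarrow> 0 < \<gamma> \<longrightarrow>
    (\<exists>\<epsilon>::real. 0 < \<epsilon> \<and>
      (\<forall>\<alpha>::real. 0 < \<alpha> \<longrightarrow>
        (\<exists>c::real.
          \<forall>(p::int) (A::int set) (B::int set) (c1::nat) (c2::nat).
            prime p \<longrightarrow>
            A \<subseteq> carrier (residue_ring p) \<longrightarrow>
            B \<subseteq> carrier (residue_ring p) \<longrightarrow>
            1 \<le> c1 \<longrightarrow> c1 \<le> card A \<longrightarrow>
            1 \<le> c2 \<longrightarrow> c2 \<le> card B \<longrightarrow>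
            real c1 * real c2 \<ge> c * real (max (card A) (card B)) \<longrightarrow>
            2 \<le> min (card A) (card B) \<longrightarrow>
            \<alpha> * real (card B) \<le> real (card A) \<longrightarrow>
            real (card A) \<le> inverse \<alpha> * real (card B) \<longrightarrow>
            real (card A) + real (card B) \<le> (1 - \<beta>) * real_of_int p \<longrightarrow>
            expected_sumset_card (residue_ring p) A c1 B c2
              \<le> real (card A) + real (card B) - 1 + \<epsilon> * real (min (card A) (card B)) \<longrightarrow>
            (\<exists>d P Q. arith_prog (residue_ring p) d P \<and> arith_prog (residue_ring p) d Q \<and>
              real (max (card (sym_diff A P)) (card (sym_diff B Q)))
                \<le> \<gamma> * real (min (card A) (card B))))))"
proof (intro allI impI, goal_cases)
  case (1 \<beta> \<gamma>)
  note \<beta> = 1(1) and \<gamma> = 1(2)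
  \<comment> \<open>The lemmas ask for a proportion of at most 1.\<close>
  define b where "b = min \<beta> 1"
  \<comment> \<open>Lowering \<gamma> only strengthens the conclusion; the bound
    \<open>b / 2\<close> provides the strict inequality \<open>err\<close>.\<close>
  define \<rho> where "\<rho> = min \<gamma> (b / 2)"
  define H where "H = max (real fourier_order) 3060"
  \<comment> \<open>The first term makes \<open>803 * \<theta> / b\<close> at most
    \<open>\<rho> / 2\<close>, as \<open>1606 = 2 * 803\<close>; the second yields
    \<open>48 * H * \<theta>^2 \<le> b\<close>. Neither involves \<alpha>, so \<epsilon> is
    independent of it.\<close>
  define \<theta> where "\<theta> = min (\<rho> * b / 1606) (b / (48 * H))"
  define \<epsilon> where "\<epsilon> = b * \<theta>\<^sup>2 / 8000"
  have b: "0 < b" "b \<le> 1" using \<beta> by (auto simp: b_def)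
  have \<rho>: "0 < \<rho>" "\<rho> \<le> \<gamma>" "\<rho> \<le> b / 2" using \<gamma> b by (auto simp: \<rho>_def)
  have H: "fourier_order \<le> H" "3060 \<le> H" by (auto simp: H_def)
  have \<theta>0: "0 < \<theta>" using b \<rho> H by (simp add: \<theta>_def)
  have "\<theta> \<le> b / (48 * H)" by (simp add: \<theta>_def)
  then have \<theta>b: "48 * H * \<theta> \<le> b" using H by (simp add: pos_le_divide_eq mult.commute)
  have "48 * 3060 * \<theta> \<le> 48 * H * \<theta>" using H \<theta>0 by (intro mult_right_mono) auto
  then have \<theta>1: "\<theta> \<le> 1" using \<theta>b b \<theta>0 by linarith
  have \<theta>H: "48 * H * \<theta>\<^sup>2 \<le> b"
  proof -
    have "48 * H * \<theta> * \<theta> \<le> b * 1" using \<theta>b \<theta>1 \<theta>0 b H by (intro mult_mono) auto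
    then show ?thesis by (simp add: power2_eq_square mult.assoc)
  qed
  have \<theta>\<rho>: "803 * \<theta> / b \<le> \<rho> / 2"
  proof -
    have "\<theta> \<le> \<rho> * b / 1606" by (simp add: \<theta>_def)
    then show ?thesis using b by (simp add: field_simps)
  qed
  have \<epsilon>0: "0 < \<epsilon>" using b \<theta>0 by (simp add: \<epsilon>_def)
  show ?case
  proof (rule exI[of _ \<epsilon>], intro conjI allI impI, goal_cases)
    case 1
    show ?case by (rule \<epsilon>0)
  next
    case (2 \<alpha>)
    note \<alpha> = 2
    \<comment> \<open>The term \<open>8 / \<rho>\<close> makes \<open>\<rho> * m\<close> at least 8,
      which absorbs the additive constants 1 and 2 in the error bounds.\<close>
    define c where "c = max (8 / \<rho>) (max (5000 / (b * \<theta>\<^sup>2)) ((1 + 3 / (\<alpha> * \<epsilon>)) * (3 / \<alpha>) / (2 * \<epsilon>)\<^sup>2))"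
    show ?case
    proof (rule exI[of _ c], intro allI impI, goal_cases)
      case (1 p A B c1 c2)
      note p = 1(1) and AB = 1(2,3) and c1 = 1(4,5) and c2 = 1(6,7) and prod = 1(8)
        and comparable = 1(10,11) and sz = 1(12) and E = 1(13)
      interpret prime_modulus p by (unfold_locales) (rule p)
      define m where "m = real (min (card A) (card B))"
      define n where "n = real (max (card A) (card B))"
      have "carrier (residue_ring p) = {0..<p}" by (auto simp: residue_ring_def)
      then have sub: "A \<subseteq> {0..<p}" "B \<subseteq> {0..<p}" using AB by simp_all
      have szb: "real (card A) + real (card B) \<le> (1 - b) * real_of_int p"
      proof -
        have "(1 - \<beta>) * real_of_int p \<le> (1 - b) * real_of_int p"
          by (intro mult_right_mono) (auto simp: b_def)
        then show ?thesis using sz by linarith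
      qed
      have "c \<le> m"
      proof -
        have "real c1 * real c2 \<le> real (card A) * real (card B)" using c1 c2 by (intro mult_mono) auto
        also have "\<dots> = m * n" by (auto simp: m_def n_def min_def max_def)
        finally have "c * n \<le> m * n" using prod by (simp add: n_def)
        moreover have "0 < n" using c1 by (simp add: n_def)
        ultimately show ?thesis by simp
      qed
      moreover have "8 / \<rho> \<le> c" by (simp add: c_def)
      ultimately have "8 / \<rho> \<le> m" by linarith
      then have \<rho>m: "8 \<le> \<rho> * m" using \<rho> by (simp add: pos_divide_le_eq mult.commute)
      have m0: "0 \<le> m" by (simp add: m_def)
      have \<theta>m: "803 * \<theta> / b * m \<le> \<rho> / 2 * m" using \<theta>\<rho> m0 by (rule mult_right_mono)
      have "\<rho> * m \<le> b / 2 * m" using \<rho> m0 by (intro mult_right_mono) auto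
      then have err: "803 * \<theta> / b * m + 2 < b / 2 * m" using \<theta>m \<rho>m by linarith
      have E': "expected_sumset_card (residue_ring p) A c1 B c2
              \<le> real (card A) + real (card B) - 1 + \<epsilon> * m" using E by (simp add: m_def)
      have "5000 / (b * \<theta>\<^sup>2) \<le> c" "(1 + 3 / (\<alpha> * \<epsilon>)) * (3 / \<alpha>) / (2 * \<epsilon>)\<^sup>2 \<le> c"
        unfolding c_def by linarith+
      then obtain d P Q where dPQ: "arith_prog (residue_ring p) d P" "arith_prog (residue_ring p) d Q"
          "card (sym_diff A P) \<le> 803 * \<theta> / b * m + 1" "card (sym_diff B Q) \<le> 803 * \<theta> / b * m + 1"
        using progressions_of_small_expected_sumset[OF sub c1 c2 prod \<alpha> comparable b szb H \<theta>0 \<theta>H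
            \<epsilon>_def m_def E' _ _ err]
        by blast
      have "803 * \<theta> / b * m + 1 \<le> \<gamma> * m"
        using \<theta>m \<rho>m mult_right_mono[OF \<rho>(2) m0] by linarith
      then have "real (max (card (sym_diff A P)) (card (sym_diff B Q))) \<le> \<gamma> * m" using dPQ by simp
      then show ?case using dPQ unfolding m_def by blast
    qed
  qed
qed

end
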